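(* Let $r\ge1$, let $N$ be a non-negative integer, and let $a,b,c_1,\dots,c_{r+1},d,x_1,\dots,x_r$ be nonzero complex parameters, generic subject to the relation $a^2q^{N+1}=bc_1\cdots c_{r+1}dx_1\cdots x_r$. Put $C=c_1\cdots c_{r+1}$ and $X=x_1\cdots x_r$. Then $$\sum_{\substack{k_1,\dots,k_r\ge0\\ 0\le|\mathbf k|\le N}}\frac{\Delta(\mathbf xq^{\mathbf k};p)}{\Delta(\mathbf x;p)}\frac{\theta(aq^{2|\mathbf k|};p)}{\theta(a;p)}\frac{(a,b,q^{-N};q,p)_{|\mathbf k|}}{(aq/b,aq^{N+1};q,p)_{|\mathbf k|}}q^{|\mathbf k|}$$ $$\times\prod_{i=1}^r\frac{(aq/CXx_i;q,p)_{|\mathbf k|-k_i}\,(d/x_i;q,p)_{|\mathbf k|}\prod_{j=1}^{r+1}(c_jx_i;q,p)_{k_i}}{(d/x_i;q,p)_{|\mathbf k|-k_i}\,(ax_iq/d;q,p)_{k_i}\prod_{j=1}^r(qx_i/x_j;q,p)_{k_i}}\prod_{i=1}^{r+1}\frac1{(ac_iq/CX;q,p)_{|\mathbf k|}}$$ $$=\frac{(aq;q,p)_N}{b^N(aq/b;q,p)_N}\prod_{i=1}^r\frac{(ax_iq/bd;q,p)_N}{(ax_iq/d;q,p)_N}\prod_{i=1}^{r+1}\frac{(aq/c_id;q,p)_N}{(aq/bc_id;q,p)_N}.$$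
   Context: $p,q$ are complex numbers with $|p|<1$, $q\ne0$, and $q^k\notin p^{\mathbb Z}$ for all integers $k>0$ (if $p=0$: $q^k\ne1$). For $x\ne0$, $\theta(x;p)=\prod_{j=0}^\infty(1-p^jx)(1-p^{j+1}/x)$. Elliptic shifted factorials: $(a;q,p)_k=\prod_{j=0}^{k-1}\theta(aq^j;p)$ for $k\in\mathbb Z_{\ge0}$, and $(a_1,\dots,a_m;q,p)_k=(a_1;q,p)_k\cdots(a_m;q,p)_k$. For $\mathbf k=(k_1,\dots,k_r)$, $|\mathbf k|=k_1+\cdots+k_r$. For $\mathbf x=(x_1,\dots,x_r)$, $\Delta(\mathbf x;p)=\prod_{1\le i<j\le r}x_j\theta(x_i/x_j;p)$, and $\mathbf xq^{\mathbf k}=(x_1q^{k_1},\dots,x_rq^{k_r})$. In expressions such as $aq/CXx_i$, everything after the slash is in the denominator. All parameters are assumed generic so that no denominator vanishes. *)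

theory Defs
  imports "HOL-Analysis.Analysis"
begin

text \<open>
  Modified Jacobi theta function. Since \<open>0 ^ 0 = 1\<close>, it specialises to \<open>1 - x\<close> for nome \<open>p = 0\<close>.
\<close>

definition jtheta :: "complex \<Rightarrow> complex \<Rightarrow> complex" where
  "jtheta p x = prodinf (\<lambda>j. (1 - p ^ j * x) * (1 - p ^ (j + 1) / x))"

text \<open>Elliptic shifted factorial \<open>(a; q, p)\<^sub>k\<close>.\<close>

definition efact :: "complex \<Rightarrow> complex \<Rightarrow> complex \<Rightarrow> nat \<Rightarrow> complex" where
  "efact q p a k = (\<Prod>j<k. jtheta p (a * q ^ j))"

text \<open>
  Tuples \<open>(z\<^sub>1, \<dots>, z\<^sub>r)\<close> are functions on \<open>nat\<close> of which only the values on \<open>{1..r}\<close> matter.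
\<close>

definition Delta :: "nat \<Rightarrow> complex \<Rightarrow> (nat \<Rightarrow> complex) \<Rightarrow> complex" where
  "Delta r p x = (\<Prod>i\<in>{1..r}. \<Prod>j\<in>{i<..r}. x j * jtheta p (x i / x j))"

definition msize :: "nat \<Rightarrow> (nat \<Rightarrow> nat) \<Rightarrow> nat" where
  "msize r k = (\<Sum>i=1..r. k i)"

text \<open>
  The multi-indices \<open>k\<close> with \<open>|k| \<le> N\<close>. Extensionality (\<open>k i = undefined\<close> outside \<open>{1..r}\<close>)
  makes each tuple occur exactly once, so that sums over this set are finite sums.
\<close>

definition multi_indices :: "nat \<Rightarrow> nat \<Rightarrow> (nat \<Rightarrow> nat) set" where
  "multi_indices r N = {k \<in> {1..r} \<rightarrow>\<^sub>E UNIV. msize r k \<le> N}"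

lemma finite_multi_indices: "finite (multi_indices r N)"
proof (rule finite_subset)
  show "multi_indices r N \<subseteq> {1..r} \<rightarrow>\<^sub>E {..N}"
  proof
    fix k assume k: "k \<in> multi_indices r N"
    have "k i \<le> N" if "i \<in> {1..r}" for i
    proof -
      have "k i \<le> msize r k"
        unfolding msize_def using that by (intro member_le_sum) auto
      with k show ?thesis by (simp add: multi_indices_def)
    qed
    with k show "k \<in> {1..r} \<rightarrow>\<^sub>E {..N}"
      by (auto simp: multi_indices_def PiE_iff)
  qed
qed (intro finite_PiE; simp)

text \<open>
  The conditions on base and nome. As \<open>0 powi m\<close> is \<open>1\<close> for \<open>m = 0\<close> and \<open>0\<close> otherwise, and
  \<open>q \<noteq> 0\<close>, the last conjunct reads \<open>q ^ k \<noteq> 1\<close> when \<open>p = 0\<close>.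
\<close>

definition base_nome :: "complex \<Rightarrow> complex \<Rightarrow> bool" where
  "base_nome q p \<longleftrightarrow> norm p < 1 \<and> q \<noteq> 0 \<and> (\<forall>k>0. \<forall>m::int. q ^ k \<noteq> p powi m)"

end

(*
  Fix c_1 c_2. After clearing the denominators (ac_i q/CX)_N for i = 1, 2, the factors of each term
  that involve c_1 or c_2 form a product of N pairs of theta functions (|k| pairs from the x_i and
  N - |k| from the denominators), and the right-hand side is another such product. Put u = aq/bd and w = aq/d. Peeling off the first factor of the product on the
  right and expanding it in the r + 1 first factors available on the left (a partial fraction
  expansion with weights beta_0, ..., beta_r of total 1) expresses the sum for N, divided by the
  right-hand side, as a weighted mean of sums for N - 1, in which w has become wq and either u
  or one of the x_i has been multiplied by q. That the coefficients obey the same recursion is a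
  second partial fraction expansion. Hence all normalized sums equal 1 by induction on N.
  Partial fractions follow from the three-term addition formula of Weierstrass, which in turn
  follows from Liouville's theorem. The induction needs parameters for which no theta function
  vanishes on any shift by a power of q; the general case follows by continuity.
*)
theory Submission
  imports Defs "HOL-Complex_Analysis.Complex_Analysis"
begin

section \<open>The theta function\<close>

text \<open>The recursion can be matched summand by summand because x_m -> q x_m together with k_m
  -> k_m - 1 leaves the vector x q^k, hence Delta(x q^k), unchanged; the other move, u -> uq and w
  -> wq, keeps x and k. Both moves fix the c_j. The weights are free of k and so come out of the sum
  over k. The second expansion depends on k through its zeros x_j q^(k_j) and its point d q^(|k|-1);
  its terms vanish where a shifted summand would leave the range of summation, that is for k_m = 0
  and for |k| = N. Both expansions are instances of one theta identity with r + 2 zeros and r + 2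
  points of equal product. For the first one, equality of the products is the relation a^2 q^(N+1) =
  bCdX; the second is balanced identically. The obstacle is division: the normalization divides by
  numerators of the right-hand side, and the induction visits shifted parameters, whereas the
  theorem only keeps its own denominators away from 0. A deformation in one parameter t, with
  different powers of t attached to the arguments, makes all of them generic at once, for all but
  countably many t.\<close>

definition qpoch :: "complex \<Rightarrow> complex \<Rightarrow> complex" where
  "qpoch p x = prodinf (\<lambda>j. 1 - p ^ j * x)"

lemma convergent_prod_qpoch:
  fixes p x :: complex
  assumes "norm p < 1"
  shows "convergent_prod (\<lambda>j. 1 - p ^ j * x)"
proof (rule abs_convergent_prod_imp_convergent_prod, subst abs_convergent_prod_conv_summable)
  have "summable (\<lambda>j. norm p ^ j * norm x)"
    using assms by (intro summable_mult2 summable_geometric) auto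
  then show "summable (\<lambda>j. norm (1 - p ^ j * x - 1))"
    by (simp add: norm_mult norm_power)
qed

lemma qpoch_tendsto:
  assumes "norm p < 1"
  shows "(\<lambda>n. \<Prod>j<n. 1 - p ^ j * x) \<longlonglongrightarrow> qpoch p x"
  using convergent_prod_LIMSEQ[OF convergent_prod_qpoch[OF assms, of x]]
  by (subst LIMSEQ_lessThan_iff_atMost) (simp add: qpoch_def)

lemma qpoch_holomorphic:
  assumes "norm p < 1"
  shows "qpoch p holomorphic_on A"
proof (rule holomorphic_on_subset)
  show "qpoch p holomorphic_on UNIV"
  proof (rule holomorphic_uniform_sequence)
    show "open (UNIV :: complex set)" by simp
    show "(\<lambda>x. \<Prod>j<n. 1 - p ^ j * x) holomorphic_on UNIV" for n
      by (intro holomorphic_intros)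
    show "\<exists>d>0. cball x d \<subseteq> UNIV \<and>
        uniform_limit (cball x d) (\<lambda>n x. \<Prod>j<n. 1 - p ^ j * x) (qpoch p) sequentially"
      for x
    proof (intro exI conjI)
      have "uniformly_convergent_on (cball x 1) (\<lambda>n x. \<Prod>j<n. 1 - p ^ j * x)"
      proof (rule uniformly_convergent_on_prod')
        show "uniformly_convergent_on (cball x 1)
            (\<lambda>n x. \<Sum>j<n. norm (1 - p ^ j * x - 1))"
        proof (rule Weierstrass_m_test')
          fix n y assume "y \<in> cball x 1"
          then have "norm y \<le> norm x + 1"
            by (metis mem_cball dist_norm norm_triangle_sub add.commute add_le_cancel_left
                norm_minus_commute order_trans)
          then show "norm (norm (1 - p ^ n * y - 1)) \<le> norm p ^ n * (norm x + 1)"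
            by (simp add: norm_mult norm_power mult_left_mono)
        next
          show "summable (\<lambda>n. norm p ^ n * (norm x + 1))"
            using assms by (intro summable_mult2 summable_geometric) auto
        qed
      qed (auto intro!: continuous_intros)
      \<comment> \<open>The uniform limit is the pointwise one, which \<open>qpoch_tendsto\<close>
        identifies.\<close>
      then show "uniform_limit (cball x 1) (\<lambda>n x. \<Prod>j<n. 1 - p ^ j * x) (qpoch p) sequentially"
        by (rule uniformly_convergent_uniform_limit_iff[THEN iffD1, THEN uniform_limit_cong'[THEN iffD1, rotated -1]])
          (auto intro!: limI qpoch_tendsto assms)
    qed auto
  qed
qed simp

lemma qpoch_eq_0_iff:
  assumes "norm p < 1"
  shows "qpoch p x = 0 \<longleftrightarrow> (\<exists>j. p ^ j * x = 1)"
  using has_prod_eq_0_iff[OF convergent_prod_has_prod[OF convergent_prod_qpoch[OF assms, of x]]]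
  by (auto simp: qpoch_def)

lemma qpoch_rec:
  assumes "norm p < 1"
  shows "qpoch p x = (1 - x) * qpoch p (p * x)"
proof -
  have "(\<lambda>n. \<Prod>j<Suc n. 1 - p ^ j * x) \<longlonglongrightarrow> qpoch p x"
    using qpoch_tendsto[OF assms] by (rule LIMSEQ_Suc)
  moreover have "(\<Prod>j<Suc n. 1 - p ^ j * x) = (1 - x) * (\<Prod>j<n. 1 - p ^ j * (p * x))" for n
    by (subst prod.lessThan_Suc_shift) (simp add: algebra_simps)
  ultimately have "(\<lambda>n. (1 - x) * (\<Prod>j<n. 1 - p ^ j * (p * x))) \<longlonglongrightarrow> qpoch p x"
    by simp
  moreover have "(\<lambda>n. (1 - x) * (\<Prod>j<n. 1 - p ^ j * (p * x))) \<longlonglongrightarrow> (1 - x) * qpoch p (p * x)"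
    by (intro tendsto_intros qpoch_tendsto assms)
  ultimately show ?thesis
    using LIMSEQ_unique by blast
qed

lemma jtheta_qpoch:
  assumes "norm p < 1"
  shows "jtheta p x = qpoch p x * qpoch p (p / x)"
proof -
  have "jtheta p x = prodinf (\<lambda>j. (1 - p ^ j * x) * (1 - p ^ j * (p / x)))"
    unfolding jtheta_def by (intro prodinf_cong) (simp add: mult.commute)
  then show ?thesis
    unfolding qpoch_def using prodinf_mult[OF convergent_prod_qpoch[OF assms] convergent_prod_qpoch[OF assms]]
    by metis
qed

text \<open>The factor besides 1 - x is symmetric under x -> 1/x and nonzero at 1. The reflection
  formula and the simplicity of the zero at 1 are read off from this form, for p = 0 as
  well.\<close>

lemma jtheta_split:
  assumes "norm p < 1"
  shows "jtheta p x = (1 - x) * (qpoch p (p * x) * qpoch p (p / x))"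
  using assms by (simp add: jtheta_qpoch qpoch_rec[of p x])

lemma jtheta_one [simp]: "norm p < 1 \<Longrightarrow> jtheta p 1 = 0"
  by (simp add: jtheta_split)

lemma jtheta_inverse:
  assumes "norm p < 1" "x \<noteq> 0"
  shows "jtheta p (1 / x) = - jtheta p x / x"
  using assms by (simp add: jtheta_split field_simps)

lemma jtheta_swap:
  assumes "norm p < 1" "x \<noteq> 0" "y \<noteq> 0"
  shows "jtheta p (x / y) = - (x / y) * jtheta p (y / x)"
  using jtheta_inverse[OF assms(1), of "y / x"] assms by simp

text \<open>Under x -> px the first infinite product loses the factor 1 - x and the second gains 1 -
  1/x; the quotient of these is -1/x.\<close>

lemma jtheta_shift:
  assumes "norm p < 1" "p \<noteq> 0" "x \<noteq> 0"
  shows "jtheta p (p * x) = - jtheta p x / x"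
proof -
  have "qpoch p (1 / x) = (1 - 1 / x) * qpoch p (p / x)"
    using qpoch_rec[OF assms(1), of "1 / x"] by simp
  then have "jtheta p (p * x) = qpoch p (p * x) * ((1 - 1 / x) * qpoch p (p / x))"
    using assms by (simp add: jtheta_qpoch[of p "p * x"])
  then show ?thesis
    using assms by (simp add: jtheta_split[of p x] divide_simps) (simp add: algebra_simps)
qed

lemma jtheta_eq_0D:
  assumes "norm p < 1" "x \<noteq> 0" "jtheta p x = 0"
  obtains m :: int where "x = p powi m"
proof -
  have "qpoch p x = 0 \<or> qpoch p (p / x) = 0"
    using assms by (simp add: jtheta_qpoch)
  then obtain j where "p ^ j * x = 1 \<or> p ^ j * (p / x) = 1"
    using qpoch_eq_0_iff[OF assms(1)] by blast
  then show ?thesis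
  proof
    assume *: "p ^ j * x = 1"
    \<comment> \<open>For p = 0 the equation forces j = 0, so no inverse of 0 with its default value
      occurs.\<close>
    then have "x = p powi (- int j)"
      by (cases "p ^ j = 0") (auto simp: power_int_minus field_simps)
    then show ?thesis by (rule that)
  next
    assume *: "p ^ j * (p / x) = 1"
    then have "x = p powi (int (Suc j))"
      using assms(2) by (simp add: field_simps del: of_nat_Suc)
    then show ?thesis by (rule that)
  qed
qed

lemma jtheta_zeros_countable:
  assumes "norm p < 1"
  shows "countable {x. x \<noteq> 0 \<and> jtheta p x = 0}"
proof (rule countable_subset)
  show "{x. x \<noteq> 0 \<and> jtheta p x = 0} \<subseteq> range (\<lambda>m::int. p powi m)"
    using jtheta_eq_0D[OF assms] by blast
qed simp

lemma jtheta_holomorphic: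
  assumes "norm p < 1" "0 \<notin> A"
  shows "jtheta p holomorphic_on A"
proof -
  have "(\<lambda>x. qpoch p x * qpoch p (p / x)) holomorphic_on A"
    using assms
    by (intro holomorphic_intros qpoch_holomorphic holomorphic_on_compose_gen
        [of "\<lambda>x. p / x" A "qpoch p" UNIV, unfolded o_def]) auto
  moreover have "jtheta p = (\<lambda>x. qpoch p x * qpoch p (p / x))"
    using jtheta_qpoch[OF assms(1)] by blast
  ultimately show ?thesis by simp
qed

lemma jtheta_holomorphic_compose [holomorphic_intros]:
  assumes "norm p < 1" "f holomorphic_on A" "\<And>z. z \<in> A \<Longrightarrow> f z \<noteq> 0"
  shows "(\<lambda>z. jtheta p (f z)) holomorphic_on A"
proof -
  have "jtheta p holomorphic_on -{0}" "f ` A \<subseteq> -{0}"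
    using assms jtheta_holomorphic by auto
  from holomorphic_on_compose_gen[OF assms(2) this] show ?thesis
    by (simp add: o_def)
qed

lemma tendsto_jtheta [tendsto_intros]:
  assumes "norm p < 1" "(f \<longlongrightarrow> l) F" "l \<noteq> 0"
  shows "((\<lambda>t. jtheta p (f t)) \<longlongrightarrow> jtheta p l) F"
proof -
  have "continuous_on (-{0}) (jtheta p)"
    using jtheta_holomorphic[OF assms(1), of "-{0}"] by (intro holomorphic_on_imp_continuous_on) auto
  then have "isCont (jtheta p) l"
    using assms(3) by (simp add: continuous_on_eq_continuous_at open_delete[of UNIV, simplified] Compl_eq_Diff_UNIV)
  then show ?thesis
    using assms(2) by (rule isCont_tendsto_compose)
qed

text \<open>The device behind every removal of a genericity condition: nonzero zeros of theta are
  powers of p, so the bad values of a parameter are countable, while a disc is not.\<close>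

lemma countable_avoiding_sequence:
  fixes z :: complex
  assumes "countable B"
  obtains t where "t \<longlonglongrightarrow> z" "\<And>n::nat. t n \<notin> B"
proof -
  have "\<exists>s. s \<in> ball z (1 / real (Suc n)) - B" for n
  proof (rule ccontr)
    assume "\<not> ?thesis"
    then have "ball z (1 / real (Suc n)) \<subseteq> B" by blast
    then show False
      using assms uncountable_ball[of "1 / real (Suc n)" z] countable_subset
      by (metis of_nat_0_less_iff zero_less_Suc zero_less_divide_1_iff)
  qed
  then obtain t where t: "\<And>n. t n \<in> ball z (1 / real (Suc n)) - B"
    by metis
  have "t \<longlonglongrightarrow> z"
  proof (rule metric_tendsto_imp_tendsto[of "\<lambda>n. 1 / real (Suc n)" 0])
    show "(\<lambda>n. 1 / real (Suc n)) \<longlonglongrightarrow> 0"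
      using LIMSEQ_inverse_real_of_nat by (simp add: inverse_eq_divide)
    show "\<forall>\<^sub>F n in sequentially. dist (t n) z \<le> dist (1 / real (Suc n)) 0"
      using t by (intro always_eventually allI) (force simp: dist_commute intro: less_imp_le)
  qed
  with t show ?thesis using that by blast
qed

section \<open>The addition formula\<close>

text \<open>A power of p moves any nonzero z into the compact annulus between the radii |p| and 1,
  so \<open>\<psi>\<close> is bounded. Hence 0 is a removable singularity and Liouville's theorem
  applies.\<close>

lemma multiplicative_periodic_constant:
  fixes \<psi> :: "complex \<Rightarrow> complex"
  assumes "norm p < 1" "p \<noteq> 0" and hol: "\<psi> holomorphic_on -{0}"
    and per: "\<And>z. z \<noteq> 0 \<Longrightarrow> \<psi> (p * z) = \<psi> z"
  obtains k where "\<And>z. z \<noteq> 0 \<Longrightarrow> \<psi> z = k"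
proof -
  define K where "K = cball (0::complex) 1 - ball 0 (norm p)"
  have pow: "\<psi> (p ^ n * z) = \<psi> z" if "z \<noteq> 0" for n z
    using that per[of "p ^ _ * z"] assms(2) by (induction n) (auto simp: mult.assoc)
  have "compact K"
    unfolding K_def by (intro compact_diff) auto
  moreover have "continuous_on K \<psi>"
    by (rule continuous_on_subset[OF holomorphic_on_imp_continuous_on[OF hol]])
      (use assms in \<open>auto simp: K_def\<close>)
  ultimately have "bounded (\<psi> ` K)"
    by (intro compact_imp_bounded compact_continuous_image)
  then obtain B where B: "\<And>z. z \<in> K \<Longrightarrow> norm (\<psi> z) \<le> B"
    by (auto simp: bounded_iff)
  have to0: "(\<lambda>n. norm p ^ n * s) \<longlonglongrightarrow> 0" for s :: real
    using assms(1) by (intro tendsto_mult_left_zero LIMSEQ_power_zero) auto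
  have bound: "norm (\<psi> z) \<le> B" if "z \<noteq> 0" for z
  proof (cases "norm z \<le> 1")
    case True
    \<comment> \<open>Minimality gives norm z <= norm p ^ (m - 1), so division by p ^ (m - 1) is
      what lands in the annulus.\<close>
    define m where "m = (LEAST m. norm p ^ m < norm z)"
    have "eventually (\<lambda>n. norm p ^ n * 1 < norm z) sequentially"
      using that by (intro order_tendstoD(2)[OF to0]) auto
    then obtain n where "norm p ^ n < norm z"
      by (auto simp: eventually_sequentially)
    then have m: "norm p ^ m < norm z"
      unfolding m_def by (rule LeastI)
    with True obtain l where l: "m = Suc l"
      by (cases m) auto
    have "\<not> norm p ^ l < norm z"
      using not_less_Least[of l "\<lambda>m. norm p ^ m < norm z"] l by (simp add: m_def)
    then have "z / p ^ l \<in> K"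
      using m l assms(2) by (auto simp: K_def norm_divide norm_power field_simps)
    moreover have "\<psi> (z / p ^ l) = \<psi> z"
      using pow[of "z / p ^ l" l] that assms(2) by simp
    ultimately show ?thesis using B by metis
  next
    case False
    define m where "m = (LEAST m. norm p ^ m * norm z \<le> 1)"
    have "eventually (\<lambda>n. norm p ^ n * norm z < 1) sequentially"
      by (intro order_tendstoD(2)[OF to0]) auto
    then obtain n where "norm p ^ n * norm z < 1"
      by (auto simp: eventually_sequentially)
    then have "norm p ^ n * norm z \<le> 1" by simp
    then have m: "norm p ^ m * norm z \<le> 1"
      unfolding m_def by (rule LeastI)
    with False obtain l where l: "m = Suc l"
      by (cases m) auto
    have "\<not> norm p ^ l * norm z \<le> 1"
      using not_less_Least[of l "\<lambda>m. norm p ^ m * norm z \<le> 1"] l by (simp add: m_def)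
    then have "norm p * 1 < norm p * (norm p ^ l * norm z)"
      using assms(2) by (intro mult_strict_left_mono) auto
    then have "p ^ m * z \<in> K"
      using m l by (auto simp: K_def norm_mult norm_power mult.assoc)
    then show ?thesis using B pow[OF that, of m] by metis
  qed
  have "\<exists>g. g holomorphic_on UNIV \<and> (\<forall>z\<in>UNIV-{0}. g z = \<psi> z)"
  proof (subst holomorphic_on_extend_bounded)
    show "\<exists>B. eventually (\<lambda>z. norm (\<psi> z) \<le> B) (at 0)"
      using bound by (intro exI[of _ B]) (auto simp: eventually_at_filter)
  qed (use hol in \<open>auto simp: Compl_eq_Diff_UNIV\<close>)
  then obtain g where g: "g holomorphic_on UNIV" "\<And>z. z \<noteq> 0 \<Longrightarrow> g z = \<psi> z"
    by auto
  have "bounded (range g)"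
    unfolding bounded_iff
  proof (intro exI ballI)
    fix y assume "y \<in> range g"
    then obtain z where z: "y = g z" by auto
    show "norm y \<le> max B (norm (g 0))"
      using z bound[of z] g(2)[of z] by (cases "z = 0") auto
  qed
  with Liouville_theorem[OF g(1)] obtain k where "\<And>z. g z = k"
    unfolding constant_on_def by auto
  with g that show ?thesis by metis
qed

lemma finite_powi_eq:
  fixes w :: complex
  assumes "m \<noteq> 0"
  shows "finite {t. t \<noteq> 0 \<and> t powi m = w}"
proof (cases "m > 0")
  case True
  then have "{t. t \<noteq> 0 \<and> t powi m = w} \<subseteq> {t. t ^ nat m = w}"
    by (auto simp: power_int_def)
  then show ?thesis
    using finite_nth_roots[of "nat m" w] True finite_subset by auto
next
  case False
  with assms have "{t. t \<noteq> 0 \<and> t powi m = w} \<subseteq> {t. t ^ nat (-m) = inverse w}"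
    by (auto simp: power_int_def power_inverse)
  then show ?thesis
    using finite_nth_roots[of "nat (-m)" "inverse w"] False assms finite_subset by auto
qed

lemma countable_jtheta_powi_zeros:
  assumes "norm p < 1" "k \<noteq> 0" "m \<noteq> 0"
  shows "countable {t. t \<noteq> 0 \<and> jtheta p (k * t powi m) = 0}"
proof (rule countable_subset)
  show "{t. t \<noteq> 0 \<and> jtheta p (k * t powi m) = 0}
    \<subseteq> (\<Union>y\<in>{x. x \<noteq> 0 \<and> jtheta p x = 0}. {t. t \<noteq> 0 \<and> t powi m = y / k})"
  proof
    fix t assume "t \<in> {t. t \<noteq> 0 \<and> jtheta p (k * t powi m) = 0}"
    with assms show "t \<in> (\<Union>y\<in>{x. x \<noteq> 0 \<and> jtheta p x = 0}. {t. t \<noteq> 0 \<and> t powi m = y / k})"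
      by (intro UN_I[of "k * t powi m"]) auto
  qed
  show "countable \<dots>"
    using assms by (intro countable_UN jtheta_zeros_countable countable_finite finite_powi_eq)
qed

text \<open>theta(x/w) has a simple zero at x = w, which the zero of \<open>D\<close> cancels, and
  theta(xw) tends to theta(w^2), which is nonzero. In the proof \<open>\<tau>\<close> is theta
  without its factor 1 - y.\<close>

lemma tendsto_quotient_jtheta_pair:
  assumes "norm p < 1" "w \<noteq> 0" "jtheta p (w * w) \<noteq> 0" "D holomorphic_on -{0}" "D w = 0"
  shows "\<exists>l. ((\<lambda>x. D x / (jtheta p (x * w) * jtheta p (x / w))) \<longlongrightarrow> l) (at w)"
proof -
  define \<tau> where "\<tau> = (\<lambda>y. qpoch p (p * y) * qpoch p (p / y))"
  have "p ^ j * p \<noteq> 1" for j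
  proof
    assume "p ^ j * p = 1"
    then have "norm p ^ Suc j = 1"
      by (metis norm_one norm_power power_Suc2)
    moreover have "norm p ^ Suc j < 1"
      using assms(1) by (cases "p = 0") (auto intro!: power_Suc_less_one simp del: power_Suc)
    ultimately show False by simp
  qed
  then have \<tau>1: "\<tau> 1 \<noteq> 0"
    using qpoch_eq_0_iff[OF assms(1), of p] by (auto simp: \<tau>_def)
  have "isCont (qpoch p) y" for y
    using holomorphic_on_imp_continuous_on[OF qpoch_holomorphic[OF assms(1), of UNIV]]
    by (simp add: continuous_on_eq_continuous_at)
  then have qlim: "((\<lambda>x. qpoch p (f x)) \<longlongrightarrow> qpoch p (f w)) (at w)" if "(f \<longlongrightarrow> f w) (at w)" for f
    using that by (rule isCont_tendsto_compose)
  have \<tau>lim: "((\<lambda>x. \<tau> (x / w)) \<longlongrightarrow> \<tau> (w / w)) (at w)"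
    unfolding \<tau>_def using assms(2) by (intro tendsto_intros qlim) auto
  have "D field_differentiable at w"
    using assms by (intro holomorphic_on_imp_differentiable_at[OF assms(4)]) auto
  then obtain D' where "(D has_field_derivative D') (at w)"
    by (auto simp: field_differentiable_def)
  then have Dlim: "((\<lambda>x. D x / (x - w)) \<longlongrightarrow> D') (at w)"
    using assms(5) by (simp add: has_field_derivative_iff)
  have "((\<lambda>x. (D x / (x - w)) * (- w / (jtheta p (x * w) * \<tau> (x / w))))
      \<longlongrightarrow> D' * (- w / (jtheta p (w * w) * \<tau> (w / w)))) (at w)"
    using assms \<tau>1 by (intro tendsto_intros \<tau>lim Dlim) auto
  then have "((\<lambda>x. D x / (jtheta p (x * w) * jtheta p (x / w)))
      \<longlongrightarrow> D' * (- w / (jtheta p (w * w) * \<tau> (w / w)))) (at w)"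
  proof (rule Lim_transform_eventually)
    have "D x / (x - w) * (- w / (jtheta p (x * w) * \<tau> (x / w)))
        = D x / (jtheta p (x * w) * jtheta p (x / w))" if "x \<noteq> w" for x
    proof -
      have eq: "(x - w) * t * u / (- w) = t * ((1 - x / w) * u)" for t u
        using assms(2) by (simp add: field_simps)
      have "D x / (x - w) * (- w / (jtheta p (x * w) * \<tau> (x / w)))
          = D x / ((x - w) * jtheta p (x * w) * \<tau> (x / w) / (- w))"
        by (simp add: mult.assoc)
      also have "\<dots> = D x / (jtheta p (x * w) * jtheta p (x / w))"
        using jtheta_split[OF assms(1), of "x / w"] unfolding \<tau>_def eq by simp
      finally show ?thesis .
    qed
    then show "\<forall>\<^sub>F x in at w. D x / (x - w) * (- w / (jtheta p (x * w) * \<tau> (x / w)))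
        = D x / (jtheta p (x * w) * jtheta p (x / w))"
      by (auto simp: eventually_at_filter)
  qed
  then show ?thesis by blast
qed

text \<open>The factor 1/u^2 is the same for all y, so a combination of such pairs that vanishes at
  u also vanishes at 1/u.\<close>

lemma jtheta_pair_inverse:
  assumes "norm p < 1" "u \<noteq> 0" "y \<noteq> 0"
  shows "jtheta p (1 / u * y) * jtheta p (1 / u / y) = jtheta p (u * y) * jtheta p (u / y) / u\<^sup>2"
proof -
  have "jtheta p (1 / u * y) = - (y / u) * jtheta p (u / y)"
    using jtheta_swap[OF assms(1), of y u] assms by simp
  moreover have "jtheta p (1 / u / y) = - jtheta p (u * y) / (u * y)"
    using jtheta_inverse[OF assms(1), of "u * y"] assms by (simp add: field_simps)
  ultimately show ?thesis
    using assms by (simp add: power2_eq_square)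
qed

text \<open>The multiplier 1/x^2 is free of y, so a linear combination of pairs divided by another
  pair is invariant under x -> px.\<close>

lemma jtheta_pair_shift:
  assumes "norm p < 1" "p \<noteq> 0" "x \<noteq> 0" "y \<noteq> 0"
  shows "jtheta p (p * x * y) * jtheta p (p * x / y) = jtheta p (x * y) * jtheta p (x / y) / x\<^sup>2"
  using jtheta_shift[of p "x * y"] jtheta_shift[of p "x / y"] assms
  by (simp add: mult.assoc power2_eq_square)

text \<open>Carries removability of a singularity along the orbit of a point under multiplication by
  p.\<close>

lemma tendsto_at_scale_iff:
  fixes p :: complex
  assumes "p \<noteq> 0" "\<And>x. x \<noteq> 0 \<Longrightarrow> \<phi> (p * x) = \<phi> x" "z \<noteq> 0"
  shows "(\<phi> \<longlongrightarrow> l) (at (p * z)) \<longleftrightarrow> (\<phi> \<longlongrightarrow> l) (at z)"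
proof
  assume *: "(\<phi> \<longlongrightarrow> l) (at (p * z))"
  have "filterlim (\<lambda>x. p * x) (at (p * z)) (at z)"
    using assms(1) by (auto simp: filterlim_at eventually_at_filter intro!: tendsto_intros)
  from filterlim_compose[OF * this] show "(\<phi> \<longlongrightarrow> l) (at z)"
  proof (rule Lim_transform_eventually)
    show "\<forall>\<^sub>F x in at z. \<phi> (p * x) = \<phi> x"
      by (rule eventually_mono[OF eventually_neq_at_within[of 0]]) (rule assms(2))
  qed
next
  assume *: "(\<phi> \<longlongrightarrow> l) (at z)"
  have "filterlim (\<lambda>x. x / p) (at z) (at (p * z))"
    using assms(1)
    by (auto simp: filterlim_at eventually_at_filter field_simps
        intro!: tendsto_eq_intros always_eventually)
  from filterlim_compose[OF * this] show "(\<phi> \<longlongrightarrow> l) (at (p * z))"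
  proof (rule Lim_transform_eventually)
    have "\<phi> (x / p) = \<phi> x" if "x \<noteq> 0" for x
      using assms(1) assms(2)[of "x / p"] that by simp
    then show "\<forall>\<^sub>F x in at (p * z). \<phi> (x / p) = \<phi> x"
      by (rule eventually_mono[OF eventually_neq_at_within[of 0]])
  qed
qed

text \<open>
  The quotient of the left-hand side by \<open>\<theta>(x u) \<theta>(x / u)\<close> is invariant under \<open>x \<mapsto> p x\<close> and has only removable
  singularities, so it is constant; \<open>x = y\<close> gives the constant.
\<close>

lemma jtheta_weierstrass_generic:
  assumes p: "norm p < 1" "p \<noteq> 0" and nz: "x \<noteq> 0" "y \<noteq> 0" "u \<noteq> 0" "v \<noteq> 0"
    and gen: "jtheta p (u * u) \<noteq> 0" "jtheta p (x * u) * jtheta p (x / u) \<noteq> 0"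
      "jtheta p (y * u) * jtheta p (y / u) \<noteq> 0"
  shows "jtheta p (x * y) * jtheta p (x / y) * (jtheta p (u * v) * jtheta p (u / v))
       - jtheta p (x * v) * jtheta p (x / v) * (jtheta p (u * y) * jtheta p (u / y))
       = u / y * (jtheta p (y * v) * jtheta p (y / v)) * (jtheta p (x * u) * jtheta p (x / u))"
proof -
  \<comment> \<open>As a function of t, \<open>G s\<close> vanishes at s and 1/s and at their
    multiples by powers of p. The combination \<open>D\<close> is built to vanish at t = u, where
    its two products coincide.\<close>
  define G where "G = (\<lambda>s t. jtheta p (t * s) * jtheta p (t / s))"
  define D where "D = (\<lambda>t. G y t * G v u - G v t * G y u)"
  define \<phi> where "\<phi> = (\<lambda>t. D t / G u t)"
  have Ghol: "G s holomorphic_on -{0}" if "s \<noteq> 0" for s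
    unfolding G_def using that p by (intro holomorphic_intros) auto
  have Dhol: "D holomorphic_on -{0}"
    unfolding D_def using nz by (intro holomorphic_intros Ghol) auto
  have Gshift: "G s (p * t) = G s t / t\<^sup>2" if "s \<noteq> 0" "t \<noteq> 0" for s t
    unfolding G_def using jtheta_pair_shift[OF p] that by simp
  have Ginv: "G s (1 / t) = G s t / t\<^sup>2" if "s \<noteq> 0" "t \<noteq> 0" for s t
    unfolding G_def using jtheta_pair_inverse[OF p(1)] that by simp
  have \<phi>shift: "\<phi> (p * t) = \<phi> t" if "t \<noteq> 0" for t
    using that nz by (simp add: \<phi>_def D_def Gshift diff_divide_distrib[symmetric])
  have D0: "D u = 0" "D (1 / u) = 0"
    using nz by (simp_all add: D_def Ginv)
  have limu: "\<exists>l. (\<phi> \<longlongrightarrow> l) (at u)"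
    using tendsto_quotient_jtheta_pair[OF p(1) nz(3) gen(1) Dhol D0(1)] by (simp add: \<phi>_def G_def)
  have "jtheta p (1 / u * (1 / u)) \<noteq> 0"
    using jtheta_inverse[OF p(1), of "u * u"] gen nz by simp
  from tendsto_quotient_jtheta_pair[OF p(1) _ this Dhol D0(2)]
  have limu': "\<exists>l. (\<phi> \<longlongrightarrow> l) (at (1 / u))"
    using nz by (simp add: \<phi>_def G_def mult.commute)
  have shiftlim: "\<exists>l. (\<phi> \<longlongrightarrow> l) (at (p powi m * z))"
    if "\<exists>l. (\<phi> \<longlongrightarrow> l) (at z)" "z \<noteq> 0" for z m
  proof (induction m rule: int_induct[of _ 0])
    case base
    show ?case using that by simp
  next
    case (step1 i)
    have "p powi (i + 1) * z = p * (p powi i * z)"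
      using p by (simp add: power_int_add)
    then show ?case
      using step1 tendsto_at_scale_iff[where \<phi> = \<phi>, OF p(2) \<phi>shift, of "p powi i * z"] p that by (simp add: mult.assoc)
  next
    case (step2 i)
    have eq: "p * (p powi (i - 1) * z) = p powi i * z"
      using p by (simp add: power_int_diff)
    have nz': "p powi (i - 1) * z \<noteq> 0"
      using p that by simp
    obtain l where "(\<phi> \<longlongrightarrow> l) (at (p powi i * z))"
      using step2.IH by (elim exE)
    then have "(\<phi> \<longlongrightarrow> l) (at (p * (p powi (i - 1) * z)))"
      by (simp only: eq)
    then have "(\<phi> \<longlongrightarrow> l) (at (p powi (i - 1) * z))"
      by (rule tendsto_at_scale_iff[where \<phi> = \<phi>, OF p(2) \<phi>shift nz', THEN iffD1, rotated])
    then show ?case by (rule exI)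
  qed
  have \<phi>lim: "(\<phi> \<longlongrightarrow> \<phi> z) (at z)" if z: "z \<noteq> 0" "G u z \<noteq> 0" for z
  proof -
    have "isCont f z" if "f holomorphic_on -{0}" for f
      using holomorphic_on_imp_continuous_on[OF that] z(1)
      by (subst (asm) continuous_on_eq_continuous_at) auto
    then have "(D \<longlongrightarrow> D z) (at z)" "(G u \<longlongrightarrow> G u z) (at z)"
      using Dhol Ghol[OF nz(3)] by (auto simp: isCont_def)
    then show ?thesis
      unfolding \<phi>_def using z(2) by (rule tendsto_divide)
  qed
  have lim: "\<exists>l. (\<phi> \<longlongrightarrow> l) (at z)" if z: "z \<noteq> 0" for z
  proof (cases "G u z = 0")
    case False
    with z show ?thesis using \<phi>lim by blast
  next
    case True
    \<comment> \<open>Every zero of \<open>G u\<close> is u or 1/u times a power of p, so the limits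
      at these two points and the orbit argument cover all of them.\<close>
    then have "jtheta p (z * u) = 0 \<or> jtheta p (z / u) = 0"
      by (auto simp: G_def)
    then show ?thesis
    proof
      assume "jtheta p (z * u) = 0"
      then obtain m where "z * u = p powi m"
        using jtheta_eq_0D[OF p(1)] z nz by (metis mult_eq_0_iff)
      then have "z = p powi m * (1 / u)"
        using nz by (simp add: field_simps)
      then show ?thesis using shiftlim[OF limu'] nz by simp
    next
      assume "jtheta p (z / u) = 0"
      then obtain m where "z / u = p powi m"
        using jtheta_eq_0D[OF p(1)] z nz by (metis divide_eq_0_iff)
      then have "z = p powi m * u"
        using nz by (simp add: field_simps)
      then show ?thesis using shiftlim[OF limu] nz by simp
    qed
  qed
  have "f analytic_on -{0}" if "f holomorphic_on -{0}" for f
    using that by (subst analytic_on_open) auto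
  then have mero: "\<phi> meromorphic_on -{0}"
    unfolding \<phi>_def using Dhol Ghol[OF nz(3)]
    by (intro meromorphic_intros analytic_on_imp_meromorphic_on)
  have "remove_sings \<phi> analytic_on {z}" if z: "z \<noteq> 0" for z
    using lim[OF z] meromorphic_on_isolated_singularity[of \<phi> z] meromorphic_on_subset[OF mero, of "{z}"] z
    by (auto intro!: remove_sings_analytic_at)
  then have "remove_sings \<phi> analytic_on -{0}"
    by (subst analytic_on_analytic_at) auto
  then have "remove_sings \<phi> holomorphic_on -{0}"
    by (rule analytic_imp_holomorphic)
  moreover have "remove_sings \<phi> (p * z) = remove_sings \<phi> z" if z: "z \<noteq> 0" for z
  proof -
    obtain l where "(\<phi> \<longlongrightarrow> l) (at z)" using lim[OF z] by blast
    then show ?thesis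
      using tendsto_at_scale_iff[where \<phi> = \<phi>, OF p(2) \<phi>shift z] by (metis remove_sings_eqI)
  qed
  ultimately obtain k where k: "\<And>z. z \<noteq> 0 \<Longrightarrow> remove_sings \<phi> z = k"
    using multiplicative_periodic_constant[OF p] by blast
  have \<phi>k: "\<phi> z = k" if z: "z \<noteq> 0" "G u z \<noteq> 0" for z
  proof -
    show ?thesis using k[OF z(1)] \<phi>lim[OF z] by (metis remove_sings_eqI)
  qed
  have G0: "G y y = 0"
    using nz p by (simp add: G_def)
  have Gswap: "G y u = - (u / y) * G u y"
    using jtheta_swap[OF p(1) nz(3) nz(2)] by (simp add: G_def mult.commute)
  have "D x / G u x = D y / G u y"
    using \<phi>k nz gen unfolding \<phi>_def G_def by simp
  moreover have "D y = u / y * G v y * G u y"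
    by (simp add: D_def G0 Gswap)
  ultimately have "D x = u / y * G v y * G u x"
    using gen by (simp add: G_def field_simps)
  then show ?thesis
    by (simp add: D_def G_def)
qed

text \<open>Periodicity says nothing for p = 0. There theta(x) = 1 - x, and the formula is a
  polynomial identity divided by yv.\<close>

lemma weierstrass_identity_nome_zero:
  fixes x y u v :: complex
  assumes nz: "x \<noteq> 0" "y \<noteq> 0" "u \<noteq> 0" "v \<noteq> 0"
  shows "(1 - x * y) * (1 - x / y) * ((1 - u * v) * (1 - u / v))
       - (1 - x * v) * (1 - x / v) * ((1 - u * y) * (1 - u / y))
       = u / y * ((1 - y * v) * (1 - y / v)) * ((1 - x * u) * (1 - x / u))"
proof -
  have "1 - a / b = (b - a) / b" if "b \<noteq> 0" for a b :: complex
    using that by (simp add: field_simps)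
  then have *: "1 - x / y = (y - x) / y" "1 - u / v = (v - u) / v" "1 - x / v = (v - x) / v"
     "1 - u / y = (y - u) / y" "1 - y / v = (v - y) / v" "1 - x / u = (u - x) / u"
    using nz by blast+
  have **: "a * (b / s) * (c * (d / t)) = a * b * (c * d) / (s * t)" for a b c d s t :: complex
    by simp
  have poly: "(1 - x * y) * (y - x) * ((1 - u * v) * (v - u))
      - (1 - x * v) * (v - x) * ((1 - u * y) * (y - u))
      = (1 - y * v) * (v - y) * ((1 - x * u) * (u - x))"
    by (simp add: algebra_simps)
  have "(1 - x * y) * ((y - x) / y) * ((1 - u * v) * ((v - u) / v))
      - (1 - x * v) * ((v - x) / v) * ((1 - u * y) * ((y - u) / y))
    = (1 - y * v) * (v - y) * ((1 - x * u) * (u - x)) / (y * v)"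
    by (simp only: ** mult.commute[of v y] diff_divide_distrib[symmetric] poly)
  also have "\<dots> = u / y * ((1 - y * v) * ((v - y) / v)) * ((1 - x * u) * ((u - x) / u))"
    using nz by simp
  finally show ?thesis
    unfolding * .
qed

lemma jtheta_weierstrass:
  assumes p: "norm p < 1" and nz: "x \<noteq> 0" "y \<noteq> 0" "u \<noteq> 0" "v \<noteq> 0"
  shows "jtheta p (x * y) * jtheta p (x / y) * (jtheta p (u * v) * jtheta p (u / v))
       - jtheta p (x * v) * jtheta p (x / v) * (jtheta p (u * y) * jtheta p (u / y))
       = u / y * (jtheta p (y * v) * jtheta p (y / v)) * (jtheta p (x * u) * jtheta p (x / u))"
proof (cases "p = 0")
  case True
  have "qpoch 0 0 = 1"
    using qpoch_tendsto[of 0 0] by (simp add: LIMSEQ_const_iff)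
  then have "jtheta 0 z = 1 - z" for z
    using jtheta_split[of 0 z] by simp
  then show ?thesis
    using weierstrass_identity_nome_zero[OF nz] by (simp only: True)
next
  case False
  let ?L = "\<lambda>u. jtheta p (x * y) * jtheta p (x / y) * (jtheta p (u * v) * jtheta p (u / v))
       - jtheta p (x * v) * jtheta p (x / v) * (jtheta p (u * y) * jtheta p (u / y))"
  let ?R = "\<lambda>u. u / y * (jtheta p (y * v) * jtheta p (y / v)) * (jtheta p (x * u) * jtheta p (x / u))"
  define Z where "Z = (\<lambda>k m. {t. t \<noteq> 0 \<and> jtheta p (k * t powi m) = 0})"
  \<comment> \<open>Besides 0, these are the zeros of theta(t^2), theta(xt), theta(x/t), theta(yt)
    and theta(y/t), which the generic case excludes for u = t.\<close>
  define B where "B = {0} \<union> Z 1 2 \<union> Z x 1 \<union> Z x (-1) \<union> Z y 1 \<union> Z y (-1)"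
  have "countable B"
    unfolding B_def Z_def using nz by (intro countable_Un countable_jtheta_powi_zeros p) auto
  then obtain t where t: "t \<longlonglongrightarrow> u" "\<And>n. t n \<notin> B"
    using countable_avoiding_sequence by blast
  have "?L (t n) = ?R (t n)" for n
    using t(2)[of n] nz
    by (intro jtheta_weierstrass_generic p False)
      (auto simp: B_def Z_def power2_eq_square power_int_minus field_simps)
  moreover have "(\<lambda>n. ?L (t n)) \<longlonglongrightarrow> ?L u"
    using t nz p by (intro tendsto_intros) auto
  moreover have "(\<lambda>n. ?R (t n)) \<longlonglongrightarrow> ?R u"
    using t nz p by (intro tendsto_intros) auto
  ultimately show ?thesis
    using LIMSEQ_unique by fastforce
qed

section \<open>Partial fractions\<close>

text \<open>Weierstrass's formula with all four variables divided by a square root of A. The pair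
  theta(t/z) theta(tz/A) vanishes at t = z and t = A/z, two points with product A; the formula
  expands one such pair in two others with the same A.\<close>

lemma jtheta_addition:
  assumes p: "norm p < 1" and nz: "A \<noteq> 0" "t \<noteq> 0" "z \<noteq> 0" "u \<noteq> 0" "v \<noteq> 0"
  shows "jtheta p (t / z) * jtheta p (t * z / A) * (jtheta p (u * v / A) * jtheta p (u / v))
       = jtheta p (t / v) * jtheta p (t * v / A) * (jtheta p (u * z / A) * jtheta p (u / z))
       + jtheta p (t / u) * jtheta p (t * u / A) * (u / z * (jtheta p (z * v / A) * jtheta p (z / v)))"
proof -
  define \<rho> where "\<rho> = csqrt A"
  have \<rho>: "\<rho> * \<rho> = A" "\<rho> \<noteq> 0"
    using nz by (auto simp: \<rho>_def simp flip: power2_eq_square)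
  have sc: "(a / \<rho>) * (b / \<rho>) = a * b / A" "(a / \<rho>) / (b / \<rho>) = a / b" for a b
    using \<rho> by (simp_all flip: \<rho>(1))
  show ?thesis
    using jtheta_weierstrass[OF p, of "t / \<rho>" "z / \<rho>" "u / \<rho>" "v / \<rho>"] nz \<rho>(2)
    unfolding sc by (simp add: algebra_simps)
qed

text \<open>
  The addition formula replaces two of the \<open>z\<close> by \<open>y\<^sub>l, z\<^sub>1 z\<^sub>2 / y\<^sub>l\<close> and by \<open>y\<^sub>m, z\<^sub>1 z\<^sub>2 / y\<^sub>m\<close>; each of the
  two resulting sums loses one term and is an instance with one point fewer.
\<close>

lemma theta_partial_fractions:
  fixes y :: "'a \<Rightarrow> complex"
  assumes "norm p < 1" "finite I" "card I = length zs"
    and "\<And>i. i \<in> I \<Longrightarrow> y i \<noteq> 0" "0 \<notin> set zs"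
    and "\<And>i j. i \<in> I \<Longrightarrow> j \<in> I \<Longrightarrow> i \<noteq> j \<Longrightarrow> jtheta p (y i / y j) \<noteq> 0"
    and "prod y I = prod_list zs"
  shows "(\<Sum>i\<in>I. (\<Prod>z\<leftarrow>zs. jtheta p (y i / z)) / (\<Prod>j\<in>I - {i}. jtheta p (y i / y j))) = 0"
  using assms(2-)
proof (induction "length zs" arbitrary: I zs rule: less_induct)
  case less
  note IH = less(1) and fin = less(2) and card = less(3) and ynz = less(4) and znz = less(5)
    and dist = less(6) and bal = less(7)
  consider "length zs = 0" | "length zs = 1" | "length zs = 2" | "length zs \<ge> 3"
    by linarith
  then show ?case
  proof cases
    case 1
    then show ?thesis using card fin by simp
  next
    case 2
    then obtain i z where "I = {i}" "zs = [z]"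
      using card by (metis card_1_singletonE One_nat_def length_0_conv length_Suc_conv)
    then show ?thesis using bal znz assms(1) by simp
  next
    case 3
    then obtain i j z1 z2 where I: "I = {i, j}" "i \<noteq> j" and zs: "zs = [z1, z2]"
      using card by (metis card_2_iff length_0_conv length_Suc_conv numeral_2_eq_2)
    have nz: "y i \<noteq> 0" "y j \<noteq> 0" "z1 \<noteq> 0" "z2 \<noteq> 0"
      using ynz znz I zs by auto
    have b: "y i * y j = z1 * z2"
      using bal I zs by simp
    \<comment> \<open>With two points the balancing condition makes each argument of the second
      summand the inverse of one of the first, so reflection turns the second summand into minus the
      first.\<close>
    then have e: "y j / z1 = z2 / y i" "y j / z2 = z1 / y i"
      using nz by (simp_all add: field_simps)
    have swap: "jtheta p (y j / z1) = - (z2 / y i) * jtheta p (y i / z2)"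
      "jtheta p (y j / z2) = - (z1 / y i) * jtheta p (y i / z1)"
      "jtheta p (y j / y i) = - (y j / y i) * jtheta p (y i / y j)"
      using jtheta_swap[OF assms(1), of z2 "y i"] jtheta_swap[OF assms(1), of z1 "y i"]
        jtheta_swap[OF assms(1), of "y j" "y i"] nz
      by (simp_all only: e not_False_eq_True simp_thms)
    define a where "a = jtheta p (y i / z1) * jtheta p (y i / z2)"
    have "jtheta p (y j / z1) * jtheta p (y j / z2) = (z2 / y i * (z1 / y i)) * a"
      unfolding swap a_def by simp
    also have "z2 / y i * (z1 / y i) = y j / y i"
      using b nz by (simp add: field_simps)
    finally have "jtheta p (y j / z1) * jtheta p (y j / z2) / jtheta p (y j / y i) = - (a / jtheta p (y i / y j))"
      unfolding swap(3) using nz by simp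
    moreover have "I - {i} = {j}" "I - {j} = {i}"
      using I by auto
    ultimately show ?thesis
      using I zs by (simp add: a_def)
  next
    case 4
    then obtain z1 z2 z3 zs' where zs: "zs = z1 # z2 # z3 # zs'"
      by (metis One_nat_def Suc_le_length_iff numeral_3_eq_3)
    have "\<exists>u v. u \<in> I \<and> v \<in> I \<and> u \<noteq> v"
      using 4 card card_le_Suc0_iff_eq[OF fin] by fastforce
    then obtain l m where lm: "l \<in> I" "m \<in> I" "l \<noteq> m" by blast
    have nz: "z1 \<noteq> 0" "z2 \<noteq> 0" "z3 \<noteq> 0" "0 \<notin> set zs'"
      using znz zs by auto
    define F where "F = (\<lambda>zs. \<Sum>i\<in>I. (\<Prod>z\<leftarrow>zs. jtheta p (y i / z)) / (\<Prod>j\<in>I - {i}. jtheta p (y i / y j)))"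
    have reduce: "F (y k # A / y k # ws) = 0"
      if k: "k \<in> I" and ws: "length ws + 2 = length zs" "0 \<notin> set ws" and A: "A \<noteq> 0"
        "prod y I = A * prod_list ws" for k A ws
    proof -
      have "F (y k # A / y k # ws)
        = (\<Sum>i\<in>I - {k}. (\<Prod>z\<leftarrow>y k # A / y k # ws. jtheta p (y i / z)) / (\<Prod>j\<in>I - {i}. jtheta p (y i / y j)))"
        unfolding F_def using k ynz[OF k] assms(1)
        by (subst sum.remove[OF fin k]) simp
      also have "\<dots> = (\<Sum>i\<in>I - {k}. (\<Prod>z\<leftarrow>A / y k # ws. jtheta p (y i / z))
          / (\<Prod>j\<in>(I - {k}) - {i}. jtheta p (y i / y j)))"
      proof (intro sum.cong refl)
        fix i assume i: "i \<in> I - {k}"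
        have "I - {i} - {k} = I - {k} - {i}" by blast
        then have "(\<Prod>j\<in>I - {i}. jtheta p (y i / y j))
            = jtheta p (y i / y k) * (\<Prod>j\<in>(I - {k}) - {i}. jtheta p (y i / y j))"
          using i k fin by (subst prod.remove[of "I - {i}" k]) auto
        then show "(\<Prod>z\<leftarrow>y k # A / y k # ws. jtheta p (y i / z)) / (\<Prod>j\<in>I - {i}. jtheta p (y i / y j))
          = (\<Prod>z\<leftarrow>A / y k # ws. jtheta p (y i / z)) / (\<Prod>j\<in>(I - {k}) - {i}. jtheta p (y i / y j))"
          using dist[of i k] i k by simp
      qed
      also have "\<dots> = 0"
      proof (rule IH)
        show "prod y (I - {k}) = prod_list (A / y k # ws)"
          using A(2) prod.remove[OF fin k, of y] ynz[OF k] by (simp add: field_simps)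
      qed (use k ws A fin card ynz dist in \<open>auto simp: card_Diff_singleton\<close>)
      finally show ?thesis .
    qed
    have scale: "a * (b * P) / Q * K = c * (c' * P) / Q * \<alpha> + d * (d' * P) / Q * \<beta>"
      if "a * b * K = c * c' * \<alpha> + d * d' * \<beta>" for a b c c' d d' K P Q \<alpha> \<beta> :: complex
    proof -
      have "a * (b * P) / Q * K = a * b * K * (P / Q)" by simp
      then show ?thesis unfolding that by (simp add: algebra_simps)
    qed
    have generic: "F (w1 # w2 # ws) = 0"
      if ws: "length ws + 2 = length zs" "0 \<notin> set (w1 # w2 # ws)" "prod y I = w1 * w2 * prod_list ws"
        and gen: "jtheta p (y l * y m / (w1 * w2)) \<noteq> 0" for w1 w2 ws
    proof -
      let ?A = "w1 * w2"
      let ?K = "jtheta p (y l * y m / ?A) * jtheta p (y l / y m)"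
      let ?\<alpha> = "jtheta p (y l * w1 / ?A) * jtheta p (y l / w1)"
      let ?\<beta> = "y l / w1 * (jtheta p (w1 * y m / ?A) * jtheta p (w1 / y m))"
      have "F (w1 # w2 # ws) * ?K = F (y m # ?A / y m # ws) * ?\<alpha> + F (y l # ?A / y l # ws) * ?\<beta>"
        unfolding F_def sum_distrib_right sum.distrib[symmetric]
      proof (rule sum.cong[OF refl])
        fix i assume i: "i \<in> I"
        have "jtheta p (y i / w1) * jtheta p (y i / w2) * ?K
            = jtheta p (y i / y m) * jtheta p (y i / (?A / y m)) * ?\<alpha>
            + jtheta p (y i / y l) * jtheta p (y i / (?A / y l)) * ?\<beta>"
          using jtheta_addition[OF assms(1), of ?A "y i" w1 "y l" "y m"] ws ynz lm i
          by simp
        then show "(\<Prod>z\<leftarrow>w1 # w2 # ws. jtheta p (y i / z)) / (\<Prod>j\<in>I - {i}. jtheta p (y i / y j)) * ?K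
          = (\<Prod>z\<leftarrow>y m # ?A / y m # ws. jtheta p (y i / z)) / (\<Prod>j\<in>I - {i}. jtheta p (y i / y j)) * ?\<alpha>
          + (\<Prod>z\<leftarrow>y l # ?A / y l # ws. jtheta p (y i / z)) / (\<Prod>j\<in>I - {i}. jtheta p (y i / y j)) * ?\<beta>"
          unfolding list.map prod_list.Cons by (rule scale)
      qed
      also have "\<dots> = 0"
        using ws lm by (simp add: reduce)
      finally show ?thesis
        using gen dist[OF lm] by simp
    qed
    \<comment> \<open>Replacing z1 by z1 t and z3 by z3 / t preserves the product of all zeros but
      moves z1 z2 off the values excluded in \<open>generic\<close>. The compensation takes a third
      zero, so two points are a base case.\<close>
    define B where "B = {0} \<union> {t. t \<noteq> 0 \<and> jtheta p (y l * y m / (z1 * z2) * t powi (-1)) = 0}"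
    have "countable B"
      unfolding B_def using nz ynz lm
      by (intro countable_Un countable_jtheta_powi_zeros assms) auto
    then obtain t where t: "t \<longlonglongrightarrow> 1" "\<And>n. t n \<notin> B"
      using countable_avoiding_sequence by blast
    have t0: "t n \<noteq> 0" for n
      using t(2)[of n] by (auto simp: B_def)
    have "F (z1 * t n # z2 # z3 / t n # zs') = 0" for n
      using t0[of n] t(2)[of n] nz zs bal
      by (intro generic) (auto simp: B_def field_simps)
    moreover have "(\<lambda>n. k * t n) \<longlonglongrightarrow> k" for k
      using tendsto_mult[OF tendsto_const t(1), of k] by simp
    then have "(\<lambda>n. F (z1 * t n # z2 # z3 / t n # zs')) \<longlonglongrightarrow> F (z1 * 1 # z2 # z3 / 1 # zs')"
      unfolding F_def using nz ynz t0 t(1) assms(1)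
      by (simp, intro tendsto_intros) (auto simp: prod_zero_iff fin dist)
    ultimately have "F zs = 0"
      using zs by (simp add: LIMSEQ_const_iff)
    then show ?thesis by (simp add: F_def)
  qed
qed

section \<open>Shifts of the factors of a term\<close>

lemma efact_0 [simp]: "efact q p a 0 = 1"
  by (simp add: efact_def)

lemma efact_Suc: "efact q p a (Suc n) = efact q p a n * jtheta p (a * q ^ n)"
  by (simp add: efact_def)

lemma efact_Suc_left: "efact q p a (Suc n) = jtheta p a * efact q p (a * q) n"
  unfolding efact_def by (subst prod.lessThan_Suc_shift) (simp add: mult.assoc)

lemma efact_shift: "jtheta p a * efact q p (a * q) n = efact q p a n * jtheta p (a * q ^ n)"
  using efact_Suc efact_Suc_left by metis

lemma efact_shift2:
  "jtheta p a * jtheta p (a * q) * efact q p (a * q * q) n = efact q p a (Suc n) * jtheta p (a * q ^ Suc n)"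
  using efact_Suc[of q p a "Suc n"] efact_Suc_left[of q p a "Suc n"] efact_Suc_left[of q p "a * q" n]
  by (simp add: mult.assoc)

text \<open>Nonvanishing along a whole q-orbit is invariant under every shift made by the recursion,
  and it keeps the shifted factorials of every length nonzero.\<close>

definition generic_arg :: "complex \<Rightarrow> complex \<Rightarrow> complex \<Rightarrow> bool" where
  "generic_arg q p y \<longleftrightarrow> y \<noteq> 0 \<and> (\<forall>m::int. jtheta p (y * q powi m) \<noteq> 0)"

lemma generic_argD: "generic_arg q p y \<Longrightarrow> y \<noteq> 0"
  by (simp add: generic_arg_def)

lemma generic_arg_jtheta: "generic_arg q p y \<Longrightarrow> jtheta p y \<noteq> 0"
  unfolding generic_arg_def by (metis mult.right_neutral power_int_0_right)

lemma generic_arg_powi: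
  assumes "q \<noteq> 0" "generic_arg q p y"
  shows "generic_arg q p (y * q powi m)"
  using assms unfolding generic_arg_def
  by (auto simp: mult.assoc simp flip: power_int_add)

lemma generic_arg_power [simp]:
  assumes "q \<noteq> 0"
  shows "generic_arg q p (y * q ^ n) \<longleftrightarrow> generic_arg q p y"
proof
  assume "generic_arg q p (y * q ^ n)"
  from generic_arg_powi[OF assms this, of "- int n"] show "generic_arg q p y"
    using assms by (simp add: power_int_minus mult.assoc)
next
  assume "generic_arg q p y"
  from generic_arg_powi[OF assms this, of "int n"] show "generic_arg q p (y * q ^ n)"
    by simp
qed

lemma generic_arg_mult [simp]:
  "q \<noteq> 0 \<Longrightarrow> generic_arg q p (y * q) \<longleftrightarrow> generic_arg q p y"
  using generic_arg_power[of q p y 1] by simp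

lemma generic_arg_divide_power [simp]:
  "q \<noteq> 0 \<Longrightarrow> generic_arg q p (y / q ^ n) \<longleftrightarrow> generic_arg q p y"
  using generic_arg_power[of q p "y / q ^ n" n] by simp

lemma generic_arg_divide [simp]:
  "q \<noteq> 0 \<Longrightarrow> generic_arg q p (y / q) \<longleftrightarrow> generic_arg q p y"
  using generic_arg_divide_power[of q p y 1] by simp

lemma generic_arg_inverse:
  assumes "norm p < 1" "q \<noteq> 0" "generic_arg q p y"
  shows "generic_arg q p (1 / y)"
  unfolding generic_arg_def
proof safe
  fix m :: int
  assume "jtheta p (1 / y * q powi m) = 0"
  moreover have "1 / y * q powi m = 1 / (y * q powi (- m))"
    by (simp add: power_int_minus divide_inverse)
  ultimately show False
    using assms jtheta_inverse[of p "y * q powi (- m)"] by (auto simp: generic_arg_def)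
qed (use assms in \<open>auto simp: generic_arg_def\<close>)

lemma generic_arg_efact:
  assumes "q \<noteq> 0" "generic_arg q p y"
  shows "efact q p y n \<noteq> 0"
  using assms by (auto simp: efact_def intro!: generic_arg_jtheta[of q])

text \<open>A zero would make q^|m| an integral power of p, which \<open>base_nome\<close>
  forbids.\<close>

lemma jtheta_q_powi:
  assumes "base_nome q p" "m \<noteq> 0"
  shows "jtheta p (q powi m) \<noteq> 0"
proof
  assume 0: "jtheta p (q powi m) = 0"
  have b: "norm p < 1" "q \<noteq> 0" "\<And>k l. k > 0 \<Longrightarrow> q ^ k \<noteq> p powi l"
    using assms by (auto simp: base_nome_def)
  obtain l where l: "q powi m = p powi l"
    using jtheta_eq_0D[OF b(1) _ 0] b(2) by auto
  show False
  proof (cases "m > 0")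
    case True
    then show False using l b(3)[of "nat m" l] by (simp add: power_int_def)
  next
    case False
    have "q powi (- m) = p powi (- l)"
      using l by (simp add: power_int_minus)
    then show False using False assms(2) b(3)[of "nat (- m)" "- l"] by (simp add: power_int_def)
  qed
qed

text \<open>Summand divided by right-hand side splits into parts for each x_i, for each c_j and a
  scalar rest. These are \<open>xfactor\<close>, \<open>cfactor\<close> and \<open>sfactor\<close>,
  with M standing for |k| and e for aq/CX. The factorials of c_j x_i and of q x_i/x_j are kept
  apart.\<close>

definition xfactor where
  "xfactor q p N M d e u w \<xi> k =
     efact q p (e / \<xi>) (M - k) * efact q p (d / \<xi>) M / (efact q p (d / \<xi>) (M - k) * efact q p (w * \<xi>) k)
     * (efact q p (w * \<xi>) N / efact q p (u * \<xi>) N)"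

definition cfactor where
  "cfactor q p N M e u w \<gamma> = efact q p (u / \<gamma>) N / (efact q p (w / \<gamma>) N * efact q p (e * \<gamma>) M)"

definition sfactor where
  "sfactor q p N a b M =
     jtheta p (a * q ^ (2 * M)) / jtheta p a
     * (efact q p a M * efact q p b M * efact q p (1 / q ^ N) M
        / (efact q p (a * q / b) M * efact q p (a * q ^ (N + 1)) M))
     * q ^ M * (b ^ N * efact q p (a * q / b) N / efact q p (a * q) N)"

text \<open>A coordinate other than m under the move x_m -> q x_m, k_m -> k_m - 1. As e u q^n = 1,
  the last factor of (u \<xi>)_(n+1) is theta(\<xi>/e), which cancels theta(e/\<xi>) up to a
  monomial.\<close>

lemma xfactor_other:
  assumes "norm p < 1" "q \<noteq> 0" "k \<le> \<mu>" "e * (u * q ^ n) = 1"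
    and gen: "generic_arg q p (d / \<xi>)" "generic_arg q p (w * \<xi>)" "generic_arg q p (u * \<xi>)"
  shows "xfactor q p n \<mu> (d * q) (e * q) u (w * q) \<xi> k
       = xfactor q p (Suc n) (Suc \<mu>) d e u w \<xi> k * (- (\<xi> / e) / jtheta p (w * \<xi> * q ^ k))"
proof -
  have nz: "e \<noteq> 0" "\<xi> \<noteq> 0" "u \<noteq> 0" "w \<noteq> 0"
    using assms by (auto simp: generic_arg_def)
  have "u * q ^ n = 1 / e"
    using assms(4) nz(1) by (simp add: nonzero_eq_divide_eq mult.commute)
  then have e: "u * \<xi> * q ^ n = \<xi> / e"
    by (simp add: mult_ac)
  have "generic_arg q p (u * \<xi> * q ^ n)"
    using gen(3) by (subst generic_arg_power[OF assms(2)])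
  from generic_arg_inverse[OF assms(1,2) this] have "generic_arg q p (e / \<xi>)"
    unfolding e by simp
  note nonzero = generic_arg_jtheta[OF this] gen[THEN generic_arg_jtheta] generic_arg_efact[OF assms(2) gen(1)]
    generic_arg_efact[OF assms(2) gen(2)] generic_arg_efact[OF assms(2) gen(3)]
  have wk: "jtheta p (w * \<xi> * q ^ k) \<noteq> 0"
    using gen(2) assms(2) by (intro generic_arg_jtheta[of q]) simp
  have dq: "efact q p (d * q / \<xi>) m = efact q p (d / \<xi>) (Suc m) / jtheta p (d / \<xi>)" for m
    using efact_Suc_left[of q p "d / \<xi>" m] nonzero by simp
  have eq: "efact q p (e * q / \<xi>) m = efact q p (e / \<xi>) (Suc m) / jtheta p (e / \<xi>)" for m
    using efact_Suc_left[of q p "e / \<xi>" m] nonzero by simp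
  have wq: "efact q p (w * q * \<xi>) k = efact q p (w * \<xi>) k * jtheta p (w * \<xi> * q ^ k) / jtheta p (w * \<xi>)"
    using efact_shift[of p "w * \<xi>" q k] nonzero by (simp add: mult_ac nonzero_eq_divide_eq)
  have wN: "efact q p (w * q * \<xi>) n = efact q p (w * \<xi>) (Suc n) / jtheta p (w * \<xi>)"
    using efact_Suc_left[of q p "w * \<xi>" n] nonzero by (simp add: mult_ac)
  have uN: "efact q p (u * \<xi>) n = efact q p (u * \<xi>) (Suc n) / jtheta p (\<xi> / e)"
  proof -
    have "jtheta p (u * \<xi> * q ^ n) \<noteq> 0"
      using gen(3) assms(2) by (intro generic_arg_jtheta[of q]) simp
    then show ?thesis
      using efact_Suc[of q p "u * \<xi>" n] unfolding e by simp
  qed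
  have th: "jtheta p (\<xi> / e) = - (\<xi> / e) * jtheta p (e / \<xi>)"
    using nz assms(1) by (intro jtheta_swap) auto
  have sub: "Suc \<mu> - k = Suc (\<mu> - k)"
    using assms(3) by (rule Suc_diff_le)
  have alg: "(E / tE) * (D / tD) / ((D' / tD) * (W * tk / tw)) * ((W' / tw) / (U / (\<kappa> * tE)))
      = E * D / (D' * W) * (W' / U) * (\<kappa> / tk)"
    if "tE \<noteq> 0" "tD \<noteq> 0" "tw \<noteq> 0" "tk \<noteq> 0" "D' \<noteq> 0" "W \<noteq> 0" "U \<noteq> 0"
    for E D D' W W' U tE tD tw tk \<kappa> :: complex
    using that by (simp add: field_simps)
  show ?thesis
    unfolding xfactor_def dq eq wq wN uN th sub by (rule alg) (use nonzero wk in auto)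
qed

text \<open>The coordinate m itself. The quotients d/\<xi> and e/\<xi> and the length M - k are
  unchanged, since numerator and denominator, respectively both indices, move together; w \<xi>
  moves by q^2 and u \<xi> by q.\<close>

lemma xfactor_self:
  assumes "norm p < 1" "q \<noteq> 0" "k \<le> \<mu>"
    and gen: "generic_arg q p (d / \<xi>)" "generic_arg q p (w * \<xi>)" "generic_arg q p (u * \<xi>)"
  shows "xfactor q p n \<mu> (d * q) (e * q) u (w * q) (q * \<xi>) k
       = xfactor q p (Suc n) (Suc \<mu>) d e u w \<xi> (Suc k)
         * (jtheta p (u * \<xi>) * jtheta p (w * \<xi> * q ^ Suc n)
            / (jtheta p (d * q ^ \<mu> / \<xi>) * jtheta p (w * \<xi> * q ^ Suc k)))"
proof -
  have "generic_arg q p (w * \<xi> * q)" "generic_arg q p (w * \<xi> * q ^ m)" for m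
    using gen assms(2) by simp_all
  note nonzero = this[THEN generic_arg_jtheta] gen[THEN generic_arg_jtheta]
    generic_arg_efact[OF assms(2) gen(1)] generic_arg_efact[OF assms(2) gen(2)]
    generic_arg_efact[OF assms(2) gen(3)]
  have wq: "efact q p (w * q * (q * \<xi>)) m
      = efact q p (w * \<xi>) (Suc m) * jtheta p (w * \<xi> * q ^ Suc m) / (jtheta p (w * \<xi>) * jtheta p (w * \<xi> * q))" for m
    using efact_shift2[of p "w * \<xi>" q m] nonzero by (simp add: mult_ac nonzero_eq_divide_eq)
  have uN: "efact q p (u * (q * \<xi>)) n = efact q p (u * \<xi>) (Suc n) / jtheta p (u * \<xi>)"
    using efact_Suc_left[of q p "u * \<xi>" n] nonzero by (simp add: mult_ac)
  have dM: "efact q p (d / \<xi>) \<mu> = efact q p (d / \<xi>) (Suc \<mu>) / jtheta p (d * q ^ \<mu> / \<xi>)"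
  proof -
    have "generic_arg q p (d / \<xi> * q ^ \<mu>)"
      using gen(1) by (subst generic_arg_power[OF assms(2)])
    from generic_arg_jtheta[OF this] show ?thesis
      using efact_Suc[of q p "d / \<xi>" \<mu>] by simp
  qed
  have quot: "d * q / (q * \<xi>) = d / \<xi>" "e * q / (q * \<xi>) = e / \<xi>"
    using assms(2) by simp_all
  have alg: "E * (D / tD) / (D' * (W * tk / (tw * tv))) * ((W' * tn / (tw * tv)) / (U / tu))
      = E * D / (D' * W) * (W' / U) * (tu * tn / (tD * tk))"
    if "tw \<noteq> 0" "tv \<noteq> 0"  for E D D' W W' U tD tw tk tu tv tn :: complex
    using that by (simp add: mult_ac)
  show ?thesis
    unfolding xfactor_def wq uN quot dM diff_Suc_Suc
    by (rule alg) (use nonzero in auto)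
qed

text \<open>Any coordinate under the move u -> uq, w -> wq, which entails d -> d/q with e fixed. The
  arguments containing d are written with d q^M / q because this becomes a point of the second
  expansion.\<close>

lemma xfactor_zero:
  assumes "norm p < 1" "q \<noteq> 0" "k \<le> M"
    and gen: "generic_arg q p (d / \<xi>)" "generic_arg q p (w * \<xi>)" "generic_arg q p (u * \<xi>)"
  shows "xfactor q p n M (d / q) e (u * q) (w * q) \<xi> k
       = xfactor q p (Suc n) M d e u w \<xi> k
         * (jtheta p (d * q ^ M / q / (\<xi> * q ^ k)) * jtheta p (u * \<xi>)
            / (jtheta p (d * q ^ M / q / \<xi>) * jtheta p (w * \<xi> * q ^ k)))"
proof -
  have wk: "jtheta p (w * \<xi> * q ^ k) \<noteq> 0"
    using gen(2) assms(2) by (intro generic_arg_jtheta[of q]) simp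
  have "generic_arg q p (d / \<xi> / q)"
    using gen(1) by (subst generic_arg_divide[OF assms(2)])
  then have gd0: "generic_arg q p (d / q / \<xi>)"
    by (simp add: mult.commute)
  then have gd: "generic_arg q p (d / q / \<xi> * q ^ m)" for m
    by (subst generic_arg_power[OF assms(2)])
  note nonzero = gd[THEN generic_arg_jtheta] gen[THEN generic_arg_jtheta] gd0[THEN generic_arg_jtheta]
    generic_arg_efact[OF assms(2) gen(1)] generic_arg_efact[OF assms(2) gen(2)]
    generic_arg_efact[OF assms(2) gen(3)]
  have dq: "efact q p (d / q / \<xi>) m = jtheta p (d / q / \<xi>) * efact q p (d / \<xi>) m / jtheta p (d / q / \<xi> * q ^ m)" for m
    using efact_shift[of p "d / q / \<xi>" q m] nonzero assms(2) by (simp add: nonzero_eq_divide_eq)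
  have M: "d * q ^ M / q / (\<xi> * q ^ k) = d / q / \<xi> * q ^ (M - k)" "d * q ^ M / q / \<xi> = d / q / \<xi> * q ^ M"
    using assms(2,3) by (simp_all add: power_diff mult_ac)
  have wq: "efact q p (w * q * \<xi>) k = efact q p (w * \<xi>) k * jtheta p (w * \<xi> * q ^ k) / jtheta p (w * \<xi>)"
    using efact_shift[of p "w * \<xi>" q k] nonzero by (simp add: mult_ac nonzero_eq_divide_eq)
  have wN: "efact q p (w * q * \<xi>) n = efact q p (w * \<xi>) (Suc n) / jtheta p (w * \<xi>)"
    using efact_Suc_left[of q p "w * \<xi>" n] nonzero by (simp add: mult_ac)
  have uN: "efact q p (u * q * \<xi>) n = efact q p (u * \<xi>) (Suc n) / jtheta p (u * \<xi>)"
    using efact_Suc_left[of q p "u * \<xi>" n] nonzero by (simp add: mult_ac)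
  have alg: "E * (t0 * D / tM) / ((t0 * D' / tk) * (W * wk / tw)) * ((W' / tw) / (U / tu))
      = E * D / (D' * W) * (W' / U) * (tk * tu / (tM * wk))"
    if "t0 \<noteq> 0" "tw \<noteq> 0" for E D D' W W' U t0 tM tw tk tu wk :: complex
    using that by (simp add: mult_ac)
  show ?thesis
    unfolding xfactor_def dq wq wN uN M by (rule alg) (use nonzero in auto)
qed

text \<open>As u q^n = 1/e, the last factor of (u/\<gamma>)_(n+1) is theta(1/(e \<gamma>)); by
  reflection it cancels the first factor of (e \<gamma>)_(\<mu>+1) up to a monomial.\<close>

lemma cfactor_step:
  assumes "norm p < 1" "q \<noteq> 0" "e * (u * q ^ n) = 1"
    and gen: "generic_arg q p (u / \<gamma>)" "generic_arg q p (w / \<gamma>)"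
  shows "cfactor q p n \<mu> (e * q) u (w * q) \<gamma>
       = cfactor q p (Suc n) (Suc \<mu>) e u w \<gamma> * (- (e * \<gamma>) * jtheta p (w / \<gamma>))"
proof -
  have nz: "e \<noteq> 0" "u \<noteq> 0" "w \<noteq> 0" "\<gamma> \<noteq> 0"
    using assms by (auto simp: generic_arg_def)
  have "u * q ^ n = 1 / e"
    using assms(3) nz(1) by (simp add: nonzero_eq_divide_eq mult.commute)
  then have e: "u / \<gamma> * q ^ n = 1 / (e * \<gamma>)"
    by (simp add: mult_ac)
  have g: "generic_arg q p (u / \<gamma> * q ^ n)"
    using gen(1) by (subst generic_arg_power[OF assms(2)])
  then have "generic_arg q p (e * \<gamma>)"
    using generic_arg_inverse[OF assms(1,2), of "1 / (e * \<gamma>)"] unfolding e by simp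
  note nonzero = generic_arg_jtheta[OF this] gen[THEN generic_arg_jtheta] generic_arg_efact[OF assms(2) this]
    generic_arg_efact[OF assms(2) gen(1)] generic_arg_efact[OF assms(2) gen(2)]
    g[THEN generic_arg_jtheta]
  have uN: "efact q p (u / \<gamma>) n = efact q p (u / \<gamma>) (Suc n) / (- jtheta p (e * \<gamma>) / (e * \<gamma>))"
    using efact_Suc[of q p "u / \<gamma>" n] g[THEN generic_arg_jtheta] jtheta_inverse[OF assms(1), of "e * \<gamma>"] nz
    unfolding e by simp
  have wN: "efact q p (w * q / \<gamma>) n = efact q p (w / \<gamma>) (Suc n) / jtheta p (w / \<gamma>)"
    using efact_Suc_left[of q p "w / \<gamma>" n] nonzero by simp
  have eM: "efact q p (e * q * \<gamma>) \<mu> = efact q p (e * \<gamma>) (Suc \<mu>) / jtheta p (e * \<gamma>)"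
    using efact_Suc_left[of q p "e * \<gamma>" \<mu>] nonzero by (simp add: mult_ac)
  have alg: "(U / (- t / g)) / ((W / tw) * (E / t)) = U / (W * E) * (- g * tw)"
    if "t \<noteq> 0" "g \<noteq> 0" for U W E t g tw :: complex
    using that by simp
  show ?thesis
    unfolding cfactor_def uN wN eM by (rule alg) (use nonzero nz in auto)
qed

lemma cfactor_zero:
  assumes "q \<noteq> 0" and gen: "generic_arg q p (u / \<gamma>)" "generic_arg q p (w / \<gamma>)"
  shows "cfactor q p n M e (u * q) (w * q) \<gamma>
       = cfactor q p (Suc n) M e u w \<gamma> * (jtheta p (w / \<gamma>) / jtheta p (u / \<gamma>))"
  unfolding cfactor_def efact_Suc_left
  using gen[THEN generic_arg_jtheta] by simp

text \<open>a -> a q^2 with M -> M - 1 preserves a q^(2M), and q^(-n) is q times q^(-n-1), so the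
  terminating factorial just loses its first factor.\<close>

lemma sfactor_step:
  assumes "base_nome q p" "b \<noteq> 0"
    and gen: "generic_arg q p a" "generic_arg q p b" "generic_arg q p (a / b)"
  shows "sfactor q p n (a * q * q) (b * q) \<mu>
       = sfactor q p (Suc n) a b (Suc \<mu>)
         * (jtheta p (a * q ^ Suc \<mu>) * q ^ n / (q * b * jtheta p b * jtheta p (1 / q ^ Suc n)))"
proof -
  have q0: "q \<noteq> 0" using assms(1) by (simp add: base_nome_def)
  define h where "h = a * q ^ (Suc n + 1)"
  define g where "g = a * q / b"
  have "generic_arg q p (a / b * q)"
    using gen(3) by (subst generic_arg_mult[OF q0])
  then have gg: "generic_arg q p g" by (simp add: g_def)
  have gh: "generic_arg q p h"
    unfolding h_def using gen(1) by (subst generic_arg_power[OF q0])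
  have ga: "generic_arg q p (a * q)" "generic_arg q p (a * q * q)"
    using gen(1) q0 by simp_all
  have "1 / q ^ Suc n = q powi (- int (Suc n))"
    by (simp add: power_int_minus divide_inverse del: of_nat_Suc power_Suc)
  then have tq: "jtheta p (1 / q ^ Suc n) \<noteq> 0"
    using jtheta_q_powi[OF assms(1), of "- int (Suc n)"] by simp
  note nonzero = gen[THEN generic_arg_jtheta] ga[THEN generic_arg_jtheta] gg[THEN generic_arg_jtheta]
    gh[THEN generic_arg_jtheta] tq
  have A: "efact q p (a * q * q) \<mu> = efact q p a (Suc \<mu>) * jtheta p (a * q ^ Suc \<mu>) / (jtheta p a * jtheta p (a * q))"
    using efact_shift2[of p a q \<mu>] nonzero by (simp add: nonzero_eq_divide_eq mult_ac)
  have B: "efact q p (b * q) \<mu> = efact q p b (Suc \<mu>) / jtheta p b"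
    using efact_Suc_left[of q p b \<mu>] nonzero by simp
  have Q: "efact q p (1 / q ^ n) \<mu> = efact q p (1 / q ^ Suc n) (Suc \<mu>) / jtheta p (1 / q ^ Suc n)"
    using efact_Suc_left[of q p "1 / q ^ Suc n" \<mu>] nonzero q0 by simp
  have "a * q * q * q / (b * q) = g * q"
    using q0 by (simp add: g_def)
  then have G: "efact q p (a * q * q * q / (b * q)) m = efact q p g (Suc m) / jtheta p g" for m
    using efact_Suc_left[of q p g m] nonzero by simp
  have h: "a * q * q * q ^ (n + 1) = h * q"
    by (simp add: h_def)
  have H: "efact q p (a * q * q * q ^ (n + 1)) \<mu> = efact q p h (Suc \<mu>) / jtheta p h"
    unfolding h using efact_Suc_left[of q p h \<mu>] nonzero by simp
  have AN: "efact q p (a * q * q * q) n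
      = efact q p (a * q) (Suc n) * jtheta p h / (jtheta p (a * q) * jtheta p (a * q * q))"
    using efact_shift2[of p "a * q" q n] nonzero
    by (simp add: nonzero_eq_divide_eq mult_ac h_def)
  have T: "a * q * q * q ^ (2 * \<mu>) = a * q ^ (2 * Suc \<mu>)"
    by (simp add: mult_ac)
  have alg: "T / t2 * (A * s / (t0 * t1) * (B / tb) * (Q / tq) / (G / tg * (H / th))) * q ^ \<mu>
      * ((b * q) ^ n * (G' / tg) / (A' * th / (t1 * t2)))
    = T / t0 * (A * B * Q / (G * H)) * q ^ Suc \<mu> * (b ^ Suc n * G' / A') * (s * q ^ n / (q * b * tb * tq))"
    if "t1 \<noteq> 0" "t2 \<noteq> 0" "tg \<noteq> 0" "th \<noteq> 0" for T A B Q G H G' A' t0 t1 t2 tb tq tg th s :: complex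
    using that q0 assms(2) by (simp add: power_mult_distrib mult_ac)
  show ?thesis
    unfolding sfactor_def T A B Q G H AN g_def[symmetric] h_def[symmetric]
    by (rule alg) (use nonzero in auto)
qed

text \<open>Only N drops. The factor theta(q^M / q^(n+1)) vanishes for M = n + 1, the indices that
  the sum for n does not contain.\<close>

lemma sfactor_zero:
  assumes "base_nome q p" "b \<noteq> 0"
    and gen: "generic_arg q p a" "generic_arg q p (a / b)"
  shows "sfactor q p n a b M
       = sfactor q p (Suc n) a b M
         * (jtheta p (q ^ M / q ^ Suc n) * jtheta p (a * q ^ (Suc n + M))
            / (jtheta p (1 / q ^ Suc n) * b * jtheta p (a * q ^ Suc n / b)))"
proof -
  have q0: "q \<noteq> 0" using assms(1) by (simp add: base_nome_def)
  have "generic_arg q p (a * q ^ m)" for m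
    using gen(1) by (subst generic_arg_power[OF q0])
  note ga = this[THEN generic_arg_jtheta]
  have "generic_arg q p (a / b * q ^ Suc n)"
    using gen(2) by (subst generic_arg_power[OF q0])
  from generic_arg_jtheta[OF this] have tg: "jtheta p (a * q ^ Suc n / b) \<noteq> 0"
    by simp
  have "1 / q ^ Suc n = q powi (- int (Suc n))"
    by (simp add: power_int_minus divide_inverse del: of_nat_Suc power_Suc)
  then have tq: "jtheta p (1 / q ^ Suc n) \<noteq> 0"
    using jtheta_q_powi[OF assms(1), of "- int (Suc n)"] by simp
  have Q: "efact q p (1 / q ^ n) M
      = efact q p (1 / q ^ Suc n) M * jtheta p (q ^ M / q ^ Suc n) / jtheta p (1 / q ^ Suc n)"
    using efact_shift[of p "1 / q ^ Suc n" q M] tq q0 by (simp add: nonzero_eq_divide_eq mult_ac)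
  have H: "efact q p (a * q ^ (n + 1)) M
      = jtheta p (a * q ^ Suc n) * efact q p (a * q ^ (Suc n + 1)) M / jtheta p (a * q ^ (Suc n + M))"
    using efact_shift[of p "a * q ^ Suc n" q M] ga[of "Suc n + M"]
    by (simp add: nonzero_eq_divide_eq mult_ac power_add)
  have G: "efact q p (a * q / b) n = efact q p (a * q / b) (Suc n) / jtheta p (a * q ^ Suc n / b)"
    using efact_Suc[of q p "a * q / b" n] tg by (simp add: mult_ac)
  have A: "efact q p (a * q) n = efact q p (a * q) (Suc n) / jtheta p (a * q ^ Suc n)"
    using efact_Suc[of q p "a * q" n] ga[of "Suc n"] by (simp add: mult_ac)
  have alg: "T * (A * B * (Q * s / tq) / (G * (th * H / tm))) * c * (b ^ n * (G' / tg) / (A' / th))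
    = T * (A * B * Q / (G * H)) * c * (b ^ Suc n * G' / A') * (s * tm / (tq * b * tg))"
    if "th \<noteq> 0" for T A B Q G H G' A' c tq tg th tm s :: complex
    using that assms(2) by (simp add: mult_ac)
  show ?thesis
    unfolding sfactor_def Q H G A by (rule alg) (rule ga)
qed

lemma prod_step:
  fixes f :: "'a \<Rightarrow> complex"
  assumes "finite I" "m \<in> I" "\<And>i. i \<in> I \<Longrightarrow> i \<noteq> m \<Longrightarrow> f i = g i * h i" "f m = g m * s"
  shows "prod f I = prod g I * (prod h (I - {m}) * s)"
proof -
  have "prod f I = f m * prod f (I - {m})"
    using assms by (simp add: prod.remove)
  also have "prod f (I - {m}) = prod g (I - {m}) * prod h (I - {m})"
    using assms(3) by (simp flip: prod.distrib)
  finally show ?thesis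
    using assms by (simp add: prod.remove)
qed

section \<open>The Vandermonde quotient under the move in x_m and k_m\<close>

definition dfactor where
  "dfactor r q p x k = Delta r p (\<lambda>i. x i * q ^ k i) / Delta r p x
     / (\<Prod>i=1..r. \<Prod>j=1..r. efact q p (q * x i / x j) (k i))"

text \<open>Reflection brings every factor containing x_m into the form x_j theta(x_m/x_j), also for
  j < m. The resulting sign depends only on m and therefore cancels between two values of
  Delta.\<close>

lemma Delta_remove:
  assumes "norm p < 1" "m \<in> {1..r}" "\<And>i. i \<in> {1..r} \<Longrightarrow> x i \<noteq> 0"
  shows "Delta r p x = (\<Prod>i\<in>{1..<m}. - 1) * (\<Prod>j\<in>{1..r} - {m}. x j * jtheta p (x m / x j))
    * (\<Prod>i\<in>{1..r} - {m}. \<Prod>j\<in>{i<..r} - {m}. x j * jtheta p (x i / x j))"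
proof -
  let ?f = "\<lambda>i j. x j * jtheta p (x i / x j)"
  have "Delta r p x = (\<Prod>j\<in>{m<..r}. ?f m j) * (\<Prod>i\<in>{1..r} - {m}. \<Prod>j\<in>{i<..r}. ?f i j)"
    unfolding Delta_def using assms(2) by (subst prod.remove[of _ m]) auto
  also have "(\<Prod>i\<in>{1..r} - {m}. \<Prod>j\<in>{i<..r}. ?f i j)
    = (\<Prod>i\<in>{1..r} - {m}. (if i < m then ?f i m else 1) * (\<Prod>j\<in>{i<..r} - {m}. ?f i j))"
  proof (intro prod.cong refl)
    fix i assume "i \<in> {1..r} - {m}"
    then show "(\<Prod>j\<in>{i<..r}. ?f i j) = (if i < m then ?f i m else 1) * (\<Prod>j\<in>{i<..r} - {m}. ?f i j)"
      using assms(2) by (cases "i < m") (auto simp: prod.remove[of "{i<..r}" m])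
  qed
  also have "\<dots> = (\<Prod>i\<in>{1..r} - {m}. if i < m then ?f i m else 1)
      * (\<Prod>i\<in>{1..r} - {m}. \<Prod>j\<in>{i<..r} - {m}. ?f i j)"
    by (rule prod.distrib)
  also have "(\<Prod>i\<in>{1..r} - {m}. if i < m then ?f i m else 1) = (\<Prod>i\<in>{1..<m}. ?f i m)"
    using assms(2) by (intro prod.mono_neutral_cong_right) auto
  also have "(\<Prod>i\<in>{1..<m}. ?f i m) = (\<Prod>i\<in>{1..<m}. - 1 * ?f m i)"
  proof (intro prod.cong refl)
    fix i assume "i \<in> {1..<m}"
    then have "x i \<noteq> 0" "x m \<noteq> 0"
      using assms by auto
    then show "?f i m = - 1 * ?f m i"
      using jtheta_swap[OF assms(1), of "x i" "x m"] by simp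
  qed
  also have "\<dots> = (\<Prod>i\<in>{1..<m}. - 1) * (\<Prod>i\<in>{1..<m}. ?f m i)"
    by (rule prod.distrib)
  also have "(\<Prod>j\<in>{m<..r}. ?f m j) * ((\<Prod>i\<in>{1..<m}. - 1) * (\<Prod>i\<in>{1..<m}. ?f m i)
        * (\<Prod>i\<in>{1..r} - {m}. \<Prod>j\<in>{i<..r} - {m}. ?f i j))
    = (\<Prod>i\<in>{1..<m}. - 1) * ((\<Prod>i\<in>{1..<m}. ?f m i) * (\<Prod>j\<in>{m<..r}. ?f m j))
        * (\<Prod>i\<in>{1..r} - {m}. \<Prod>j\<in>{i<..r} - {m}. ?f i j)"
    by (simp only: mult_ac)
  also have "(\<Prod>i\<in>{1..<m}. ?f m i) * (\<Prod>j\<in>{m<..r}. ?f m j) = (\<Prod>j\<in>{1..<m} \<union> {m<..r}. ?f m j)"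
    by (rule prod.union_disjoint[symmetric]) auto
  also have "{1..<m} \<union> {m<..r} = {1..r} - {m}"
    using assms(2) by auto
  finally show ?thesis .
qed

text \<open>Both sides contain the same Delta(x q^k), because x_m gains the factor q that q^(k_m)
  loses. What changes is Delta(x) and, in the double product, row m, column m and their common
  entry.\<close>

lemma dfactor_step:
  assumes p: "norm p < 1" and q0: "q \<noteq> 0" and m: "m \<in> {1..r}" and x0: "\<And>i. i \<in> {1..r} \<Longrightarrow> x i \<noteq> 0"
    and gen: "\<And>i j. i \<in> {1..r} \<Longrightarrow> j \<in> {1..r} \<Longrightarrow> i \<noteq> j \<Longrightarrow> generic_arg q p (x i / x j)"
    and qq: "\<And>j. efact q p q j \<noteq> 0"
  shows "dfactor r q p (x(m := q * x m)) \<kappa>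
    = dfactor r q p x (\<kappa>(m := Suc (\<kappa> m)))
      * ((\<Prod>j=1..r. jtheta p (x j * q ^ (\<kappa>(m := Suc (\<kappa> m))) j / x m))
         * (\<Prod>j\<in>{1..r} - {m}. - (x m / x j)))"
proof -
  define I where "I = {1..r} - {m}"
  define x' where "x' = x(m := q * x m)"
  define k where "k = \<kappa>(m := Suc (\<kappa> m))"
  define v where "v = (\<lambda>i. x i * q ^ k i)"
  have I: "finite I" "m \<notin> I" "{1..r} = insert m I" "\<And>i. i \<in> I \<Longrightarrow> i \<in> {1..r}" "\<And>i. i \<in> I \<Longrightarrow> i \<noteq> m"
    using m by (auto simp: I_def)
  have v: "(\<lambda>i. x' i * q ^ \<kappa> i) = v"
    by (auto simp: v_def x'_def k_def)
  have genI: "generic_arg q p (x m / x j)" "generic_arg q p (x j / x m)" if "j \<in> I" for j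
    using gen[of m j] gen[of j m] that m by (auto simp: I_def)
  have gq: "jtheta p (q * x m / x j) \<noteq> 0" if "j \<in> I" for j
  proof -
    have "generic_arg q p (x m / x j * q)"
      using genI(1)[OF that] by (subst generic_arg_mult[OF q0])
    from generic_arg_jtheta[OF this] show ?thesis by (simp add: mult.commute)
  qed
  define rest where "rest = (\<Prod>i\<in>I. \<Prod>j\<in>{i<..r} - {m}. x j * jtheta p (x i / x j))"
  define sgn where "sgn = (\<Prod>i\<in>{1..<m}. - 1 :: complex)"
  have Dx: "Delta r p x = sgn * (\<Prod>j\<in>I. x j * jtheta p (x m / x j)) * rest"
    unfolding I_def rest_def sgn_def by (rule Delta_remove[OF p m x0])
  have Dx': "Delta r p x' = sgn * (\<Prod>j\<in>I. x j * jtheta p (q * x m / x j)) * rest"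
  proof -
    have "x' i \<noteq> 0" if "i \<in> {1..r}" for i
      using x0[OF that] q0 m x0 by (auto simp: x'_def)
    note Delta_remove[OF p m this, folded I_def]
    also have "(\<Prod>j\<in>I. x' j * jtheta p (x' m / x' j)) = (\<Prod>j\<in>I. x j * jtheta p (q * x m / x j))"
      by (intro prod.cong refl) (auto simp: x'_def I_def)
    also have "(\<Prod>i\<in>I. \<Prod>j\<in>{i<..r} - {m}. x' j * jtheta p (x' i / x' j)) = rest"
      unfolding rest_def by (intro prod.cong refl) (auto simp: x'_def I_def)
    finally show ?thesis
      by (simp only: sgn_def)
  qed
  define Q where "Q = (\<lambda>x k. \<Prod>i=1..r. \<Prod>j=1..r. efact q p (q * x i / x j) (k i))"
  define Q0 where "Q0 = (\<Prod>i\<in>I. \<Prod>j\<in>I. efact q p (q * x i / x j) (k i))"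
  have Qsplit: "Q x k = efact q p (q * x m / x m) (k m) * (\<Prod>j\<in>I. efact q p (q * x m / x j) (k m))
      * ((\<Prod>i\<in>I. efact q p (q * x i / x m) (k i)) * (\<Prod>i\<in>I. \<Prod>j\<in>I. efact q p (q * x i / x j) (k i)))" for x k
    unfolding Q_def I(3) using I by (simp add: prod.distrib)
  have km: "k m = Suc (\<kappa> m)" "\<And>i. i \<in> I \<Longrightarrow> k i = \<kappa> i"
    using I by (auto simp: k_def)
  have x'm: "x' m = q * x m" "\<And>i. i \<in> I \<Longrightarrow> x' i = x i"
    using I by (auto simp: x'_def)
  have xm: "x m \<noteq> 0" using x0 m by simp
  have row: "(\<Prod>j\<in>I. efact q p (q * x m / x j) (Suc (\<kappa> m)))
      = (\<Prod>j\<in>I. jtheta p (q * x m / x j)) * (\<Prod>j\<in>I. efact q p (q * (q * x m) / x j) (\<kappa> m))"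
    unfolding prod.distrib[symmetric] by (intro prod.cong refl) (simp add: efact_Suc_left mult_ac)
  have col: "(\<Prod>i\<in>I. efact q p (q * x i / x m) (k i))
      = (\<Prod>i\<in>I. efact q p (q * x i / (q * x m)) (\<kappa> i)) * ((\<Prod>i\<in>I. jtheta p (v i / x m)) / (\<Prod>i\<in>I. jtheta p (x i / x m)))"
    unfolding prod_dividef[symmetric] prod.distrib[symmetric]
  proof (intro prod.cong refl)
    fix i assume i: "i \<in> I"
    have "q * x i / (q * x m) = x i / x m" using q0 by simp
    then show "efact q p (q * x i / x m) (k i)
      = efact q p (q * x i / (q * x m)) (\<kappa> i) * (jtheta p (v i / x m) / jtheta p (x i / x m))"
      using efact_shift[of p "x i / x m" q "\<kappa> i"] generic_arg_jtheta[OF genI(2)[OF i]] km(2)[OF i]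
      by (simp add: v_def nonzero_eq_divide_eq mult_ac)
  qed
  have dia: "efact q p (q * x m / x m) (Suc (\<kappa> m)) = efact q p (q * (q * x m) / (q * x m)) (\<kappa> m) * jtheta p (v m / x m)"
    using xm q0 efact_Suc[of q p q "\<kappa> m"] by (simp add: v_def km)
  \<comment> \<open>The theta(q x_m/x_j) from row m are the ones that Delta(x') has in place of
    theta(x_m/x_j), so they cancel in the quotient.\<close>
  have Qx: "Q x k = Q x' \<kappa> * (jtheta p (v m / x m) * (\<Prod>j\<in>I. jtheta p (q * x m / x j))
      * ((\<Prod>i\<in>I. jtheta p (v i / x m)) / (\<Prod>i\<in>I. jtheta p (x i / x m))))"
    unfolding Qsplit km(1) x'm(1) row col dia
    using I(1) by (simp add: x'm(2) km(2) mult_ac cong: prod.cong)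
  have nz: "(\<Prod>j\<in>I. jtheta p (q * x m / x j)) \<noteq> 0" "(\<Prod>i\<in>I. jtheta p (x i / x m)) \<noteq> 0"
    "(\<Prod>i\<in>I. jtheta p (x m / x i)) \<noteq> 0"
    using I(1) gq genI[THEN generic_arg_jtheta] by auto
  have swap: "(\<Prod>j\<in>I. - (x m / x j)) = (\<Prod>j\<in>I. jtheta p (x m / x j)) / (\<Prod>j\<in>I. jtheta p (x j / x m))"
    unfolding prod_dividef[symmetric]
  proof (intro prod.cong refl)
    fix j assume j: "j \<in> I"
    show "- (x m / x j) = jtheta p (x m / x j) / jtheta p (x j / x m)"
      using jtheta_swap[OF p xm, of "x j"] x0[OF I(4)[OF j]] generic_arg_jtheta[OF genI(2)[OF j]]
      by (simp add: nonzero_eq_divide_eq)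
  qed
  have vprod: "(\<Prod>j=1..r. jtheta p (v j / x m)) = jtheta p (v m / x m) * (\<Prod>j\<in>I. jtheta p (v j / x m))"
    unfolding I(3) using I by simp
  define vI where "vI = (\<Prod>j\<in>I. jtheta p (v j / x m))"
  have "jtheta p (v m / x m) \<noteq> 0"
    using qq[of "Suc (\<kappa> m)"] xm by (simp add: v_def km efact_Suc)
  moreover have "vI \<noteq> 0"
  proof -
    have "generic_arg q p (x j / x m * q ^ k j)" if "j \<in> I" for j
      using genI(2)[OF that] by (subst generic_arg_power[OF q0])
    from generic_arg_jtheta[OF this] show ?thesis
      unfolding vI_def v_def using I(1) by simp
  qed
  ultimately have "Delta r p v / Delta r p x' / Q x' \<kappa>
      = Delta r p v / Delta r p x / Q x k * (jtheta p (v m / x m) * vI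
        * ((\<Prod>j\<in>I. jtheta p (x m / x j)) / (\<Prod>j\<in>I. jtheta p (x j / x m))))"
    using nz unfolding Dx Dx' Qx prod.distrib vI_def[symmetric] by simp
  then show ?thesis
    unfolding dfactor_def x'_def[symmetric] k_def[symmetric] I_def[symmetric] v Q_def swap vI_def
    using vprod by (simp add: v_def)
qed

section \<open>Partial fractions at x_1, ..., x_r and two further points\<close>

definition pf_point :: "complex \<Rightarrow> nat \<Rightarrow> (nat \<Rightarrow> complex) \<Rightarrow> complex \<Rightarrow> complex
    \<Rightarrow> (complex \<Rightarrow> complex) \<Rightarrow> nat \<Rightarrow> complex" where
  "pf_point p r x s t P m = P (x m) / ((\<Prod>l\<in>{1..r} - {m}. jtheta p (x m / x l))
     * jtheta p (x m / s) * jtheta p (x m / t))"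

text \<open>The term at the additional point s; exchanging s and t gives the one at t.\<close>

definition pf_extra :: "complex \<Rightarrow> nat \<Rightarrow> (nat \<Rightarrow> complex) \<Rightarrow> complex \<Rightarrow> complex
    \<Rightarrow> (complex \<Rightarrow> complex) \<Rightarrow> complex" where
  "pf_extra p r x s t P = P s / ((\<Prod>l=1..r. jtheta p (s / x l)) * jtheta p (s / t))"

lemma pf_sum:
  fixes x :: "nat \<Rightarrow> complex"
  assumes "norm p < 1" "length zs = r + 2" "0 \<notin> set zs" "s \<noteq> 0" "t \<noteq> 0"
    and x0: "\<And>i. i \<in> {1..r} \<Longrightarrow> x i \<noteq> 0"
    and xx: "\<And>i j. i \<in> {1..r} \<Longrightarrow> j \<in> {1..r} \<Longrightarrow> i \<noteq> j \<Longrightarrow> jtheta p (x i / x j) \<noteq> 0"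
    and xs: "\<And>i. i \<in> {1..r} \<Longrightarrow> jtheta p (x i / s) \<noteq> 0"
    and xt: "\<And>i. i \<in> {1..r} \<Longrightarrow> jtheta p (x i / t) \<noteq> 0"
    and st: "jtheta p (s / t) \<noteq> 0"
    and bal: "prod x {1..r} * s * t = prod_list zs"
    and P: "\<And>y. P y = (\<Prod>z\<leftarrow>zs. jtheta p (y / z))"
  shows "(\<Sum>m=1..r. pf_point p r x s t P m) + pf_extra p r x s t P + pf_extra p r x t s P = 0"
proof -
  \<comment> \<open>The indices 0 and r + 1 are free for the two points that do not belong to
    x.\<close>
  define y where "y = (\<lambda>i. if i = 0 then s else if i = Suc r then t else x i)"
  define I where "I = {0..Suc r}"
  have I: "I = insert 0 (insert (Suc r) {1..r})" by (auto simp: I_def)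
  have y: "y 0 = s" "y (Suc r) = t" "\<And>i. i \<in> {1..r} \<Longrightarrow> y i = x i" by (auto simp: y_def)
  have rev: "jtheta p (b / a) \<noteq> 0" if "jtheta p (a / b) \<noteq> 0" "a \<noteq> 0" "b \<noteq> 0" for a b
    using jtheta_swap[OF assms(1), of a b] that by auto
  have "(\<Sum>i\<in>I. (\<Prod>z\<leftarrow>zs. jtheta p (y i / z)) / (\<Prod>j\<in>I - {i}. jtheta p (y i / y j))) = 0"
  proof (rule theta_partial_fractions)
    show "jtheta p (y i / y j) \<noteq> 0" if "i \<in> I" "j \<in> I" "i \<noteq> j" for i j
      using that xx[of i j] xs[of i] xt[of i] st rev[OF st] rev[OF xs[of j]] rev[OF xt[of j]] assms(4,5) x0
      by (auto simp: I y_def)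
    have "prod y {1..r} = prod x {1..r}" by (rule prod.cong) (auto simp: y)
    then show "prod y I = prod_list zs"
      using bal unfolding I by (simp add: y mult_ac)
  qed (use assms in \<open>auto simp: I_def y_def\<close>)
  then have "(\<Sum>i\<in>I. P (y i) / (\<Prod>j\<in>I - {i}. jtheta p (y i / y j))) = 0"
    by (simp add: P)
  moreover have "P (y i) / (\<Prod>j\<in>I - {i}. jtheta p (y i / y j)) = pf_point p r x s t P i"
    if i: "i \<in> {1..r}" for i
  proof -
    have "I - {i} = insert 0 (insert (Suc r) ({1..r} - {i}))" using i by (auto simp: I_def)
    moreover have "(\<Prod>j\<in>{1..r} - {i}. jtheta p (y i / y j)) = (\<Prod>j\<in>{1..r} - {i}. jtheta p (x i / x j))"
      using i by (intro prod.cong) (auto simp: y)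
    ultimately show ?thesis
      using i by (simp add: pf_point_def y mult_ac)
  qed
  moreover have "P (y 0) / (\<Prod>j\<in>I - {0}. jtheta p (y 0 / y j)) = pf_extra p r x s t P"
  proof -
    have "I - {0} = insert (Suc r) {1..r}" by (auto simp: I_def)
    moreover have "(\<Prod>j=1..r. jtheta p (s / y j)) = (\<Prod>j=1..r. jtheta p (s / x j))"
      by (intro prod.cong) (auto simp: y)
    ultimately show ?thesis
      by (simp add: pf_extra_def y mult_ac)
  qed
  moreover have "P (y (Suc r)) / (\<Prod>j\<in>I - {Suc r}. jtheta p (y (Suc r) / y j)) = pf_extra p r x t s P"
  proof -
    have "I - {Suc r} = insert 0 {1..r}" by (auto simp: I_def)
    moreover have "(\<Prod>j=1..r. jtheta p (t / y j)) = (\<Prod>j=1..r. jtheta p (t / x j))"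
      by (intro prod.cong) (auto simp: y)
    ultimately show ?thesis
      by (simp add: pf_extra_def y mult_ac)
  qed
  ultimately show ?thesis
    unfolding I by (simp add: algebra_simps)
qed

text \<open>
  In the application \<open>w / u = b\<close>, and \<open>CX / u\<close>, \<open>CX / w\<close>, \<open>CX / (u w x\<^sub>i)\<close> are \<open>a\<close>, \<open>a / b\<close>, \<open>d / x\<^sub>i\<close> up to
  powers of \<open>q\<close>.
\<close>

definition generic_params :: "complex \<Rightarrow> complex \<Rightarrow> nat \<Rightarrow> (nat \<Rightarrow> complex) \<Rightarrow> complex \<Rightarrow> complex
    \<Rightarrow> (nat \<Rightarrow> complex) \<Rightarrow> bool" where
  "generic_params q p r c u w x \<longleftrightarrow>
     (\<forall>i\<in>{1..r}. \<forall>j\<in>{1..r}. i \<noteq> j \<longrightarrow> generic_arg q p (x i / x j)) \<and>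
     (\<forall>i\<in>{1..r}. generic_arg q p (w * x i) \<and> generic_arg q p (u * x i) \<and>
        generic_arg q p (prod c {1..r+1} * prod x {1..r} / (u * w * x i))) \<and>
     (\<forall>j\<in>{1..r+1}. generic_arg q p (u / c j) \<and> generic_arg q p (w / c j)) \<and>
     generic_arg q p (w / u) \<and> generic_arg q p (prod c {1..r+1} * prod x {1..r} / u) \<and>
     generic_arg q p (prod c {1..r+1} * prod x {1..r} / w)"

lemma prod_fun_upd_mult:
  fixes x :: "nat \<Rightarrow> complex"
  assumes "finite I" "m \<in> I"
  shows "prod (x(m := q * x m)) I = q * prod x I"
proof -
  have "prod (x(m := q * x m)) I = q * x m * prod (x(m := q * x m)) (I - {m})"
    using assms by (simp add: prod.remove)
  also have "prod (x(m := q * x m)) (I - {m}) = prod x (I - {m})"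
    by (intro prod.cong) auto
  finally show ?thesis
    using assms by (simp add: prod.remove mult.assoc)
qed

lemma generic_arg_cong:
  assumes "q \<noteq> 0" "y = z \<or> y = z * q \<or> y * q = z"
  shows "generic_arg q p y \<longleftrightarrow> generic_arg q p z"
  using assms generic_arg_mult[OF assms(1)] by metis

text \<open>The move multiplies each monomial in \<open>generic_params\<close> by 1, q, q^2 or 1/q,
  so the condition survives and the induction hypothesis becomes available.\<close>

lemma generic_params_step:
  assumes q0: "q \<noteq> 0" and m: "m \<in> {1..r}" and gen: "generic_params q p r c u w x"
  shows "generic_params q p r c u (w * q) (x(m := q * x m))"
proof -
  let ?x = "x(m := q * x m)"
  have X: "prod ?x {1..r} = q * prod x {1..r}"
    using m by (intro prod_fun_upd_mult) auto
  show ?thesis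
    unfolding generic_params_def X
  proof (intro conjI ballI impI)
    fix i j assume "i \<in> {1..r}" "j \<in> {1..r}" "i \<noteq> j"
    moreover have "generic_arg q p (?x i / ?x j) \<longleftrightarrow> generic_arg q p (x i / x j)"
      using q0 calculation by (intro generic_arg_cong) auto
    ultimately show "generic_arg q p (?x i / ?x j)"
      using gen by (auto simp: generic_params_def)
  next
    fix i assume i: "i \<in> {1..r}"
    then have g: "generic_arg q p (w * x i)" "generic_arg q p (u * x i)"
      "generic_arg q p (prod c {1..r+1} * prod x {1..r} / (u * w * x i))"
      using gen by (auto simp: generic_params_def)
    have "generic_arg q p (w * q * ?x i) \<longleftrightarrow> generic_arg q p (w * q * x i)"
      using q0 by (intro generic_arg_cong) (auto simp: mult_ac)
    also have "\<dots> \<longleftrightarrow> generic_arg q p (w * x i)"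
      using q0 by (intro generic_arg_cong) (auto simp: mult_ac)
    finally show "generic_arg q p (w * q * ?x i)" using g by simp
    have "generic_arg q p (u * ?x i) \<longleftrightarrow> generic_arg q p (u * x i)"
      using q0 by (intro generic_arg_cong) (auto simp: mult_ac)
    then show "generic_arg q p (u * ?x i)" using g by simp
    have "generic_arg q p (prod c {1..r+1} * (q * prod x {1..r}) / (u * (w * q) * ?x i))
      \<longleftrightarrow> generic_arg q p (prod c {1..r+1} * prod x {1..r} / (u * w * x i))"
      using q0 by (intro generic_arg_cong) (auto simp: mult_ac)
    then show "generic_arg q p (prod c {1..r+1} * (q * prod x {1..r}) / (u * (w * q) * ?x i))"
      using g by simp
  next
    fix j assume j: "j \<in> {1..r+1}"
    then show "generic_arg q p (u / c j)"
      using gen by (auto simp: generic_params_def)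
    have "generic_arg q p (w * q / c j) \<longleftrightarrow> generic_arg q p (w / c j)"
      using q0 by (intro generic_arg_cong) (auto simp: mult_ac)
    then show "generic_arg q p (w * q / c j)"
      using gen j by (auto simp: generic_params_def)
  next
    have "generic_arg q p (w * q / u) \<longleftrightarrow> generic_arg q p (w / u)"
      using q0 by (intro generic_arg_cong) (auto simp: mult_ac)
    then show "generic_arg q p (w * q / u)"
      using gen by (auto simp: generic_params_def)
    have "generic_arg q p (prod c {1..r+1} * (q * prod x {1..r}) / u)
      \<longleftrightarrow> generic_arg q p (prod c {1..r+1} * prod x {1..r} / u)"
      using q0 by (intro generic_arg_cong) (auto simp: mult_ac)
    then show "generic_arg q p (prod c {1..r+1} * (q * prod x {1..r}) / u)"
      using gen by (auto simp: generic_params_def)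
    have "generic_arg q p (prod c {1..r+1} * (q * prod x {1..r}) / (w * q))
      \<longleftrightarrow> generic_arg q p (prod c {1..r+1} * prod x {1..r} / w)"
      using q0 by (intro generic_arg_cong) (auto simp: mult_ac)
    then show "generic_arg q p (prod c {1..r+1} * (q * prod x {1..r}) / (w * q))"
      using gen by (auto simp: generic_params_def)
  qed
qed

lemma generic_params_zero:
  assumes q0: "q \<noteq> 0" and gen: "generic_params q p r c u w x"
  shows "generic_params q p r c (u * q) (w * q) x"
  unfolding generic_params_def
proof (intro conjI ballI impI)
  fix i j assume "i \<in> {1..r}" "j \<in> {1..r}" "i \<noteq> j"
  then show "generic_arg q p (x i / x j)"
    using gen by (auto simp: generic_params_def)
next
  fix i assume i: "i \<in> {1..r}"
  then have g: "generic_arg q p (w * x i)" "generic_arg q p (u * x i)"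
    "generic_arg q p (prod c {1..r+1} * prod x {1..r} / (u * w * x i))"
    using gen by (auto simp: generic_params_def)
  have "generic_arg q p (w * q * x i) \<longleftrightarrow> generic_arg q p (w * x i)"
    "generic_arg q p (u * q * x i) \<longleftrightarrow> generic_arg q p (u * x i)"
    using q0 by (intro generic_arg_cong; auto)+
  then show "generic_arg q p (w * q * x i)" "generic_arg q p (u * q * x i)" using g by simp_all
  have "generic_arg q p (prod c {1..r+1} * prod x {1..r} / (u * q * (w * q) * x i))
    \<longleftrightarrow> generic_arg q p (prod c {1..r+1} * prod x {1..r} / (u * (w * q) * x i))"
    using q0 by (intro generic_arg_cong) (auto simp: mult_ac)
  also have "\<dots> \<longleftrightarrow> generic_arg q p (prod c {1..r+1} * prod x {1..r} / (u * w * x i))"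
    using q0 by (intro generic_arg_cong) (auto simp: mult_ac)
  finally show "generic_arg q p (prod c {1..r+1} * prod x {1..r} / (u * q * (w * q) * x i))"
    using g by simp
next
  fix j assume j: "j \<in> {1..r+1}"
  have "generic_arg q p (w * q / c j) \<longleftrightarrow> generic_arg q p (w / c j)"
    "generic_arg q p (u * q / c j) \<longleftrightarrow> generic_arg q p (u / c j)"
    using q0 by (intro generic_arg_cong; auto)+
  then show "generic_arg q p (u * q / c j)" "generic_arg q p (w * q / c j)"
    using gen j by (auto simp: generic_params_def)
next
  have "generic_arg q p (w * q / (u * q)) \<longleftrightarrow> generic_arg q p (w / u)"
    "generic_arg q p (prod c {1..r+1} * prod x {1..r} / (u * q)) \<longleftrightarrow> generic_arg q p (prod c {1..r+1} * prod x {1..r} / u)"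
    "generic_arg q p (prod c {1..r+1} * prod x {1..r} / (w * q)) \<longleftrightarrow> generic_arg q p (prod c {1..r+1} * prod x {1..r} / w)"
    using q0 by (intro generic_arg_cong; auto)+
  then show "generic_arg q p (w * q / (u * q))"
    "generic_arg q p (prod c {1..r+1} * prod x {1..r} / (u * q))"
    "generic_arg q p (prod c {1..r+1} * prod x {1..r} / (w * q))"
    using gen by (auto simp: generic_params_def)
qed

text \<open>
  The summand divided by the right-hand side. The parameters \<open>u = aq/bd\<close>, \<open>w = aq/d\<close>, \<open>e = aq/CX\<close> are
  redundant; in \<open>jterm\<close> everything is expressed by \<open>u\<close>, \<open>w\<close>, \<open>c\<close>, \<open>x\<close>, for which the recursion in \<open>N\<close>
  takes place without a side condition.
\<close>

definition nterm where
  "nterm q p r c N a b d e u w x k =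
     dfactor r q p x k * sfactor q p N a b (msize r k)
     * (\<Prod>j=1..r+1. cfactor q p N (msize r k) e u w (c j))
     * ((\<Prod>i=1..r. xfactor q p N (msize r k) d e u w (x i) (k i))
        * (\<Prod>i=1..r. \<Prod>j=1..r+1. efact q p (c j * x i) (k i)))"

definition jterm where
  "jterm q p r c N u w x k =
     nterm q p r c N (prod c {1..r+1} * prod x {1..r} / (u * q ^ N)) (w / u)
       (q * (prod c {1..r+1} * prod x {1..r}) / (u * w * q ^ N)) (q / (u * q ^ N)) u w x k"

text \<open>C X is multiplied by q while N drops by one; solving for the dependent parameters then
  gives the shifts of a, b, d, e for which the factors were compared.\<close>

lemma jterm_shift_self:
  assumes "q \<noteq> 0" "m \<in> {1..r}"
    and "a = prod c {1..r+1} * prod x {1..r} / (u * q ^ Suc n)" "b = w / u"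
    and "d = q * (prod c {1..r+1} * prod x {1..r}) / (u * w * q ^ Suc n)" "e = q / (u * q ^ Suc n)"
  shows "jterm q p r c n u (w * q) (x(m := q * x m)) k
    = nterm q p r c n (a * q * q) (b * q) (d * q) (e * q) u (w * q) (x(m := q * x m)) k"
proof -
  have X: "prod (x(m := q * x m)) {1..r} = q * prod x {1..r}"
    using assms(2) by (intro prod_fun_upd_mult) auto
  have eqs: "prod c {1..r+1} * (q * prod x {1..r}) / (u * q ^ n) = a * q * q"
    "w * q / u = b * q"
    "q * (prod c {1..r+1} * (q * prod x {1..r})) / (u * (w * q) * q ^ n) = d * q"
    "q / (u * q ^ n) = e * q"
    using assms(1,3-) by simp_all
  show ?thesis
    unfolding jterm_def X eqs ..
qed

lemma jterm_shift_zero: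
  assumes "q \<noteq> 0"
    and "a = prod c {1..r+1} * prod x {1..r} / (u * q ^ Suc n)" "b = w / u"
    and "d = q * (prod c {1..r+1} * prod x {1..r}) / (u * w * q ^ Suc n)" "e = q / (u * q ^ Suc n)"
  shows "jterm q p r c n (u * q) (w * q) x k
    = nterm q p r c n a b (d / q) e (u * q) (w * q) x k"
proof -
  have eqs: "prod c {1..r+1} * prod x {1..r} / (u * q * q ^ n) = a"
    "w * q / (u * q) = b"
    "q * (prod c {1..r+1} * prod x {1..r}) / (u * q * (w * q) * q ^ n) = d / q"
    "q / (u * q * q ^ n) = e"
    using assms(1,2-) by (simp_all add: mult_ac)
  show ?thesis
    unfolding jterm_def eqs ..
qed

section \<open>The recursion in \<open>N\<close>\<close>

text \<open>Collects the monomials that reflections produce. There is one more c_j than x_i, which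
  leaves a single factor -t.\<close>

lemma prod_minus_mult:
  fixes c x :: "nat \<Rightarrow> complex"
  assumes "t \<noteq> 0"
  shows "(\<Prod>j=1..r+1. - (t * c j)) * (\<Prod>i=1..r. - (x i / t)) = - (t * (prod c {1..r+1} * prod x {1..r}))"
proof (induction r)
  case 0
  show ?case by simp
next
  case (Suc r)
  have "(\<Prod>j=1..Suc r+1. - (t * c j)) * (\<Prod>i=1..Suc r. - (x i / t))
    = ((\<Prod>j=1..r+1. - (t * c j)) * (\<Prod>i=1..r. - (x i / t))) * (c (Suc r + 1) * x (Suc r))"
    using assms by (simp add: mult_ac)
  also have "\<dots> = - (t * (prod c {1..Suc r+1} * prod x {1..Suc r}))"
    unfolding Suc.IH by (simp add: mult_ac)
  finally show ?case .
qed

section \<open>Summands for n + 1 against summands for n\<close>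

locale jackson_step =
  fixes q p :: complex and r n :: nat and c x :: "nat \<Rightarrow> complex" and u w a b d e :: complex
  assumes base: "base_nome q p"
    and gen: "generic_params q p r c u w x"
    and x0: "\<And>i. i \<in> {1..r} \<Longrightarrow> x i \<noteq> 0"
    and a_def: "a = prod c {1..r+1} * prod x {1..r} / (u * q ^ Suc n)"
    and b_def: "b = w / u"
    and d_def: "d = q * (prod c {1..r+1} * prod x {1..r}) / (u * w * q ^ Suc n)"
    and e_def: "e = q / (u * q ^ Suc n)"
begin

lemma p1: "norm p < 1" and q0: "q \<noteq> 0"
  using base by (auto simp: base_nome_def)

abbreviation "CX \<equiv> prod c {1..r+1} * prod x {1..r}"

lemma gens:
  "\<And>i j. i \<in> {1..r} \<Longrightarrow> j \<in> {1..r} \<Longrightarrow> i \<noteq> j \<Longrightarrow> generic_arg q p (x i / x j)"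
  "\<And>i. i \<in> {1..r} \<Longrightarrow> generic_arg q p (w * x i)"
  "\<And>i. i \<in> {1..r} \<Longrightarrow> generic_arg q p (u * x i)"
  "\<And>j. j \<in> {1..r+1} \<Longrightarrow> generic_arg q p (u / c j)"
  "\<And>j. j \<in> {1..r+1} \<Longrightarrow> generic_arg q p (w / c j)"
  "generic_arg q p b"
  using gen by (auto simp: generic_params_def b_def)

lemma uw0: "u \<noteq> 0" "w \<noteq> 0" "b \<noteq> 0"
  using generic_argD[OF gens(6)] by (auto simp: b_def)

lemma CX0: "CX \<noteq> 0"
  using gen by (auto simp: generic_params_def generic_arg_def)

lemma c0: "j \<in> {1..r+1} \<Longrightarrow> c j \<noteq> 0"
  using generic_argD[OF gens(4)] by auto

lemma ade0: "a \<noteq> 0" "d \<noteq> 0" "e \<noteq> 0"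
  using CX0 uw0 q0 unfolding a_def d_def e_def by simp_all

lemma rels: "a * q ^ Suc n = CX / u" "e * (u * q ^ n) = 1" "d * w = a * q" "e * CX = d * w" "b * u = w"
  using uw0 q0 by (simp_all add: a_def b_def d_def e_def)

lemma gen_a: "generic_arg q p a"
proof -
  have "generic_arg q p (CX / u / q ^ Suc n)"
    using gen by (subst generic_arg_divide_power[OF q0]) (auto simp: generic_params_def)
  then show ?thesis by (simp add: a_def)
qed

lemma gen_ab: "generic_arg q p (a / b)"
proof -
  have "generic_arg q p (CX / w / q ^ Suc n)"
    using gen by (subst generic_arg_divide_power[OF q0]) (auto simp: generic_params_def)
  moreover have "CX / w / q ^ Suc n = a / b"
    using uw0 by (simp add: a_def b_def)
  ultimately show ?thesis by simp
qed

lemma gen_d: "i \<in> {1..r} \<Longrightarrow> generic_arg q p (d / x i)"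
proof -
  assume i: "i \<in> {1..r}"
  have "generic_arg q p (CX / (u * w * x i) / q ^ n)"
    using gen i by (subst generic_arg_divide_power[OF q0]) (auto simp: generic_params_def)
  moreover have "CX / (u * w * x i) / q ^ n = d / x i"
    using q0 by (simp add: d_def mult_ac)
  ultimately show ?thesis by simp
qed

text \<open>
  Numerators of the two partial fraction expansions: the first defines the weights, the second shows
  that the terms satisfy the recursion with these weights.
\<close>

definition "zeros1 = (\<lambda>y. jtheta p (y / (d * q ^ n)) * (\<Prod>j=1..r+1. jtheta p (y * c j)))"

definition "zeros2 k = (\<lambda>y. jtheta p (y / (d * q ^ n)) * jtheta p (y * (w * q ^ Suc n))
    * (\<Prod>j=1..r. jtheta p (y / (x j * q ^ k j))))"

text \<open>The term of the first expansion at 1/w. Dividing the other terms by -R gives weights of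
  total 1.\<close>

definition "R = pf_extra p r x (1 / w) (1 / u) zeros1"

text \<open>The part that the quotients of shifted by unshifted summands have in common: the scalar
  and c-factors, and the x-factors as if every coordinate were different from m. By
  \<open>weight_one\<close>, K k / R is minus the reciprocal of the term of the second expansion at
  1/w.\<close>

definition "K k = jtheta p (a * q ^ msize r k) * q ^ n / (q * b * jtheta p b * jtheta p (1 / q ^ Suc n))
    * (\<Prod>j=1..r+1. - (e * c j) * jtheta p (w / c j))
    * (\<Prod>i=1..r. - (x i / e) / jtheta p (w * x i * q ^ k i)) * (e * q / d)"

text \<open>All monomials in K k combine to a constant, through e C X = d w, b u = w and e u q^n =
  1.\<close>

lemma monomial_e:
  "q ^ n / (q * b) * ((\<Prod>j=1..r+1. - (e * c j)) * (\<Prod>i=1..r. - (x i / e))) * (e * q / d) = - 1"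
proof -
  have "q ^ n / (q * b) * - (e * CX) * (e * q / d) = - ((e * (u * q ^ n)) * (d * w) / (d * (b * u)))"
    unfolding rels(4) using q0 uw0 by simp
  then show ?thesis
    unfolding prod_minus_mult[OF ade0(3)] rels(2) rels(5) using ade0 uw0 by simp
qed

text \<open>The quotient of the two summands is, up to K k and sign, the term of the second
  expansion at x_m divided by that of the first. Both terms contain theta(x_m/(d q^n)), theta(w x_m)
  and the theta(x_m/x_l), which therefore leave no trace.\<close>

lemma nterm_step:
  fixes \<kappa> m
  assumes m: "m \<in> {1..r}"
  defines "k \<equiv> \<kappa>(m := Suc (\<kappa> m))"
  defines "\<delta> \<equiv> d * q ^ msize r k / q"
  shows "- pf_point p r x (1 / w) (1 / u) zeros1 m / R
      * nterm q p r c n (a * q * q) (b * q) (d * q) (e * q) u (w * q) (x(m := q * x m)) \<kappa>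
    = nterm q p r c (Suc n) a b d e u w x k * (K k / R * pf_point p r x (1 / w) \<delta> (zeros2 k) m)"
proof -
  define x' where "x' = x(m := q * x m)"
  define \<mu> where "\<mu> = msize r \<kappa>"
  have M: "msize r k = Suc \<mu>"
  proof -
    have "(\<Sum>i\<in>{1..r} - {m}. k i) = (\<Sum>i\<in>{1..r} - {m}. \<kappa> i)"
      by (intro sum.cong) (auto simp: k_def)
    then show ?thesis
      using m sum.remove[of "{1..r}" m k] sum.remove[of "{1..r}" m \<kappa>]
      unfolding msize_def \<mu>_def by (simp add: k_def)
  qed
  have \<delta>: "\<delta> = d * q ^ \<mu>"
    using q0 by (simp add: \<delta>_def M)
  have \<kappa>\<mu>: "\<kappa> i \<le> \<mu>" if "i \<in> {1..r}" for i
    unfolding \<mu>_def msize_def using that by (intro member_le_sum) auto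
  have xm: "x m \<noteq> 0" using x0 m by simp
  have qq: "efact q p q j \<noteq> 0" for j
  proof -
    have "q * q ^ i = q powi int (Suc i)" for i
      by (simp add: power_int_add power_int_def nat_add_distrib)
    then show ?thesis
      using jtheta_q_powi[OF base, of "int (Suc _)"] by (simp add: efact_def del: of_nat_Suc)
  qed
  define A where "A = (\<Prod>j=1..r. jtheta p (x j * q ^ k j / x m))"
  define B where "B = (\<Prod>j\<in>{1..r} - {m}. - (x m / x j))"
  define L where "L = (\<Prod>l\<in>{1..r} - {m}. jtheta p (x m / x l))"
  define Pv where "Pv = (\<Prod>j=1..r. jtheta p (x m / (x j * q ^ k j)))"
  define sC where "sC = (\<Prod>j=1..r+1. jtheta p (x m * c j))"
  define S where "S = jtheta p (a * q ^ Suc \<mu>) * q ^ n / (q * b * jtheta p b * jtheta p (1 / q ^ Suc n))"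
  define \<Gamma> where "\<Gamma> = (\<Prod>j=1..r+1. - (e * c j) * jtheta p (w / c j))"
  define G1 where "G1 = (\<Prod>i\<in>{1..r} - {m}. - (x i / e) / jtheta p (w * x i * q ^ k i))"
  define G where "G = (\<Prod>i=1..r. - (x i / e) / jtheta p (w * x i * q ^ k i))"
  have D: "dfactor r q p x' \<kappa> = dfactor r q p x k * (A * B)"
    unfolding x'_def k_def A_def B_def by (rule dfactor_step[OF p1 q0 m x0 gens(1) qq])
  have S': "sfactor q p n (a * q * q) (b * q) \<mu> = sfactor q p (Suc n) a b (Suc \<mu>) * S"
    unfolding S_def by (rule sfactor_step[OF base uw0(3) gen_a gens(6) gen_ab])
  have \<Gamma>': "(\<Prod>j=1..r+1. cfactor q p n \<mu> (e * q) u (w * q) (c j))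
      = (\<Prod>j=1..r+1. cfactor q p (Suc n) (Suc \<mu>) e u w (c j)) * \<Gamma>"
    unfolding \<Gamma>_def prod.distrib[symmetric, where A = "{1..r+1}"]
    by (intro prod.cong refl cfactor_step[OF p1 q0 rels(2) gens(4) gens(5)])
  have X': "(\<Prod>i=1..r. xfactor q p n \<mu> (d * q) (e * q) u (w * q) (x' i) (\<kappa> i))
      = (\<Prod>i=1..r. xfactor q p (Suc n) (Suc \<mu>) d e u w (x i) (k i))
        * (G1 * (jtheta p (u * x m) * jtheta p (w * x m * q ^ Suc n)
           / (jtheta p (\<delta> / x m) * jtheta p (w * x m * q ^ k m))))"
    unfolding G1_def
  proof (rule prod_step)
    fix i assume i: "i \<in> {1..r}" "i \<noteq> m"
    then show "xfactor q p n \<mu> (d * q) (e * q) u (w * q) (x' i) (\<kappa> i) =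
        xfactor q p (Suc n) (Suc \<mu>) d e u w (x i) (k i) * (- (x i / e) / jtheta p (w * x i * q ^ k i))"
      using xfactor_other[OF p1 q0 \<kappa>\<mu>[OF i(1)] rels(2) gen_d gens(2) gens(3), OF i(1) i(1) i(1)]
      by (simp add: x'_def k_def)
  next
    show "xfactor q p n \<mu> (d * q) (e * q) u (w * q) (x' m) (\<kappa> m) =
        xfactor q p (Suc n) (Suc \<mu>) d e u w (x m) (k m)
        * (jtheta p (u * x m) * jtheta p (w * x m * q ^ Suc n)
           / (jtheta p (\<delta> / x m) * jtheta p (w * x m * q ^ k m)))"
      unfolding \<delta> using xfactor_self[OF p1 q0 \<kappa>\<mu>[OF m] gen_d gens(2) gens(3), OF m m m]
      by (simp add: x'_def k_def)
  qed (use m in auto)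
  have E: "(\<Prod>i=1..r. \<Prod>j=1..r+1. efact q p (c j * x i) (k i))
      = (\<Prod>i=1..r. \<Prod>j=1..r+1. efact q p (c j * x' i) (\<kappa> i)) * ((\<Prod>i\<in>{1..r} - {m}. 1) * sC)"
  proof (rule prod_step)
    show "(\<Prod>j=1..r+1. efact q p (c j * x m) (k m)) = (\<Prod>j=1..r+1. efact q p (c j * x' m) (\<kappa> m)) * sC"
      unfolding sC_def prod.distrib[symmetric, where A = "{1..r+1}"]
      by (intro prod.cong refl) (simp add: k_def x'_def efact_Suc_left mult_ac)
  qed (use m in \<open>auto simp: k_def x'_def\<close>)
  \<comment> \<open>Reflection makes the arguments in A those of the numerator
    \<open>zeros2 k\<close>. The monomials x_j/x_m it produces cancel those in B, and the powers of
    q multiply to q^|k|.\<close>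
  have AB: "A * B = - (q ^ Suc \<mu>) * Pv"
  proof -
    have "A = (\<Prod>j=1..r. - (x j * q ^ k j / x m)) * Pv"
      unfolding A_def Pv_def prod.distrib[symmetric, where A = "{1..r}"]
      by (intro prod.cong refl jtheta_swap) (use p1 x0 xm q0 in auto)
    also have "(\<Prod>j=1..r. - (x j * q ^ k j / x m))
        = - (q ^ k m) * (\<Prod>j\<in>{1..r} - {m}. - (x j * q ^ k j / x m))"
      using m xm prod.remove[of "{1..r}" m "\<lambda>j. - (x j * q ^ k j / x m)"] by simp
    finally have "A * B = - (q ^ k m) * ((\<Prod>j\<in>{1..r} - {m}. - (x j * q ^ k j / x m)) * B) * Pv"
      by (simp add: mult_ac)
    also have "(\<Prod>j\<in>{1..r} - {m}. - (x j * q ^ k j / x m)) * B = (\<Prod>j\<in>{1..r} - {m}. q ^ k j)"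
      unfolding B_def prod.distrib[symmetric]
      by (intro prod.cong refl) (use x0 xm in auto)
    also have "- (q ^ k m) * (\<Prod>j\<in>{1..r} - {m}. q ^ k j) = - (\<Prod>j=1..r. q ^ k j)"
      using m prod.remove[of "{1..r}" m "\<lambda>j. q ^ k j"] by simp
    also have "(\<Prod>j=1..r. q ^ k j) = q ^ Suc \<mu>"
      using M by (simp add: msize_def flip: power_sum)
    finally show ?thesis .
  qed
  have G: "G = - (x m / e) / jtheta p (w * x m * q ^ k m) * G1"
    unfolding G_def G1_def using m by (intro prod.remove) auto
  have \<delta>0: "\<delta> \<noteq> 0" using ade0 q0 by (simp add: \<delta>)
  have t\<delta>: "jtheta p (\<delta> / x m) = - (\<delta> / x m) * jtheta p (x m / \<delta>)"
    by (rule jtheta_swap[OF p1 \<delta>0 xm])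
  have tu: "jtheta p (u * x m) \<noteq> 0"
    by (rule generic_arg_jtheta[OF gens(3)[OF m]])
  let ?N' = "nterm q p r c n (a * q * q) (b * q) (d * q) (e * q) u (w * q) x' \<kappa>"
  let ?N = "nterm q p r c (Suc n) a b d e u w x k"
  have alg: "D * (- Q * Pv) * (S1 * S) * (C1 * \<Gamma>) * (X1 * (G1 * (tu * tN / (- (\<delta> / xm) * t\<delta> * tk))) * E1) * sC
    = D * S1 * C1 * (X1 * (E1 * (1 * sC))) * (S * \<Gamma> * (- (xm / e) / tk * G1) * (e * Q / \<delta>)) * Pv * tu * tN / t\<delta> * - 1"
    if "xm \<noteq> 0" "e \<noteq> 0" for D Q Pv S1 S C1 \<Gamma> X1 G1 tu tN \<delta> xm t\<delta> tk E1 sC e :: complex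
    using that by (simp add: mult_ac)
  \<comment> \<open>\<open>sC\<close> stays on the left because theta(c_j x_m) may vanish; the
    weight at m contains it as a numerator, so it is never divided by.\<close>
  have main: "?N' * sC = ?N * (S * \<Gamma> * G * (e * q ^ Suc \<mu> / \<delta>)) * Pv * jtheta p (u * x m) * jtheta p (w * x m * q ^ Suc n)
      / jtheta p (x m / \<delta>) * - 1"
    unfolding nterm_def M \<mu>_def[symmetric] D S' \<Gamma>' X' E AB G t\<delta> prod.neutral_const
    by (rule alg) (use xm ade0 in auto)
  have eqd: "e * q ^ Suc \<mu> / \<delta> = e * q / d"
    using q0 by (simp add: \<delta>)
  have KS: "K k = S * \<Gamma> * G * (e * q / d)"
    unfolding K_def M S_def \<Gamma>_def G_def ..
  have p1m: "pf_point p r x (1 / w) (1 / u) zeros1 m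
      = jtheta p (x m / (d * q ^ n)) * sC / (L * jtheta p (w * x m) * jtheta p (u * x m))"
    unfolding pf_point_def zeros1_def sC_def L_def by (simp add: mult_ac)
  have p2m: "pf_point p r x (1 / w) \<delta> (zeros2 k) m
      = jtheta p (x m / (d * q ^ n)) * jtheta p (w * x m * q ^ Suc n) * Pv / (L * jtheta p (w * x m) * jtheta p (x m / \<delta>))"
    unfolding pf_point_def zeros2_def Pv_def L_def by (simp add: mult_ac)
  have alg2: "- (t1 * sC / (L * tw * tu)) / R * N' = N * (KK / R * (t1 * tN * Pv / (L * tw * t\<delta>)))"
    if "N' * sC = N * KK * Pv * tu * tN / t\<delta> * - 1" "tu \<noteq> 0"
    for t1 sC L tw tu R N' N KK tN Pv t\<delta> :: complex
  proof -
    have "- (t1 * sC / (L * tw * tu)) / R * N' = - (t1 / (L * tw * tu) / R) * (N' * sC)"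
      by simp
    also have "\<dots> = N * (KK / R * (t1 * tN * Pv / (L * tw * t\<delta>)))"
      unfolding that(1) using that(2) by (simp add: mult_ac)
    finally show ?thesis .
  qed
  show ?thesis
    unfolding x'_def[symmetric] p1m p2m KS eqd[symmetric]
    by (rule alg2[OF main tu])
qed

text \<open>Here x and k are unchanged, so only the scalar, c- and x-factors contribute. Their
  quotient is the term of the second expansion at \<open>\<delta>\<close> over that of the first at
  1/u, up to K k and sign; the monomials agree by \<open>mono\<close>, both sides of which are
  -1.\<close>

lemma nterm_zero:
  fixes k
  defines "\<delta> \<equiv> d * q ^ msize r k / q"
  shows "- pf_extra p r x (1 / u) (1 / w) zeros1 / R
      * nterm q p r c n a b (d / q) e (u * q) (w * q) x k
    = nterm q p r c (Suc n) a b d e u w x k * (K k / R * pf_extra p r x \<delta> (1 / w) (zeros2 k))"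
proof -
  define M where "M = msize r k"
  have kM: "k i \<le> M" if "i \<in> {1..r}" for i
    unfolding M_def msize_def using that by (intro member_le_sum) auto
  define S0 where "S0 = jtheta p (q ^ M / q ^ Suc n) * jtheta p (a * q ^ (Suc n + M))
            / (jtheta p (1 / q ^ Suc n) * b * jtheta p (a * q ^ Suc n / b))"
  have S': "sfactor q p n a b M = sfactor q p (Suc n) a b M * S0"
    unfolding S0_def by (rule sfactor_zero[OF base uw0(3) gen_a gen_ab])
  define Tw Tu where "Tw = (\<Prod>j=1..r+1. jtheta p (w / c j))" and "Tu = (\<Prod>j=1..r+1. jtheta p (u / c j))"
  have C': "(\<Prod>j=1..r+1. cfactor q p n M e (u * q) (w * q) (c j))
      = (\<Prod>j=1..r+1. cfactor q p (Suc n) M e u w (c j)) * (Tw / Tu)"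
    unfolding Tw_def Tu_def prod_dividef[symmetric] prod.distrib[symmetric, where A = "{1..r+1}"]
    by (intro prod.cong refl cfactor_zero[OF q0 gens(4) gens(5)])
  define Dv where "Dv = (\<Prod>i=1..r. jtheta p (\<delta> / (x i * q ^ k i)))"
  define Dx where "Dx = (\<Prod>i=1..r. jtheta p (\<delta> / x i))"
  define Ux where "Ux = (\<Prod>i=1..r. jtheta p (u * x i))"
  define Wk where "Wk = (\<Prod>i=1..r. jtheta p (w * x i * q ^ k i))"
  have X': "(\<Prod>i=1..r. xfactor q p n M (d / q) e (u * q) (w * q) (x i) (k i))
      = (\<Prod>i=1..r. xfactor q p (Suc n) M d e u w (x i) (k i)) * (Dv * Ux / (Dx * Wk))"
    unfolding Dv_def Dx_def Ux_def Wk_def \<delta>_def M_def[symmetric]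
      prod_dividef[symmetric] prod.distrib[symmetric, where A = "{1..r}"]
    by (intro prod.cong refl xfactor_zero[OF p1 q0 kM gen_d gens(2) gens(3)])
  let ?Nz = "nterm q p r c n a b (d / q) e (u * q) (w * q) x k"
  let ?N = "nterm q p r c (Suc n) a b d e u w x k"
  have alg0: "D * (S1 * S0) * (C1 * t) * ((X1 * y) * E) = D * S1 * C1 * (X1 * E) * (S0 * t * y)"
    for D S1 S0 C1 t X1 y E :: complex
    by simp
  have N0: "?Nz = ?N * (S0 * (Tw / Tu) * (Dv * Ux / (Dx * Wk)))"
    unfolding nterm_def M_def[symmetric] S' C' X' by (rule alg0)
  define Cu where "Cu = (\<Prod>j=1..r+1. - (1 / u * c j))"
  define Xu where "Xu = (\<Prod>i=1..r. - (x i / (1 / u)))"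
  define Ce where "Ce = (\<Prod>j=1..r+1. - (e * c j))"
  define Xe where "Xe = (\<Prod>i=1..r. - (x i / e))"
  have CuXu: "Cu * Xu = - (CX / u)"
    unfolding Cu_def Xu_def using prod_minus_mult[of "1 / u" c r x] uw0 by simp
  have e1: "(\<Prod>j=1..r+1. jtheta p (1 / u * c j)) = Cu * Tu"
    unfolding Cu_def Tu_def prod.distrib[symmetric, where A = "{1..r+1}"]
  proof (intro prod.cong refl)
    fix j assume j: "j \<in> {1..r+1}"
    show "jtheta p (1 / u * c j) = - (1 / u * c j) * jtheta p (u / c j)"
      using jtheta_swap[OF p1 c0[OF j] uw0(1)] by simp
  qed
  have e2: "(\<Prod>l=1..r. jtheta p (1 / u / x l)) = Ux / Xu"
    unfolding Xu_def Ux_def prod_dividef[symmetric]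
  proof (intro prod.cong refl)
    fix i assume i: "i \<in> {1..r}"
    show "jtheta p (1 / u / x i) = jtheta p (u * x i) / - (x i / (1 / u))"
      using jtheta_inverse[OF p1, of "u * x i"] uw0 x0[OF i] by (simp add: mult.commute)
  qed
  have e3: "jtheta p (1 / u / (d * q ^ n)) = - (b / (a * q ^ Suc n)) * jtheta p (a * q ^ Suc n / b)"
  proof -
    have "u * (d * q ^ n) * b = a * q ^ Suc n"
      using rels(3,5) by (metis mult.assoc mult.commute power_Suc)
    then have "1 / u / (d * q ^ n) = b / (a * q ^ Suc n)"
      using uw0 ade0 q0 by (simp add: field_simps)
    then show ?thesis
      using jtheta_swap[OF p1 uw0(3), of "a * q ^ Suc n"] ade0 q0 by simp
  qed
  have e4: "(1 / u) / (1 / w) = b" using uw0 by (simp add: b_def)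
  have x1: "pf_extra p r x (1 / u) (1 / w) zeros1
     = - (b / (a * q ^ Suc n)) * jtheta p (a * q ^ Suc n / b) * (Cu * Tu) / (Ux / Xu * jtheta p b)"
    unfolding pf_extra_def zeros1_def e1 e2 e3 e4 ..
  have del: "\<delta> / (d * q ^ n) = q ^ M / q ^ Suc n" "\<delta> * (w * q ^ Suc n) = a * q ^ (Suc n + M)"
    "\<delta> / (1 / w) = a * q ^ M"
  proof -
    show "\<delta> / (d * q ^ n) = q ^ M / q ^ Suc n"
      using ade0 by (simp add: \<delta>_def M_def)
    have "\<delta> * w = d * w * q ^ M / q"
      by (simp add: \<delta>_def M_def mult_ac)
    then have "\<delta> * w = a * q ^ M"
      unfolding rels(3) using q0 by simp
    then show "\<delta> / (1 / w) = a * q ^ M" "\<delta> * (w * q ^ Suc n) = a * q ^ (Suc n + M)"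
      by (simp_all add: power_add mult_ac)
  qed
  have x2: "pf_extra p r x \<delta> (1 / w) (zeros2 k)
    = jtheta p (q ^ M / q ^ Suc n) * jtheta p (a * q ^ (Suc n + M)) * Dv / (Dx * jtheta p (a * q ^ M))"
    unfolding pf_extra_def zeros2_def Dv_def Dx_def del ..
  have K: "K k = jtheta p (a * q ^ M) * q ^ n / (q * b * jtheta p b * jtheta p (1 / q ^ Suc n))
    * (Ce * Tw) * (Xe / Wk) * (e * q / d)"
    unfolding K_def M_def[symmetric] Ce_def Tw_def Xe_def Wk_def prod.distrib prod_dividef ..
  have nz: "Ux \<noteq> 0" "Tu \<noteq> 0" "jtheta p (a * q ^ Suc n / b) \<noteq> 0" "jtheta p (a * q ^ M) \<noteq> 0"
  proof -
    show "Ux \<noteq> 0" "Tu \<noteq> 0"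
      unfolding Ux_def Tu_def using gens(3,4)[THEN generic_arg_jtheta] by auto
    have "generic_arg q p (a / b * q ^ Suc n)"
      using gen_ab by (subst generic_arg_power[OF q0])
    moreover have "generic_arg q p (a * q ^ M)"
      using gen_a by (subst generic_arg_power[OF q0])
    ultimately have "jtheta p (a / b * q ^ Suc n) \<noteq> 0" "jtheta p (a * q ^ M) \<noteq> 0"
      by (blast dest: generic_arg_jtheta)+
    then show "jtheta p (a * q ^ Suc n / b) \<noteq> 0" "jtheta p (a * q ^ M) \<noteq> 0"
      by simp_all
  qed
  have mono: "b / (a * q ^ Suc n) * (Cu * Xu) / b = q ^ n / (q * b) * (Ce * Xe) * (e * q / d)"
  proof -
    have "b / (a * q ^ Suc n) * (Cu * Xu) / b = - 1"
      unfolding CuXu rels(1) using uw0 CX0 by simp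
    moreover have "q ^ n / (q * b) * (Ce * Xe) * (e * q / d) = - 1"
      unfolding Ce_def Xe_def by (rule monomial_e)
    ultimately show ?thesis by simp
  qed
  have alg: "- (- m1 * tab * (Cu * Tu) / (Ux / Xu * tb)) / R * (N * (tM * tN / (tq * b * tab) * (Tw / Tu) * (Dv * Ux / (Dx * Wk))))
    = N * (ta * Q / (q * b * tb * tq) * (Ce * Tw) * (Xe / Wk) * ed / R * (tM * tN * Dv / (Dx * ta)))"
    if "m1 * (Cu * Xu) / b = Q / (q * b) * (Ce * Xe) * ed" "tab \<noteq> 0" "Tu \<noteq> 0" "Ux \<noteq> 0" "ta \<noteq> 0"
    for m1 tab Cu Tu Ux Xu tb R N tM tN tq b Tw Dv Dx Wk ta Q q Ce Xe ed :: complex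
  proof -
    have "- (- m1 * tab * (Cu * Tu) / (Ux / Xu * tb)) / R * (N * (tM * tN / (tq * b * tab) * (Tw / Tu) * (Dv * Ux / (Dx * Wk))))
      = (m1 * (Cu * Xu) / b) * (N * tM * tN * Tw * Dv / (tb * R * tq * Dx * Wk))"
      using that(2-) by (simp add: mult_ac)
    also have "\<dots> = N * (ta * Q / (q * b * tb * tq) * (Ce * Tw) * (Xe / Wk) * ed / R * (tM * tN * Dv / (Dx * ta)))"
      unfolding that(1) using that(2-) by (simp add: mult_ac)
    finally show ?thesis .
  qed
  show ?thesis
    unfolding N0 x1 x2 K S0_def by (rule alg[OF mono nz(3) nz(2) nz(1) nz(4)])
qed

lemma jtheta_inverse_nz: "generic_arg q p y \<Longrightarrow> jtheta p (1 / y) \<noteq> 0"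
  by (rule generic_arg_jtheta[OF generic_arg_inverse[OF p1 q0]])

lemma R_nz: "R \<noteq> 0"
proof -
  have "w * (d * q ^ n) = a * q ^ Suc n"
    using rels(3) by (simp add: mult_ac)
  then have "1 / w / (d * q ^ n) = 1 / (a * q ^ Suc n)"
    by simp
  moreover have "generic_arg q p (a * q ^ Suc n)"
    using gen_a by (subst generic_arg_power[OF q0])
  ultimately have 1: "jtheta p (1 / w / (d * q ^ n)) \<noteq> 0"
    using jtheta_inverse_nz by metis
  have 2: "jtheta p (1 / w * c j) \<noteq> 0" if "j \<in> {1..r+1}" for j
    using jtheta_inverse_nz[OF gens(5)[OF that]] by simp
  have 3: "jtheta p (1 / w / x i) \<noteq> 0" if "i \<in> {1..r}" for i
    using jtheta_inverse_nz[OF gens(2)[OF that]] by simp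
  have "(1 / w) / (1 / u) = 1 / b"
    by (simp add: b_def)
  then have 4: "jtheta p ((1 / w) / (1 / u)) \<noteq> 0"
    using jtheta_inverse_nz[OF gens(6)] by metis
  have "(\<Prod>j=1..r+1. jtheta p (1 / w * c j)) \<noteq> 0" "(\<Prod>i=1..r. jtheta p (1 / w / x i)) \<noteq> 0"
    by (subst prod_zero_iff, simp, use 2 3 in blast)+
  with 1 4 show ?thesis
    unfolding R_def pf_extra_def zeros1_def by (simp del: prod.cl_ivl_Suc)
qed

text \<open>The terms of both expansions at 1/w share theta(1/(w d q^n)) and all theta(1/(w x_l)).
  Reflection matches the remaining theta functions with those of K k, and the monomials cancel by
  \<open>monomial_e\<close> and C X = a u q^(n+1).\<close>

lemma weight_one:
  fixes k
  defines "\<delta> \<equiv> d * q ^ msize r k / q"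
  shows "K k / R * pf_extra p r x (1 / w) \<delta> (zeros2 k) = - 1"
proof -
  define M where "M = msize r k"
  define Tw where "Tw = (\<Prod>j=1..r+1. jtheta p (w / c j))"
  define Wk where "Wk = (\<Prod>i=1..r. jtheta p (w * x i * q ^ k i))"
  define Lx where "Lx = (\<Prod>l=1..r. jtheta p (1 / w / x l))"
  define Cw where "Cw = (\<Prod>j=1..r+1. - (1 / w * c j))"
  define Xw where "Xw = (\<Prod>i=1..r. - (x i / (1 / w)))"
  define Ce where "Ce = (\<Prod>j=1..r+1. - (e * c j))"
  define Xe where "Xe = (\<Prod>i=1..r. - (x i / e))"
  have CwXw: "Cw * Xw = - (CX / w)"
    unfolding Cw_def Xw_def using prod_minus_mult[of "1 / w" c r x] uw0 by simp
  have CeXe: "q ^ n / (q * b) * (Ce * Xe) * (e * q / d) = - 1"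
    unfolding Ce_def Xe_def by (rule monomial_e)
  have e1: "(\<Prod>j=1..r+1. jtheta p (1 / w * c j)) = Cw * Tw"
    unfolding Cw_def Tw_def prod.distrib[symmetric, where A = "{1..r+1}"]
  proof (intro prod.cong refl)
    fix j assume j: "j \<in> {1..r+1}"
    show "jtheta p (1 / w * c j) = - (1 / w * c j) * jtheta p (w / c j)"
      using jtheta_swap[OF p1 c0[OF j] uw0(2)] by simp
  qed
  have e2: "(1 / w) / (1 / u) = 1 / b" by (simp add: b_def)
  have e3: "jtheta p (1 / b) = - jtheta p b / b"
    by (rule jtheta_inverse[OF p1 uw0(3)])
  have R: "R = jtheta p (1 / w / (d * q ^ n)) * (Cw * Tw) / (Lx * (- jtheta p b / b))"
    unfolding R_def pf_extra_def zeros1_def e1 e2 e3 Lx_def ..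
  have e4: "(\<Prod>j=1..r. jtheta p (1 / w / (x j * q ^ k j))) = Wk / (Xw * q ^ M)"
  proof -
    have "(\<Prod>j=1..r. jtheta p (1 / w / (x j * q ^ k j)))
        = (\<Prod>i=1..r. jtheta p (w * x i * q ^ k i) / (- (x i / (1 / w)) * q ^ k i))"
    proof (intro prod.cong refl)
      fix i assume i: "i \<in> {1..r}"
      show "jtheta p (1 / w / (x i * q ^ k i)) = jtheta p (w * x i * q ^ k i) / (- (x i / (1 / w)) * q ^ k i)"
        using jtheta_inverse[OF p1, of "w * x i * q ^ k i"] uw0 x0[OF i] q0 by (simp add: mult_ac)
    qed
    then show ?thesis
      unfolding prod_dividef prod.distrib Wk_def Xw_def M_def msize_def power_sum .
  qed
  have e5: "jtheta p (1 / w * (w * q ^ Suc n)) = - (q ^ Suc n) * jtheta p (1 / q ^ Suc n)"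
    using jtheta_inverse[OF p1, of "q ^ Suc n"] q0 uw0 by simp
  have e6: "jtheta p (1 / w / \<delta>) = - jtheta p (a * q ^ M) / (a * q ^ M)"
  proof -
    have "w * \<delta> = d * w * q ^ M / q"
      by (simp add: \<delta>_def M_def mult_ac)
    then have "w * \<delta> = a * q ^ M"
      unfolding rels(3) using q0 by simp
    then have "1 / w / \<delta> = 1 / (a * q ^ M)" by simp
    then show ?thesis
      using jtheta_inverse[OF p1, of "a * q ^ M"] ade0 q0 by simp
  qed
  have x2: "pf_extra p r x (1 / w) \<delta> (zeros2 k)
    = jtheta p (1 / w / (d * q ^ n)) * (- (q ^ Suc n) * jtheta p (1 / q ^ Suc n)) * (Wk / (Xw * q ^ M))
      / (Lx * (- jtheta p (a * q ^ M) / (a * q ^ M)))"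
    unfolding pf_extra_def zeros2_def e4 e5 e6 Lx_def ..
  have K: "K k = jtheta p (a * q ^ M) * q ^ n / (q * b * jtheta p b * jtheta p (1 / q ^ Suc n))
    * (Ce * Tw) * (Xe / Wk) * (e * q / d)"
    unfolding K_def M_def[symmetric] Ce_def Tw_def Xe_def Wk_def prod.distrib prod_dividef ..
  have "1 / q ^ Suc n = q powi (- int (Suc n))"
    by (simp add: power_int_minus divide_inverse del: of_nat_Suc power_Suc)
  then have tq: "jtheta p (1 / q ^ Suc n) \<noteq> 0"
    using jtheta_q_powi[OF base, of "- int (Suc n)"] by simp
  have "generic_arg q p (a * q ^ M)"
    using gen_a by (subst generic_arg_power[OF q0])
  then have ta: "jtheta p (a * q ^ M) \<noteq> 0"
    by (rule generic_arg_jtheta)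
  have tb: "jtheta p b \<noteq> 0"
    by (rule generic_arg_jtheta[OF gens(6)])
  have Wk: "Wk \<noteq> 0"
  proof -
    have "generic_arg q p (w * x i * q ^ k i)" if "i \<in> {1..r}" for i
      using gens(2)[OF that] by (subst generic_arg_power[OF q0])
    from generic_arg_jtheta[OF this] show ?thesis
      unfolding Wk_def by simp
  qed
  have R': "jtheta p (1 / w / (d * q ^ n)) \<noteq> 0" "Tw \<noteq> 0" "Lx \<noteq> 0"
    using R_nz unfolding R by auto
  have alg: "ta * Q / (q * b * tb * tq) * (Ce * Tw) * (Xe / Wk) * ed / (T1 * (Cw * Tw) / (Lx * (- tb / b)))
      * (T1 * (- qN * tq) * (Wk / (Xw * qM)) / (Lx * (- ta / (a * qM))))
    = - (Q / (q * b) * (Ce * Xe) * ed) * (a * qN) / (b * (Cw * Xw))"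
    if "T1 \<noteq> 0" "Tw \<noteq> 0" "Lx \<noteq> 0" "Wk \<noteq> 0" "tb \<noteq> 0" "ta \<noteq> 0" "tq \<noteq> 0" "qM \<noteq> 0"
    for ta Q q b tb tq Ce Tw Xe Wk ed T1 Cw Lx qN Xw qM a :: complex
    using that by (simp add: mult_ac)
  have "K k / R * pf_extra p r x (1 / w) \<delta> (zeros2 k)
    = - (q ^ n / (q * b) * (Ce * Xe) * (e * q / d)) * (a * q ^ Suc n) / (b * (Cw * Xw))"
    unfolding K R x2 by (rule alg[OF R' Wk tb ta tq]) (use q0 in simp)
  also have "\<dots> = - (w / (b * u))"
    unfolding CeXe CwXw rels(1) using CX0 uw0 by simp
  also have "\<dots> = - 1"
    unfolding rels(5) using uw0 by simp
  finally show ?thesis .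
qed

end

section \<open>Sums over multi-indices and the recursion\<close>

lemma msize_upd_Suc:
  assumes "m \<in> {1..r}"
  shows "msize r (k(m := Suc (k m))) = Suc (msize r k)"
proof -
  have "(\<Sum>i\<in>{1..r} - {m}. (k(m := Suc (k m))) i) = (\<Sum>i\<in>{1..r} - {m}. k i)"
    by (intro sum.cong) auto
  then show ?thesis
    using assms sum.remove[of "{1..r}" m k] sum.remove[of "{1..r}" m "k(m := Suc (k m))"]
    unfolding msize_def by simp
qed

text \<open>Lowering k_m maps the indices with k_m > 0 and |k| <= n + 1 bijectively onto those with
  |k| <= n.\<close>

lemma sum_multi_indices_lower:
  fixes f :: "(nat \<Rightarrow> nat) \<Rightarrow> complex"
  assumes m: "m \<in> {1..r}"
  shows "(\<Sum>k\<in>multi_indices r (Suc n). if k m = 0 then 0 else f (k(m := k m - 1)))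
    = (\<Sum>k\<in>multi_indices r n. f k)"
proof -
  have "(\<Sum>k\<in>multi_indices r (Suc n). if k m = 0 then 0 else f (k(m := k m - 1)))
    = (\<Sum>k\<in>{k \<in> multi_indices r (Suc n). k m \<noteq> 0}. f (k(m := k m - 1)))"
    by (rule sum.mono_neutral_cong_right) (auto simp: finite_multi_indices)
  also have "\<dots> = (\<Sum>k\<in>multi_indices r n. f k)"
  proof (rule sum.reindex_bij_witness[of _ "\<lambda>k. k(m := Suc (k m))" "\<lambda>k. k(m := k m - 1)"])
    fix k assume k: "k \<in> {k \<in> multi_indices r (Suc n). k m \<noteq> 0}"
    define \<kappa> where "\<kappa> = k(m := k m - 1)"
    have \<kappa>: "\<kappa>(m := Suc (\<kappa> m)) = k"
      using k by (auto simp: \<kappa>_def)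
    then show "(k(m := k m - 1))(m := Suc ((k(m := k m - 1)) m)) = k"
      by (simp only: \<kappa>_def)
    have "\<kappa> \<in> {1..r} \<rightarrow>\<^sub>E UNIV"
      using k m by (auto simp: \<kappa>_def multi_indices_def PiE_iff extensional_def)
    then show "k(m := k m - 1) \<in> multi_indices r n"
      using k msize_upd_Suc[OF m, of \<kappa>] unfolding \<kappa> by (simp add: multi_indices_def \<kappa>_def)
  next
    fix k assume k: "k \<in> multi_indices r n"
    show "k(m := Suc (k m)) \<in> {k \<in> multi_indices r (Suc n). k m \<noteq> 0}"
      using k m msize_upd_Suc[OF m, of k]
      by (auto simp: multi_indices_def PiE_iff extensional_def)
  qed auto
  finally show ?thesis .
qed

lemma sum_multi_indices_restrict:
  fixes f :: "(nat \<Rightarrow> nat) \<Rightarrow> complex"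
  shows "(\<Sum>k\<in>multi_indices r (Suc n). if msize r k \<le> n then f k else 0) = (\<Sum>k\<in>multi_indices r n. f k)"
  by (rule sum.mono_neutral_cong_right[OF finite_multi_indices]) (auto simp: multi_indices_def)

lemma prod_list_map_upt: "(\<Prod>j\<leftarrow>[m..<n]. f j) = (\<Prod>j\<in>{m..<n}. f j)"
  for f :: "nat \<Rightarrow> complex"
  using prod.distinct_set_conv_list[of "[m..<n]" f] by simp

context jackson_step
begin

text \<open>The weights contain no k, which lets the recursion for summands pass to the
  sums.\<close>

definition "\<beta> m = - pf_point p r x (1 / w) (1 / u) zeros1 m / R"

definition "\<beta>0 = - pf_extra p r x (1 / u) (1 / w) zeros1 / R"

lemma jtheta_x: "i \<in> {1..r} \<Longrightarrow> j \<in> {1..r} \<Longrightarrow> i \<noteq> j \<Longrightarrow> jtheta p (x i / x j) \<noteq> 0"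
  by (rule generic_arg_jtheta[OF gens(1)])

lemma jtheta_xw: "i \<in> {1..r} \<Longrightarrow> jtheta p (x i / (1 / w)) \<noteq> 0"
  using generic_arg_jtheta[OF gens(2)] by (simp add: mult.commute)

lemma jtheta_xu: "i \<in> {1..r} \<Longrightarrow> jtheta p (x i / (1 / u)) \<noteq> 0"
  using generic_arg_jtheta[OF gens(3)] by (simp add: mult.commute)

text \<open>The expansion with points x_i, 1/w, 1/u and zeros d q^n, 1/c_j, divided by its term at
  1/w. It is balanced because d u w q^n = C X.\<close>

lemma weights_sum: "(\<Sum>m=1..r. \<beta> m) + \<beta>0 = 1"
proof -
  define zs where "zs = d * q ^ n # map (\<lambda>j. 1 / c j) [1..<r+2]"
  have "(\<Sum>m=1..r. pf_point p r x (1 / w) (1 / u) zeros1 m) + pf_extra p r x (1 / w) (1 / u) zeros1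
      + pf_extra p r x (1 / u) (1 / w) zeros1 = 0"
  proof (rule pf_sum[OF p1, where zs = zs])
    show "jtheta p ((1 / w) / (1 / u)) \<noteq> 0"
      using jtheta_inverse_nz[OF gens(6)] by (simp add: b_def)
    have "prod_list zs = d * q ^ n / prod c {1..r+1}"
      by (simp add: zs_def prod_list_map_upt atLeastLessThanSuc_atLeastAtMost prod_dividef
          del: prod.cl_ivl_Suc upt_Suc prod.op_ivl_Suc)
    also have "\<dots> = prod x {1..r} / (u * w)"
      using CX0 q0 by (simp add: d_def del: prod.cl_ivl_Suc)
    finally show "prod x {1..r} * (1 / w) * (1 / u) = prod_list zs"
      by (simp add: mult.commute)
    show "zeros1 y = (\<Prod>z\<leftarrow>zs. jtheta p (y / z))" for y
      by (simp add: zs_def zeros1_def prod_list_map_upt atLeastLessThanSuc_atLeastAtMost o_def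
          del: prod.cl_ivl_Suc upt_Suc prod.op_ivl_Suc)
    show "0 \<notin> set zs"
      using ade0 q0 c0 by (auto simp: zs_def)
  qed (use x0 jtheta_x jtheta_xw jtheta_xu uw0 in \<open>auto simp: zs_def\<close>)
  then have "(\<Sum>m=1..r. pf_point p r x (1 / w) (1 / u) zeros1 m) + pf_extra p r x (1 / u) (1 / w) zeros1 = - R"
    unfolding R_def by algebra
  moreover have "(\<Sum>m=1..r. \<beta> m) + \<beta>0
      = - ((\<Sum>m=1..r. pf_point p r x (1 / w) (1 / u) zeros1 m) + pf_extra p r x (1 / u) (1 / w) zeros1) / R"
    by (simp add: \<beta>_def \<beta>0_def sum_divide_distrib[symmetric] sum_negf add_divide_distrib diff_divide_distrib)
  ultimately show ?thesis
    using R_nz by simp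
qed

text \<open>The expansion with points x_i, 1/w, \<open>\<delta>\<close> and zeros d q^n, 1/(w
  q^(n+1)), x_j q^(k_j). It is balanced for every k because \<open>\<delta>\<close> absorbs q^|k|;
  its term at 1/w is removed by \<open>weight_one\<close>.\<close>

lemma transferred_weights_sum:
  fixes k
  defines "\<delta> \<equiv> d * q ^ msize r k / q"
  shows "(\<Sum>m=1..r. K k / R * pf_point p r x (1 / w) \<delta> (zeros2 k) m)
      + K k / R * pf_extra p r x \<delta> (1 / w) (zeros2 k) = 1"
proof -
  define zs where "zs = d * q ^ n # 1 / (w * q ^ Suc n) # map (\<lambda>j. x j * q ^ k j) [1..<r+1]"
  have \<delta>0: "\<delta> \<noteq> 0" using ade0 q0 by (simp add: \<delta>_def)
  have "(\<Sum>m=1..r. pf_point p r x (1 / w) \<delta> (zeros2 k) m) + pf_extra p r x (1 / w) \<delta> (zeros2 k)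
      + pf_extra p r x \<delta> (1 / w) (zeros2 k) = 0"
  proof (rule pf_sum[OF p1, where zs = zs])
    show "jtheta p (x i / \<delta>) \<noteq> 0" if i: "i \<in> {1..r}" for i
    proof -
      have "generic_arg q p (d / x i * q ^ msize r k)"
        using gen_d[OF i] by (subst generic_arg_power[OF q0])
      then have "generic_arg q p (d / x i * q ^ msize r k / q)"
        by (subst generic_arg_divide[OF q0])
      from jtheta_inverse_nz[OF this] show ?thesis
        by (simp add: \<delta>_def mult_ac)
    qed
    show "jtheta p ((1 / w) / \<delta>) \<noteq> 0"
    proof -
      have "w * \<delta> = d * w * q ^ msize r k / q"
        by (simp add: \<delta>_def mult_ac)
      then have "w * \<delta> = a * q ^ msize r k"
        unfolding rels(3) using q0 by simp
      moreover have "generic_arg q p (a * q ^ msize r k)"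
        using gen_a by (subst generic_arg_power[OF q0])
      ultimately show ?thesis
        using jtheta_inverse_nz[of "w * \<delta>"] by simp
    qed
    have "prod_list zs = d * q ^ n * (1 / (w * q ^ Suc n)) * (prod x {1..r} * q ^ msize r k)"
      by (simp add: zs_def prod_list_map_upt atLeastLessThanSuc_atLeastAtMost prod.distrib msize_def power_sum
          del: upt_Suc prod.op_ivl_Suc)
    then show "prod x {1..r} * (1 / w) * \<delta> = prod_list zs"
      using q0 by (simp add: \<delta>_def mult_ac)
    show "zeros2 k y = (\<Prod>z\<leftarrow>zs. jtheta p (y / z))" for y
      by (simp add: zs_def zeros2_def prod_list_map_upt atLeastLessThanSuc_atLeastAtMost o_def
          del: upt_Suc prod.op_ivl_Suc)
    show "0 \<notin> set zs"
      using ade0 q0 x0 uw0 by (auto simp: zs_def)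
  qed (use x0 jtheta_x jtheta_xw uw0 \<delta>0 in \<open>auto simp: zs_def\<close>)
  then have "K k / R * ((\<Sum>m=1..r. pf_point p r x (1 / w) \<delta> (zeros2 k) m) + pf_extra p r x (1 / w) \<delta> (zeros2 k)
      + pf_extra p r x \<delta> (1 / w) (zeros2 k)) = 0"
    by simp
  then have "(\<Sum>m=1..r. K k / R * pf_point p r x (1 / w) \<delta> (zeros2 k) m) + - 1
      + K k / R * pf_extra p r x \<delta> (1 / w) (zeros2 k) = 0"
    unfolding distrib_left sum_distrib_left weight_one[of k, folded \<delta>_def] .
  then show ?thesis by algebra
qed

text \<open>The summand is multiplied by 1 in the form of \<open>transferred_weights_sum\<close>,
  and each piece is converted into a shifted summand. Pieces without a shifted counterpart
  vanish.\<close>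

lemma nterm_recursion:
  assumes "msize r k \<le> Suc n"
  shows "nterm q p r c (Suc n) a b d e u w x k
    = (\<Sum>m=1..r. \<beta> m * (if k m = 0 then 0
         else nterm q p r c n (a * q * q) (b * q) (d * q) (e * q) u (w * q) (x(m := q * x m)) (k(m := k m - 1))))
      + \<beta>0 * (if msize r k \<le> n then nterm q p r c n a b (d / q) e (u * q) (w * q) x k else 0)"
proof -
  define \<delta> where "\<delta> = d * q ^ msize r k / q"
  let ?N = "nterm q p r c (Suc n) a b d e u w x k"
  have "\<beta> m * (if k m = 0 then 0
         else nterm q p r c n (a * q * q) (b * q) (d * q) (e * q) u (w * q) (x(m := q * x m)) (k(m := k m - 1)))
      = ?N * (K k / R * pf_point p r x (1 / w) \<delta> (zeros2 k) m)" if m: "m \<in> {1..r}" for m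
  proof (cases "k m = 0")
    case True
    \<comment> \<open>For k_m = 0 the point x_m coincides with the zero x_m q^(k_m).\<close>
    have "(\<Prod>j=1..r. jtheta p (x m / (x j * q ^ k j))) = 0"
      using m True x0[OF m] p1 by (intro prod_zero bexI[of _ m]) auto
    then have "zeros2 k (x m) = 0"
      by (simp add: zeros2_def)
    then show ?thesis
      using True by (simp add: pf_point_def)
  next
    case False
    then have "(k(m := k m - 1))(m := Suc ((k(m := k m - 1)) m)) = k"
      by auto
    then show ?thesis
      using nterm_step[OF m, of "k(m := k m - 1)"] False unfolding \<beta>_def \<delta>_def by simp
  qed
  moreover have "\<beta>0 * (if msize r k \<le> n then nterm q p r c n a b (d / q) e (u * q) (w * q) x k else 0)
      = ?N * (K k / R * pf_extra p r x \<delta> (1 / w) (zeros2 k))"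
  proof (cases "msize r k \<le> n")
    case True
    then show ?thesis
      using nterm_zero[of k] unfolding \<beta>0_def \<delta>_def by simp
  next
    case False
    \<comment> \<open>At the upper edge the point \<open>\<delta>\<close> coincides with the zero d
      q^n.\<close>
    then have "msize r k = Suc n" using assms by simp
    then have "\<delta> = d * q ^ n"
      using q0 by (simp add: \<delta>_def)
    then have "zeros2 k \<delta> = 0"
      using ade0 q0 p1 by (simp add: zeros2_def)
    then show ?thesis
      using False by (simp add: pf_extra_def)
  qed
  moreover have "?N = (\<Sum>m=1..r. ?N * (K k / R * pf_point p r x (1 / w) \<delta> (zeros2 k) m))
      + ?N * (K k / R * pf_extra p r x \<delta> (1 / w) (zeros2 k))"
    using arg_cong[OF transferred_weights_sum[of k, folded \<delta>_def], of "\<lambda>z. ?N * z"]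
    by (simp only: distrib_left sum_distrib_left mult_1_right)
  ultimately show ?thesis
    by (metis (no_types, lifting) sum.cong)
qed

end

lemma Delta_cong: "(\<And>i. i \<in> {1..r} \<Longrightarrow> x i = y i) \<Longrightarrow> Delta r p x = Delta r p y"
  unfolding Delta_def by (intro prod.cong refl) auto

text \<open>The moves change u, w and x but not c, so exactly these three are arbitrary in the
  induction. Each of the r + 1 inner sums is 1, which leaves the sum of the weights.\<close>

lemma jterm_sum:
  assumes "base_nome q p" "generic_params q p r c u w x"
  shows "(\<Sum>k\<in>multi_indices r N. jterm q p r c N u w x k) = 1"
  using assms(2)
proof (induction N arbitrary: u w x)
  case 0
  have p1: "norm p < 1" and q0: "q \<noteq> 0"
    using assms(1) by (auto simp: base_nome_def)
  have x0: "x i \<noteq> 0" if "i \<in> {1..r}" for i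
    using 0 that by (auto simp: generic_params_def generic_arg_def)
  define k where "k = (\<lambda>i\<in>{1..r}. 0::nat)"
  have "multi_indices r 0 = {k}"
    unfolding k_def by (auto simp: multi_indices_def msize_def PiE_def extensional_def fun_eq_iff restrict_def)
  moreover have "jterm q p r c 0 u w x k = 1"
  proof -
    have k: "k i = 0" if "i \<in> {1..r}" for i
      using that by (simp add: k_def)
    have M: "msize r k = 0" by (simp add: msize_def k)
    have "Delta r p x \<noteq> 0"
      using 0 x0 by (auto simp: Delta_def generic_params_def intro!: generic_arg_jtheta[of q])
    moreover have "Delta r p (\<lambda>i. x i * q ^ k i) = Delta r p x"
      by (rule Delta_cong) (simp add: k)
    moreover have "(\<Prod>i=1..r. \<Prod>j=1..r. efact q p (q * x i / x j) (k i)) = 1"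
      by (intro prod.neutral ballI) (simp add: k)
    ultimately have D: "dfactor r q p x k = 1"
      by (simp add: dfactor_def)
    have "generic_arg q p (prod c {1..r+1} * prod x {1..r} / u)"
      using 0 by (auto simp: generic_params_def)
    from generic_arg_jtheta[OF this]
    have S: "sfactor q p 0 (prod c {1..r+1} * prod x {1..r} / (u * q ^ 0)) (w / u) 0 = 1"
      by (simp add: sfactor_def del: prod.cl_ivl_Suc)
    have X: "(\<Prod>i=1..r. xfactor q p 0 0 d e u w (x i) (k i)) = 1"
      "(\<Prod>i=1..r. \<Prod>j=1..r+1. efact q p (c j * x i) (k i)) = 1" for d e
      by (intro prod.neutral ballI; simp add: xfactor_def k del: prod.cl_ivl_Suc)+
    show ?thesis
      unfolding jterm_def nterm_def M D S X by (simp add: cfactor_def)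
  qed
  ultimately show ?case by simp
next
  case (Suc n)
  have p1: "norm p < 1" and q0: "q \<noteq> 0"
    using assms(1) by (auto simp: base_nome_def)
  have x0: "x i \<noteq> 0" if "i \<in> {1..r}" for i
    using Suc.prems that by (auto simp: generic_params_def generic_arg_def)
  define a where "a = prod c {1..r+1} * prod x {1..r} / (u * q ^ Suc n)"
  define b where "b = w / u"
  define d where "d = q * (prod c {1..r+1} * prod x {1..r}) / (u * w * q ^ Suc n)"
  define e where "e = q / (u * q ^ Suc n)"
  interpret jackson_step q p r n c x u w a b d e
    by unfold_locales (use assms(1) Suc.prems x0 in \<open>auto simp: a_def b_def d_def e_def\<close>)
  have N: "jterm q p r c (Suc n) u w x k = nterm q p r c (Suc n) a b d e u w x k" for k
    unfolding jterm_def a_def b_def d_def e_def ..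
  let ?f = "\<lambda>m. jterm q p r c n u (w * q) (x(m := q * x m))"
  let ?g = "jterm q p r c n (u * q) (w * q) x"
  have "(\<Sum>k\<in>multi_indices r (Suc n). jterm q p r c (Suc n) u w x k)
    = (\<Sum>k\<in>multi_indices r (Suc n). (\<Sum>m=1..r. \<beta> m * (if k m = 0 then 0 else ?f m (k(m := k m - 1))))
        + \<beta>0 * (if msize r k \<le> n then ?g k else 0))"
  proof (rule sum.cong[OF refl])
    fix k assume k: "k \<in> multi_indices r (Suc n)"
    let ?h = "\<lambda>m. nterm q p r c n (a * q * q) (b * q) (d * q) (e * q) u (w * q) (x(m := q * x m))"
    have "(\<Sum>m=1..r. \<beta> m * (if k m = 0 then 0 else ?f m (k(m := k m - 1))))
      = (\<Sum>m=1..r. \<beta> m * (if k m = 0 then 0 else ?h m (k(m := k m - 1))))"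
    proof (rule sum.cong[OF refl])
      fix m assume "m \<in> {1..r}"
      from jterm_shift_self[OF q0 this a_def b_def d_def e_def]
      show "\<beta> m * (if k m = 0 then 0 else ?f m (k(m := k m - 1)))
        = \<beta> m * (if k m = 0 then 0 else ?h m (k(m := k m - 1)))"
        by (simp only:)
    qed
    moreover have "jterm q p r c n (u * q) (w * q) x = nterm q p r c n a b (d / q) e (u * q) (w * q) x"
      using jterm_shift_zero[OF q0 a_def b_def d_def e_def] by blast
    ultimately show "jterm q p r c (Suc n) u w x k
      = (\<Sum>m=1..r. \<beta> m * (if k m = 0 then 0 else ?f m (k(m := k m - 1))))
        + \<beta>0 * (if msize r k \<le> n then ?g k else 0)"
      unfolding N using nterm_recursion[of k] k by (simp only: multi_indices_def mem_Collect_eq)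
  qed
  also have "\<dots> = (\<Sum>m=1..r. \<beta> m * (\<Sum>k\<in>multi_indices r (Suc n). if k m = 0 then 0 else ?f m (k(m := k m - 1))))
      + \<beta>0 * (\<Sum>k\<in>multi_indices r (Suc n). if msize r k \<le> n then ?g k else 0)"
    unfolding sum.distrib sum_distrib_left by (subst sum.swap) simp
  also have "\<dots> = (\<Sum>m=1..r. \<beta> m) + \<beta>0"
  proof -
    have "(\<Sum>m=1..r. \<beta> m * (\<Sum>k\<in>multi_indices r (Suc n). if k m = 0 then 0 else ?f m (k(m := k m - 1))))
      = (\<Sum>m=1..r. \<beta> m)"
    proof (rule sum.cong[OF refl])
      fix m assume m: "m \<in> {1..r}"
      have "(\<Sum>k\<in>multi_indices r (Suc n). if k m = 0 then 0 else ?f m (k(m := k m - 1))) = 1"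
        unfolding sum_multi_indices_lower[OF m] by (rule Suc.IH[OF generic_params_step[OF q0 m Suc.prems]])
      then show "\<beta> m * (\<Sum>k\<in>multi_indices r (Suc n). if k m = 0 then 0 else ?f m (k(m := k m - 1))) = \<beta> m"
        by (simp only: mult_1_right)
    qed
    moreover have "(\<Sum>k\<in>multi_indices r (Suc n). if msize r k \<le> n then ?g k else 0) = 1"
      unfolding sum_multi_indices_restrict by (rule Suc.IH[OF generic_params_zero[OF q0 Suc.prems]])
    ultimately show ?thesis
      by (simp only: mult_1_right)
  qed
  also have "\<dots> = 1" by (rule weights_sum)
  finally show ?case .
qed

section \<open>Removing the genericity assumption\<close>

text \<open>C and X are separate arguments because the deformation fixes c and moves x.\<close>

definition jackson_term where
  "jackson_term q p r N a b d C X c x k =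
     Delta r p (\<lambda>i. x i * q ^ k i) / Delta r p x
            * (jtheta p (a * q ^ (2 * msize r k)) / jtheta p a)
            * ((efact q p a (msize r k) * efact q p b (msize r k)
                  * efact q p (q powi (- int N)) (msize r k))
               / (efact q p (a * q / b) (msize r k)
                  * efact q p (a * q ^ (N + 1)) (msize r k)))
            * q ^ msize r k
            * (\<Prod>i=1..r.
                 (efact q p (a * q / (C * X * x i)) (msize r k - k i)
                    * efact q p (d / x i) (msize r k)
                    * (\<Prod>j=1..r+1. efact q p (c j * x i) (k i)))
                 / (efact q p (d / x i) (msize r k - k i)
                    * efact q p (a * x i * q / d) (k i)
                    * (\<Prod>j=1..r. efact q p (q * x i / x j) (k i))))
            * (\<Prod>i=1..r+1. 1 / efact q p (a * c i * q / (C * X)) (msize r k))"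

definition jackson_rhs where
  "jackson_rhs q p r N a b d c x =
     efact q p (a * q) N / (b ^ N * efact q p (a * q / b) N)
           * (\<Prod>i=1..r. efact q p (a * x i * q / (b * d)) N / efact q p (a * x i * q / d) N)
           * (\<Prod>i=1..r+1. efact q p (a * q / (c i * d)) N / efact q p (a * q / (b * c i * d)) N)"

text \<open>\<open>nterm\<close> has the right-hand side as a divisor, so the numerators of the
  latter have to be nonzero as well as its denominators.\<close>

lemma jackson_term_eq_nterm:
  fixes q p a b d C X e u w :: complex and c x :: "nat \<Rightarrow> complex" and r N :: nat
  assumes q0: "q \<noteq> 0" and nz: "b \<noteq> 0" "d \<noteq> 0"
    and rel: "w = a * q / d" "e = a * q / (C * X)" "w = b * u"
    and gen: "\<And>i. i \<in> {1..r} \<Longrightarrow> generic_arg q p (w * x i) \<and> generic_arg q p (u * x i)"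
      "\<And>j. j \<in> {1..r+1} \<Longrightarrow> generic_arg q p (u / c j) \<and> generic_arg q p (w / c j)"
      "generic_arg q p a" "generic_arg q p (a / b)"
  shows "jackson_term q p r N a b d C X c x k
    = nterm q p r c N a b d e u w x k * jackson_rhs q p r N a b d c x"
proof -
  define M where "M = msize r k"
  define PE PD PD' PW PQ PC where
    "PE = (\<Prod>i=1..r. efact q p (e / x i) (M - k i))" and
    "PD = (\<Prod>i=1..r. efact q p (d / x i) M)" and
    "PD' = (\<Prod>i=1..r. efact q p (d / x i) (M - k i))" and
    "PW = (\<Prod>i=1..r. efact q p (w * x i) (k i))" and
    "PQ = (\<Prod>i=1..r. \<Prod>j=1..r. efact q p (q * x i / x j) (k i))" and
    "PC = (\<Prod>i=1..r. \<Prod>j=1..r+1. efact q p (c j * x i) (k i))"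
  define Wx Ux Wc Uc Ec where
    "Wx = (\<Prod>i=1..r. efact q p (w * x i) N)" and
    "Ux = (\<Prod>i=1..r. efact q p (u * x i) N)" and
    "Wc = (\<Prod>i=1..r+1. efact q p (w / c i) N)" and
    "Uc = (\<Prod>i=1..r+1. efact q p (u / c i) N)" and
    "Ec = (\<Prod>i=1..r+1. efact q p (e * c i) M)"
  have u: "a * q / (b * d) = u"
    using rel nz by (simp add: field_simps)
  have args: "a * q / (C * X * z) = e / z" "a * z * q / d = w * z" "a * z * q / (C * X) = e * z"
    "a * z * q / (b * d) = u * z" "a * q / (z * d) = w / z" "a * q / (b * z * d) = u / z" for z
    using rel(1,2) by (simp_all add: u[symmetric] mult_ac)
  have T: "jackson_term q p r N a b d C X c x k
    = Delta r p (\<lambda>i. x i * q ^ k i) / Delta r p x * (jtheta p (a * q ^ (2 * M)) / jtheta p a)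
      * ((efact q p a M * efact q p b M * efact q p (1 / q ^ N) M)
         / (efact q p (a * q / b) M * efact q p (a * q ^ (N + 1)) M)) * q ^ M
      * ((PE * PD * PC) / (PD' * PW * PQ)) * (1 / Ec)"
    unfolding jackson_term_def args M_def[symmetric] prod_dividef prod.distrib
      PE_def PD_def PD'_def PW_def PQ_def PC_def Ec_def
    by (simp add: power_int_minus divide_inverse)
  have R: "jackson_rhs q p r N a b d c x
    = efact q p (a * q) N / (b ^ N * efact q p (a * q / b) N) * (Ux / Wx) * (Wc / Uc)"
    unfolding jackson_rhs_def args(6) unfolding args(1-5) prod_dividef Wx_def Ux_def Wc_def Uc_def ..
  have Nt: "nterm q p r c N a b d e u w x k
    = Delta r p (\<lambda>i. x i * q ^ k i) / Delta r p x / PQ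
      * (jtheta p (a * q ^ (2 * M)) / jtheta p a
     * (efact q p a M * efact q p b M * efact q p (1 / q ^ N) M
        / (efact q p (a * q / b) M * efact q p (a * q ^ (N + 1)) M))
     * q ^ M * (b ^ N * efact q p (a * q / b) N / efact q p (a * q) N))
     * (Uc / (Wc * Ec)) * (PE * PD / (PD' * PW) * (Wx / Ux) * PC)"
    unfolding nterm_def M_def[symmetric] dfactor_def sfactor_def cfactor_def xfactor_def
      prod_dividef prod.distrib PE_def PD_def PD'_def PW_def PQ_def PC_def Ec_def Wx_def Ux_def Wc_def Uc_def ..
  have "Wx \<noteq> 0" "Ux \<noteq> 0"
    unfolding Wx_def Ux_def using gen(1) generic_arg_efact[OF q0] by (subst prod_zero_iff; blast)+
  moreover have "Wc \<noteq> 0" "Uc \<noteq> 0"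
    unfolding Wc_def Uc_def using gen(2) generic_arg_efact[OF q0] by (subst prod_zero_iff; blast)+
  moreover have "efact q p (a * q) N \<noteq> 0"
    using gen(3) q0 by (intro generic_arg_efact) simp_all
  moreover have "efact q p (a * q / b) N \<noteq> 0"
  proof -
    have "generic_arg q p (a / b * q)"
      using gen(4) by (subst generic_arg_mult[OF q0])
    from generic_arg_efact[OF q0 this] show ?thesis by simp
  qed
  moreover have alg: "D * T * S * qM * (P / (D' * W * Q)) * (1 / E)
    = D / Q * (T * S * qM * (bN * GN / AN)) * (Uc / (Wc * E)) * (PP / (D' * W) * (Wx / Ux) * PC)
      * (AN / (bN * GN) * (Ux / Wx) * (Wc / Uc))"
    if "P = PP * PC" "Wx \<noteq> 0" "Ux \<noteq> 0" "Wc \<noteq> 0" "Uc \<noteq> 0" "AN \<noteq> 0" "GN \<noteq> 0" "bN \<noteq> 0"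
    for D T S qM P D' W Q E bN GN AN Uc Wc Wx Ux PP PC :: complex
    using that(2-) unfolding that(1) by (simp add: mult_ac)
  ultimately show ?thesis
    unfolding T R Nt using nz by (intro alg) auto
qed

lemma jackson_sum_generic:
  fixes q p a b d :: complex and c x :: "nat \<Rightarrow> complex" and r N :: nat
  defines "C \<equiv> prod c {1..r+1}" and "X \<equiv> prod x {1..r}"
  assumes base: "base_nome q p" and nz: "a \<noteq> 0" "b \<noteq> 0" "d \<noteq> 0" "C * X \<noteq> 0"
    and rel: "a ^ 2 * q ^ (N + 1) = b * C * d * X"
    and gen: "generic_params q p r c (C * X / (a * q ^ N)) (a * q / d) x"
  shows "(\<Sum>k\<in>multi_indices r N. jackson_term q p r N a b d C X c x k) = jackson_rhs q p r N a b d c x"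
proof -
  have q0: "q \<noteq> 0" using base by (simp add: base_nome_def)
  \<comment> \<open>By the relation between the parameters this equals aq/bd. Written without b and
    d, it recovers a directly as C X / (u q^N).\<close>
  define u where "u = C * X / (a * q ^ N)"
  define w where "w = a * q / d"
  define e where "e = a * q / (C * X)"
  have bu: "w = b * u"
  proof -
    have "b * u = b * C * d * X / (a * d * q ^ N)"
      using nz q0 by (simp add: u_def)
    also have "\<dots> = w"
      unfolding rel[symmetric] using nz q0 by (simp add: w_def power2_eq_square)
    finally show ?thesis ..
  qed
  have u0: "u \<noteq> 0" using nz q0 by (simp add: u_def)
  have params: "C * X / (u * q ^ N) = a" "w / u = b" "q * (C * X) / (u * w * q ^ N) = d" "q / (u * q ^ N) = e"
  proof -
    have uq: "u * q ^ N = C * X / a"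
      using q0 by (simp add: u_def)
    show "C * X / (u * q ^ N) = a" "q / (u * q ^ N) = e"
      unfolding uq using nz by (simp_all add: e_def mult.commute)
    show "w / u = b" using bu u0 by simp
    have "q * (C * X) / (u * w * q ^ N) = q * (C * X) / (u * q ^ N * w)"
      by (simp only: mult_ac)
    also have "\<dots> = d"
      unfolding uq using nz q0 by (simp add: w_def)
    finally show "q * (C * X) / (u * w * q ^ N) = d" .
  qed
  have "jterm q p r c N u w x k = nterm q p r c N a b d e u w x k" for k
    unfolding jterm_def C_def[symmetric] X_def[symmetric] params ..
  moreover have "(\<Sum>k\<in>multi_indices r N. jterm q p r c N u w x k) = 1"
    by (rule jterm_sum[OF base]) (use gen in \<open>simp add: u_def w_def\<close>)
  moreover have "jackson_term q p r N a b d C X c x k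
    = nterm q p r c N a b d e u w x k * jackson_rhs q p r N a b d c x" for k
  proof (rule jackson_term_eq_nterm[OF q0 nz(2,3) w_def e_def bu])
    have g: "generic_arg q p (C * X / u)" "generic_arg q p (C * X / w)"
      using gen unfolding generic_params_def u_def[symmetric] w_def[symmetric] C_def[symmetric] X_def[symmetric]
      by blast+
    have "generic_arg q p (C * X / u / q ^ N)" "generic_arg q p (C * X / w / q ^ N)"
      using g by (simp_all only: generic_arg_divide_power[OF q0])
    moreover have "C * X / u / q ^ N = a" "C * X / w / q ^ N = a / b"
      using params(1,2) bu by auto
    ultimately show "generic_arg q p a" "generic_arg q p (a / b)" by simp_all
  qed (use gen in \<open>auto simp: generic_params_def u_def w_def\<close>)
  ultimately show ?thesis
    by (simp flip: sum_distrib_right)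
qed

text \<open>Each shift by q^l excludes countably many t, and there are countably many l. A nonzero
  exponent m is what makes the argument move with t.\<close>

lemma countable_not_generic_arg:
  assumes "base_nome q p" "y \<noteq> 0" "m \<noteq> 0"
  shows "countable {t. t \<noteq> 0 \<and> \<not> generic_arg q p (y * t powi m)}"
proof -
  have q0: "q \<noteq> 0" and p1: "norm p < 1" using assms(1) by (auto simp: base_nome_def)
  have "{t. t \<noteq> 0 \<and> \<not> generic_arg q p (y * t powi m)}
    \<subseteq> (\<Union>l::int. {t. t \<noteq> 0 \<and> jtheta p (y * q powi l * t powi m) = 0})"
    using assms(2) by (auto simp: generic_arg_def mult_ac)
  moreover have "countable \<dots>"
    using assms q0 p1 by (intro countable_UN countable_jtheta_powi_zeros) auto
  ultimately show ?thesis by (rule countable_subset)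
qed

section \<open>Continuity of both sides and the deformation\<close>

lemma tendsto_efact [tendsto_intros]:
  assumes "norm p < 1" "q \<noteq> 0" "(f \<longlongrightarrow> l) F" "l \<noteq> 0"
  shows "((\<lambda>t. efact q p (f t) k) \<longlongrightarrow> efact q p l k) F"
  unfolding efact_def using assms by (intro tendsto_intros) auto

lemma tendsto_Delta:
  assumes "norm p < 1" "\<And>i. i \<in> {1..r} \<Longrightarrow> ((\<lambda>t. f t i) \<longlongrightarrow> x i) F" "\<And>i. i \<in> {1..r} \<Longrightarrow> x i \<noteq> 0"
  shows "((\<lambda>t. Delta r p (f t)) \<longlongrightarrow> Delta r p x) F"
  unfolding Delta_def using assms by (intro tendsto_prod tendsto_mult tendsto_jtheta tendsto_divide) auto

text \<open>Nonvanishing is asked at the limit point only, and only for the denominators that occur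
  in the theorem.\<close>

lemma tendsto_jackson_term:
  fixes q p a b d C X :: complex and c x :: "nat \<Rightarrow> complex" and r N :: nat
  assumes p1: "norm p < 1" and q0: "q \<noteq> 0"
    and lim: "(an \<longlongrightarrow> a) F" "(bn \<longlongrightarrow> b) F" "(dn \<longlongrightarrow> d) F" "(Xn \<longlongrightarrow> X) F"
      "\<And>i. i \<in> {1..r} \<Longrightarrow> ((\<lambda>t. xn t i) \<longlongrightarrow> x i) F"
    and nz: "a \<noteq> 0" "b \<noteq> 0" "d \<noteq> 0" "C \<noteq> 0" "X \<noteq> 0" "\<And>i. i \<in> {1..r} \<Longrightarrow> x i \<noteq> 0"
      "\<And>i. i \<in> {1..r+1} \<Longrightarrow> c i \<noteq> 0"
    and den: "Delta r p x \<noteq> 0" "jtheta p a \<noteq> 0"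
      "efact q p (a * q / b) (msize r k) \<noteq> 0" "efact q p (a * q ^ (N + 1)) (msize r k) \<noteq> 0"
      "\<And>i. i \<in> {1..r} \<Longrightarrow> efact q p (d / x i) (msize r k - k i) \<noteq> 0"
      "\<And>i. i \<in> {1..r} \<Longrightarrow> efact q p (a * x i * q / d) (k i) \<noteq> 0"
      "\<And>i j. i \<in> {1..r} \<Longrightarrow> j \<in> {1..r} \<Longrightarrow> efact q p (q * x i / x j) (k i) \<noteq> 0"
      "\<And>i. i \<in> {1..r+1} \<Longrightarrow> efact q p (a * c i * q / (C * X)) (msize r k) \<noteq> 0"
  shows "((\<lambda>t. jackson_term q p r N (an t) (bn t) (dn t) C (Xn t) c (xn t) k)
    \<longlongrightarrow> jackson_term q p r N a b d C X c x k) F"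
  unfolding jackson_term_def
  by (intro tendsto_mult tendsto_divide tendsto_prod tendsto_const tendsto_power tendsto_Delta[OF p1]
      tendsto_jtheta[OF p1] tendsto_efact[OF p1 q0] lim)
    (use q0 nz den in \<open>simp_all del: prod.cl_ivl_Suc\<close>)

lemma tendsto_jackson_rhs:
  fixes q p a b d :: complex and c x :: "nat \<Rightarrow> complex" and r N :: nat
  assumes p1: "norm p < 1" and q0: "q \<noteq> 0"
    and lim: "(an \<longlongrightarrow> a) F" "(bn \<longlongrightarrow> b) F" "(dn \<longlongrightarrow> d) F"
      "\<And>i. i \<in> {1..r} \<Longrightarrow> ((\<lambda>t. xn t i) \<longlongrightarrow> x i) F"
    and nz: "a \<noteq> 0" "b \<noteq> 0" "d \<noteq> 0" "\<And>i. i \<in> {1..r} \<Longrightarrow> x i \<noteq> 0"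
      "\<And>i. i \<in> {1..r+1} \<Longrightarrow> c i \<noteq> 0"
    and den: "efact q p (a * q / b) N \<noteq> 0"
      "\<And>i. i \<in> {1..r} \<Longrightarrow> efact q p (a * x i * q / d) N \<noteq> 0"
      "\<And>i. i \<in> {1..r+1} \<Longrightarrow> efact q p (a * q / (b * c i * d)) N \<noteq> 0"
  shows "((\<lambda>t. jackson_rhs q p r N (an t) (bn t) (dn t) c (xn t))
    \<longlongrightarrow> jackson_rhs q p r N a b d c x) F"
  unfolding jackson_rhs_def
  by (intro tendsto_mult tendsto_divide tendsto_prod tendsto_const tendsto_power
      tendsto_efact[OF p1 q0] lim)
    (use q0 nz den in \<open>simp_all del: prod.cl_ivl_Suc\<close>)

text \<open>
  The exponents of \<open>t\<close> are chosen such that every monomial in \<open>generic_params\<close> is multiplied by a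
  nonzero power of \<open>t\<close>.
\<close>

lemma generic_perturbation:
  fixes q p u w :: complex and c x :: "nat \<Rightarrow> complex" and r :: nat
  defines "S \<equiv> \<Sum>{1..r}"
  assumes base: "base_nome q p" and nz: "u \<noteq> 0" "w \<noteq> 0" "\<And>i. i \<in> {1..r} \<Longrightarrow> x i \<noteq> 0"
    "\<And>i. i \<in> {1..r+1} \<Longrightarrow> c i \<noteq> 0"
  obtains t where "t \<longlonglongrightarrow> (1::complex)" "\<And>n::nat. t n \<noteq> 0"
    "\<And>n. generic_params q p r c (u * t n ^ (S + 1)) (w * t n ^ (2 * S + 3)) (\<lambda>i. x i * t n ^ i)"
proof -
  define CX where "CX = prod c {1..r+1} * prod x {1..r}"
  have CX: "CX \<noteq> 0"
    unfolding CX_def mult_eq_0_iff de_Morgan_disj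
    using nz(3,4) by (intro conjI; subst prod_zero_iff; blast)
  \<comment> \<open>A pair (y, m) records that the deformation turns the argument y into y t^m. The
    exponents result from t^i on x_i, hence t^S on C X, together with t^(S+1) on u and t^(2S+3) on
    w.\<close>
  define L :: "(complex \<times> int) set" where "L =
    (\<lambda>(i, j). (x i / x j, int i - int j)) ` {(i, j) \<in> {1..r} \<times> {1..r}. i \<noteq> j} \<union>
    (\<lambda>i. (w * x i, int (2 * S + 3 + i))) ` {1..r} \<union> (\<lambda>i. (u * x i, int (S + 1 + i))) ` {1..r} \<union>
    (\<lambda>i. (CX / (u * w * x i), - int (2 * S + 4 + i))) ` {1..r} \<union>
    (\<lambda>j. (u / c j, int (S + 1))) ` {1..r+1} \<union> (\<lambda>j. (w / c j, int (2 * S + 3))) ` {1..r+1} \<union>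
    {(w / u, int (S + 2)), (CX / u, - int 1), (CX / w, - int (S + 3))}"
  have "finite {(i, j) \<in> {1..r} \<times> {1..r}. i \<noteq> j}"
    by (rule finite_subset[of _ "{1..r} \<times> {1..r}"]) auto
  then have "finite L"
    unfolding L_def by (intro finite_UnI finite_imageI) simp_all
  have L: "y \<noteq> 0 \<and> m \<noteq> 0" if "(y, m) \<in> L" for y m
    using that nz CX by (auto simp: L_def simp del: of_nat_Suc)
  define B where "B = insert 0 (\<Union>(y, m)\<in>L. {t. t \<noteq> 0 \<and> \<not> generic_arg q p (y * t powi m)})"
  have "countable B"
    unfolding B_def using L
    by (intro countable_insert countable_UN countable_finite[OF \<open>finite L\<close>])
      (auto intro!: countable_not_generic_arg[OF base])
  then obtain t where t: "t \<longlonglongrightarrow> 1" "\<And>n::nat. t n \<notin> B"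
    using countable_avoiding_sequence by blast
  have t0: "t n \<noteq> 0" for n
    using t(2)[of n] by (auto simp: B_def)
  have g: "generic_arg q p (y * t n powi m)" if "(y, m) \<in> L" for y m n
    using t(2)[of n] t0[of n] that by (auto simp: B_def)
  have gp: "generic_arg q p (y * t n ^ m)" if "(y, int m) \<in> L" for y m n
    using g[OF that] by simp
  have gm: "generic_arg q p (y / t n ^ m)" if "(y, - int m) \<in> L" for y m n
    using g[OF that, of n] by (simp add: power_int_minus divide_inverse)
  have "generic_params q p r c (u * t n ^ (S + 1)) (w * t n ^ (2 * S + 3)) (\<lambda>i. x i * t n ^ i)" for n
  proof -
    define s where "s = t n"
    have s0: "s \<noteq> 0" using t0 by (simp add: s_def)
    have X: "prod c {1..r+1} * (\<Prod>i=1..r. x i * s ^ i) = CX * s ^ S"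
      by (simp add: CX_def S_def prod.distrib power_sum del: prod.cl_ivl_Suc)
    note gp = gp[of _ _ n, folded s_def] and gm = gm[of _ _ n, folded s_def] and g = g[of _ _ n, folded s_def]
    show ?thesis
      unfolding generic_params_def s_def[symmetric] X
    proof (intro conjI ballI impI)
      fix i j assume ij: "i \<in> {1..r}" "j \<in> {1..r}" "i \<noteq> j"
      have "x i * s ^ i / (x j * s ^ j) = x i / x j * s powi (int i - int j)"
        using s0 by (simp add: power_int_diff)
      moreover have "(x i / x j, int i - int j) \<in> L"
        unfolding L_def by (intro UnI1, rule image_eqI[of _ _ "(i, j)"]) (use ij in auto)
      ultimately show "generic_arg q p (x i * s ^ i / (x j * s ^ j))"
        using g by (simp only:)
    next
      fix i assume i: "i \<in> {1..r}"
      have "w * s ^ (2 * S + 3) * (x i * s ^ i) = w * x i * s ^ (2 * S + 3 + i)"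
        by (simp add: power_add mult_ac)
      moreover have "(w * x i, int (2 * S + 3 + i)) \<in> L"
        unfolding L_def using i by blast
      ultimately show "generic_arg q p (w * s ^ (2 * S + 3) * (x i * s ^ i))"
        using gp by (simp only:)
      have "u * s ^ (S + 1) * (x i * s ^ i) = u * x i * s ^ (S + 1 + i)"
        by (simp add: power_add mult_ac)
      moreover have "(u * x i, int (S + 1 + i)) \<in> L"
        unfolding L_def using i by blast
      ultimately show "generic_arg q p (u * s ^ (S + 1) * (x i * s ^ i))"
        using gp by (simp only:)
      have "s ^ (S + 1) * s ^ (2 * S + 3) * s ^ i = s ^ S * s ^ (2 * S + 4 + i)"
        unfolding power_add[symmetric] by (simp add: algebra_simps)
      then have "u * s ^ (S + 1) * (w * s ^ (2 * S + 3)) * (x i * s ^ i)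
          = u * w * x i * s ^ (2 * S + 4 + i) * s ^ S"
        by (metis (no_types, lifting) mult.assoc mult.commute mult.left_commute)
      then have "CX * s ^ S / (u * s ^ (S + 1) * (w * s ^ (2 * S + 3)) * (x i * s ^ i))
          = CX / (u * w * x i) / s ^ (2 * S + 4 + i)"
        using s0 by simp
      moreover have "(CX / (u * w * x i), - int (2 * S + 4 + i)) \<in> L"
        unfolding L_def using i by blast
      ultimately show "generic_arg q p (CX * s ^ S / (u * s ^ (S + 1) * (w * s ^ (2 * S + 3)) * (x i * s ^ i)))"
        using gm by (simp only:)
    next
      fix j assume j: "j \<in> {1..r+1}"
      have "(u / c j, int (S + 1)) \<in> (\<lambda>j. (u / c j, int (S + 1))) ` {1..r+1}"
        "(w / c j, int (2 * S + 3)) \<in> (\<lambda>j. (w / c j, int (2 * S + 3))) ` {1..r+1}"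
        using j by (rule image_eqI[OF refl])+
      then have "(u / c j, int (S + 1)) \<in> L" "(w / c j, int (2 * S + 3)) \<in> L"
        unfolding L_def by (simp_all only: Un_iff simp_thms)
      from gp[OF this(1)] gp[OF this(2)]
      show "generic_arg q p (u * s ^ (S + 1) / c j)" "generic_arg q p (w * s ^ (2 * S + 3) / c j)"
        by (simp_all only: times_divide_eq_left)
    next
      have "(w / u, int (S + 2)) \<in> L" "(CX / u, - int 1) \<in> L" "(CX / w, - int (S + 3)) \<in> L"
        unfolding L_def by (simp_all only: Un_iff insert_iff simp_thms)
      note G = gp[OF this(1)] gm[OF this(2)] gm[OF this(3)]
      have "2 * S + 3 = S + 2 + (S + 1)" by simp
      then have "s ^ (2 * S + 3) = s ^ (S + 2) * s ^ (S + 1)"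
        by (simp only: power_add)
      then have "w * s ^ (2 * S + 3) / (u * s ^ (S + 1)) = w / u * s ^ (S + 2)"
        using s0 by simp
      then show "generic_arg q p (w * s ^ (2 * S + 3) / (u * s ^ (S + 1)))"
        using G(1) by (simp only:)
      have "CX * s ^ S / (u * s ^ (S + 1)) = CX / u / s ^ 1"
        using s0 by (simp add: power_add)
      then show "generic_arg q p (CX * s ^ S / (u * s ^ (S + 1)))"
        using G(2) by (simp only:)
      have "2 * S + 3 = S + 3 + S" by simp
      then have "s ^ (2 * S + 3) = s ^ (S + 3) * s ^ S"
        by (simp only: power_add)
      then have "CX * s ^ S / (w * s ^ (2 * S + 3)) = CX / w / s ^ (S + 3)"
        using s0 by simp
      then show "generic_arg q p (CX * s ^ S / (w * s ^ (2 * S + 3)))"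
        using G(3) by (simp only:)
    qed
  qed
  with t t0 that show ?thesis by blast
qed

theorem corollary4p2:
  fixes p q a b d C X :: complex
    and c x :: "nat \<Rightarrow> complex"
    and r N :: nat
  assumes "base_nome q p"
    and "r \<ge> 1"
    and "a \<noteq> 0" "b \<noteq> 0" "d \<noteq> 0"
    and "\<forall>i\<in>{1..r+1}. c i \<noteq> 0"
    and "\<forall>i\<in>{1..r}. x i \<noteq> 0"
    and "C = (\<Prod>i=1..r+1. c i)"
    and "X = (\<Prod>i=1..r. x i)"
    and "a ^ 2 * q ^ (N + 1) = b * C * d * X"
    \<comment> \<open>genericity: no denominator on the left-hand side vanishes\<close>
    and "Delta r p x \<noteq> 0"
    and "jtheta p a \<noteq> 0"
    and "\<forall>k\<in>multi_indices r N.
           efact q p (a * q / b) (msize r k) \<noteq> 0 \<and>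
           efact q p (a * q ^ (N + 1)) (msize r k) \<noteq> 0 \<and>
           (\<forall>i\<in>{1..r}.
              efact q p (d / x i) (msize r k - k i) \<noteq> 0 \<and>
              efact q p (a * x i * q / d) (k i) \<noteq> 0 \<and>
              (\<forall>j\<in>{1..r}. efact q p (q * x i / x j) (k i) \<noteq> 0)) \<and>
           (\<forall>i\<in>{1..r+1}. efact q p (a * c i * q / (C * X)) (msize r k) \<noteq> 0)"
    \<comment> \<open>genericity: no denominator on the right-hand side vanishes\<close>
    and "efact q p (a * q / b) N \<noteq> 0"
    and "\<forall>i\<in>{1..r}. efact q p (a * x i * q / d) N \<noteq> 0"
    and "\<forall>i\<in>{1..r+1}. efact q p (a * q / (b * c i * d)) N \<noteq> 0"
  shows "(\<Sum>k\<in>multi_indices r N.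
            Delta r p (\<lambda>i. x i * q ^ k i) / Delta r p x
            * (jtheta p (a * q ^ (2 * msize r k)) / jtheta p a)
            * ((efact q p a (msize r k) * efact q p b (msize r k)
                  * efact q p (q powi (- int N)) (msize r k))
               / (efact q p (a * q / b) (msize r k)
                  * efact q p (a * q ^ (N + 1)) (msize r k)))
            * q ^ msize r k
            * (\<Prod>i=1..r.
                 (efact q p (a * q / (C * X * x i)) (msize r k - k i)
                    * efact q p (d / x i) (msize r k)
                    * (\<Prod>j=1..r+1. efact q p (c j * x i) (k i)))
                 / (efact q p (d / x i) (msize r k - k i)
                    * efact q p (a * x i * q / d) (k i)
                    * (\<Prod>j=1..r. efact q p (q * x i / x j) (k i))))
            * (\<Prod>i=1..r+1. 1 / efact q p (a * c i * q / (C * X)) (msize r k)))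
         = efact q p (a * q) N / (b ^ N * efact q p (a * q / b) N)
           * (\<Prod>i=1..r. efact q p (a * x i * q / (b * d)) N / efact q p (a * x i * q / d) N)
           * (\<Prod>i=1..r+1. efact q p (a * q / (c i * d)) N / efact q p (a * q / (b * c i * d)) N)"
proof -
  note base = assms(1) and a0 = assms(3) and b0 = assms(4) and d0 = assms(5) and c0 = assms(6)
    and x0 = assms(7) and C = assms(8) and X = assms(9) and rel = assms(10) and den = assms(11-16)
  have p1: "norm p < 1" and q0: "q \<noteq> 0"
    using base by (auto simp: base_nome_def)
  have CX: "C \<noteq> 0" "X \<noteq> 0"
    unfolding C X using c0 x0 by (subst prod_zero_iff; blast)+
  define S where "S = \<Sum>{1..r}"
  define u where "u = C * X / (a * q ^ N)"
  define w where "w = a * q / d"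
  have "u \<noteq> 0" "w \<noteq> 0"
    using a0 d0 q0 CX by (simp_all add: u_def w_def)
  from generic_perturbation[OF base this, of r x c, folded S_def]
  obtain t where t: "t \<longlonglongrightarrow> 1" "\<And>n::nat. t n \<noteq> 0"
    "\<And>n. generic_params q p r c (u * t n ^ (S + 1)) (w * t n ^ (2 * S + 3)) (\<lambda>i. x i * t n ^ i)"
    using c0 x0 by blast
  \<comment> \<open>The exponents are dictated by those of u, w and x through a = C X / (u q^N), d =
    aq/w and b = w/u. Both sides of the relation between the parameters are then multiplied by
    t^(-2), so it persists along the deformation.\<close>
  define an bn dn Xn xn where "an = (\<lambda>n. a / t n)" and "bn = (\<lambda>n. b * t n ^ (S + 2))"
    and "dn = (\<lambda>n. d / t n ^ (2 * S + 4))" and "Xn = (\<lambda>n. X * t n ^ S)"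
    and "xn = (\<lambda>n i. x i * t n ^ i)"
  have Xn: "Xn n = prod (xn n) {1..r}" for n
    by (simp add: Xn_def xn_def X S_def prod.distrib power_sum)
  have lim: "an \<longlonglongrightarrow> a" "bn \<longlonglongrightarrow> b" "dn \<longlonglongrightarrow> d" "Xn \<longlonglongrightarrow> X" "(\<lambda>n. xn n i) \<longlonglongrightarrow> x i" for i
    unfolding an_def bn_def dn_def Xn_def xn_def by (rule tendsto_eq_intros t(1) | simp)+
  have eq: "(\<Sum>k\<in>multi_indices r N. jackson_term q p r N (an n) (bn n) (dn n) C (Xn n) c (xn n) k)
    = jackson_rhs q p r N (an n) (bn n) (dn n) c (xn n)" for n
    unfolding C Xn
  proof (rule jackson_sum_generic[OF base])
    define s where "s = t n"
    have s0: "s \<noteq> 0" using t(2) by (simp add: s_def)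
    show "an n \<noteq> 0" "bn n \<noteq> 0" "dn n \<noteq> 0"
      using a0 b0 d0 t(2) by (simp_all add: an_def bn_def dn_def)
    show "prod c {1..r+1} * prod (xn n) {1..r} \<noteq> 0"
      unfolding C[symmetric] Xn[symmetric] using CX t(2) by (simp add: Xn_def)
    have "2 * S + 4 = S + 2 + S + 2" by simp
    then have pow: "s ^ (2 * S + 4) = s ^ (S + 2) * s ^ S * s ^ 2"
      by (simp only: power_add)
    have alg: "b * A * C * (d / (A * B * Z)) * (X * B) = b * C * d * X / Z"
      if "A \<noteq> 0" "B \<noteq> 0" for A B Z :: complex
      using that by simp
    have "bn n * C * dn n * Xn n = b * C * d * X / s ^ 2"
      unfolding bn_def dn_def Xn_def s_def[symmetric] pow by (rule alg) (use s0 in simp_all)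
    also have "\<dots> = an n ^ 2 * q ^ (N + 1)"
      unfolding rel[symmetric] by (simp add: an_def s_def power_divide)
    finally show "an n ^ 2 * q ^ (N + 1) = bn n * prod c {1..r+1} * dn n * prod (xn n) {1..r}"
      unfolding C[symmetric] Xn[symmetric] ..
    have "C * Xn n / (an n * q ^ N) = u * s ^ (S + 1)"
      by (simp add: Xn_def an_def u_def s_def mult_ac)
    moreover have "s ^ (2 * S + 4) = s ^ (2 * S + 3) * s"
      using power_Suc2[of s "2 * S + 3"] by (simp add: numeral_eq_Suc)
    then have "an n * q / dn n = w * s ^ (2 * S + 3)"
      using s0 by (simp add: an_def dn_def w_def s_def[symmetric])
    ultimately show "generic_params q p r c (prod c {1..r+1} * prod (xn n) {1..r} / (an n * q ^ N)) (an n * q / dn n) (xn n)"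
      unfolding C[symmetric] Xn[symmetric] using t(3)[of n] by (simp only: s_def xn_def)
  qed
  have "(\<lambda>n. \<Sum>k\<in>multi_indices r N. jackson_term q p r N (an n) (bn n) (dn n) C (Xn n) c (xn n) k)
    \<longlonglongrightarrow> (\<Sum>k\<in>multi_indices r N. jackson_term q p r N a b d C X c x k)"
    by (intro tendsto_sum tendsto_jackson_term[OF p1 q0 lim]) (use a0 b0 d0 c0 x0 CX den in blast)+
  moreover have "(\<lambda>n. jackson_rhs q p r N (an n) (bn n) (dn n) c (xn n)) \<longlonglongrightarrow> jackson_rhs q p r N a b d c x"
    by (intro tendsto_jackson_rhs[OF p1 q0 lim(1-3,5)]) (use a0 b0 d0 c0 x0 den in blast)+
  ultimately have "(\<Sum>k\<in>multi_indices r N. jackson_term q p r N a b d C X c x k) = jackson_rhs q p r N a b d c x"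
    unfolding eq by (rule LIMSEQ_unique)
  then show ?thesis
    unfolding jackson_term_def jackson_rhs_def .
qed

end
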